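(* Let $V$ be an $n$-dimensional real vector space with a positive definite inner product $(\cdot|\cdot)$, and let $G\subseteq\operatorname{GL}(V)$ be a Zariski-closed subgroup preserving $(\cdot|\cdot)$ which is a compact torus, i.e. isomorphic as a Lie group to $(S^1)^m$. Fix an isomorphism of algebraic groups $T=(\mathbb C^* )^m\to G_{\mathbb C}$, making $V_{\mathbb C}$ a $T$-representation, and let $X_V\subseteq X(T)=\mathbb Z^m$ be the set of characters $\chi$ with $V_\chi\neq0$. Then: (1) the ED degree of $G$ depends only on $X_V$ and not on the dimensions $\dim V_\chi$, $\chi\in X_V$; that is, if $(V',(\cdot|\cdot)',G')$ is another such datum, with a fixed isomorphism $T\to G'_{\mathbb C}$, whose set of weights $X_{V'}$ equals $X_V$, then $G$ and $G'$ have the same ED degree; (2) the ED degree of $G$ is at most the normalised volume of the convex hull $\Delta\subseteq\mathbb R^m$ of $X_V$, where the normalisation is such that the simplex spanned by $0$ and the standard basis vectors of $\mathbb R^m$ has volume one.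
   Context: For $a\in\operatorname{End}(V)$, $a^t$ denotes the transpose with respect to $(\cdot|\cdot)$. On $\operatorname{End}(V)$ use $\langle a,b\rangle=\operatorname{tr}(a^tb)$, and write $\perp$ for orthogonality with respect to it. Set $V_{\mathbb C}=\mathbb C\otimes_{\mathbb R}V$, let $G_{\mathbb C}$ be the complex points of $G$ and $\mathfrak g_{\mathbb C}$ its complexified Lie algebra, and extend $\langle\cdot,\cdot\rangle$ and transposition $\mathbb C$-bilinearly to $\operatorname{End}_{\mathbb C}(V_{\mathbb C})$. The ED degree of $G$ is the number of solutions $x\in G_{\mathbb C}$ of $x^t(u-x)\perp\mathfrak g_{\mathbb C}$, which is constant for general $u\in\operatorname{End}(V)$ (outside a proper Zariski-closed subset). Characters of $T$ are the homomorphisms $t\mapsto t_1^{a_1}\cdots t_m^{a_m}$, identified with $(a_1,\dots,a_m)\in\mathbb Z^m$; the weight space is $V_\chi=\{v\in V_{\mathbb C}: tv=t^\chi v \ \forall t\in T\}$. *)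

theory Defs
  imports "HOL-Analysis.Analysis"
begin

inductive_set poly_fun :: "(('i \<Rightarrow> 'a::comm_ring_1) \<Rightarrow> 'a) set" where
  const: "(\<lambda>_. c) \<in> poly_fun"
| var: "(\<lambda>x. x i) \<in> poly_fun"
| add: "p \<in> poly_fun \<Longrightarrow> q \<in> poly_fun \<Longrightarrow> (\<lambda>x. p x + q x) \<in> poly_fun"
| mult: "p \<in> poly_fun \<Longrightarrow> q \<in> poly_fun \<Longrightarrow> (\<lambda>x. p x * q x) \<in> poly_fun"

definition mcoords :: "'a^'n^'k \<Rightarrow> ('k \<times> 'n \<Rightarrow> 'a)" where
  "mcoords A = (\<lambda>(i,j). A $ i $ j)"

definition cmat :: "real^'n^'k \<Rightarrow> complex^'n^'k" where
  "cmat A = (\<chi> i j. complex_of_real (A $ i $ j))"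

definition zariski_closed_real :: "(real^'n^'n) set \<Rightarrow> bool" where
  "zariski_closed_real S \<longleftrightarrow>
     (\<forall>x. (\<forall>p\<in>poly_fun. (\<forall>g\<in>S. p (mcoords g) = 0) \<longrightarrow> p (mcoords x) = 0) \<longrightarrow> x \<in> S)"

definition complex_points :: "(real^'n^'n) set \<Rightarrow> (complex^'n^'n) set" where
  "complex_points G = {x. invertible x \<and>
     (\<forall>p\<in>poly_fun. (\<forall>g\<in>G. p (mcoords (cmat g)) = 0) \<longrightarrow> p (mcoords x) = 0)}"

definition lie_alg :: "(real^'n^'n) set \<Rightarrow> (real^'n^'n) set" where
  "lie_alg G = {A. \<exists>\<gamma>. \<gamma> 0 = mat 1 \<and> (\<forall>t. \<gamma> t \<in> G) \<and> (\<gamma> has_vector_derivative A) (at 0)}"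

definition lie_alg_C :: "(real^'n^'n) set \<Rightarrow> (complex^'n^'n) set" where
  "lie_alg_C G = {(\<chi> i j. complex_of_real (A $ i $ j) + \<i> * complex_of_real (B $ i $ j)) | A B.
                   A \<in> lie_alg G \<and> B \<in> lie_alg G}"

text \<open>Transpose with respect to the inner product (v|w) = v^T Q w, extended C-bilinearly,
  and the pairing <a,b> = tr(a^t b).\<close>
definition Qtransp :: "real^'n^'n \<Rightarrow> complex^'n^'n \<Rightarrow> complex^'n^'n" where
  "Qtransp Q a = cmat (matrix_inv Q) ** transpose a ** cmat Q"

definition Qpair :: "real^'n^'n \<Rightarrow> complex^'n^'n \<Rightarrow> complex^'n^'n \<Rightarrow> complex" where
  "Qpair Q a b = trace (Qtransp Q a ** b)"

definition ed_sols :: "real^'n^'n \<Rightarrow> (real^'n^'n) set \<Rightarrow> real^'n^'n \<Rightarrow> (complex^'n^'n) set" where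
  "ed_sols Q G u = {x \<in> complex_points G.
      \<forall>A \<in> lie_alg_C G. Qpair Q (Qtransp Q x ** (cmat u - x)) A = 0}"

definition has_ED_degree :: "real^'n^'n \<Rightarrow> (real^'n^'n) set \<Rightarrow> nat \<Rightarrow> bool" where
  "has_ED_degree Q G d \<longleftrightarrow> (\<exists>p\<in>poly_fun. p \<noteq> (\<lambda>_. 0) \<and>
      (\<forall>u. p (mcoords u) \<noteq> 0 \<longrightarrow> finite (ed_sols Q G u) \<and> card (ed_sols Q G u) = d))"

definition ED_degree :: "real^'n^'n \<Rightarrow> (real^'n^'n) set \<Rightarrow> nat" where
  "ED_degree Q G = (THE d. has_ED_degree Q G d)"

definition torus_T :: "(complex^'m) set" where
  "torus_T = {z. \<forall>i. z $ i \<noteq> 0}"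

definition circle_torus :: "(complex^'m) set" where
  "circle_torus = {z. \<forall>i. cmod (z $ i) = 1}"

definition alg_torus_iso :: "(real^'n^'n) set \<Rightarrow> (complex^'m \<Rightarrow> complex^'n^'n) \<Rightarrow> bool" where
  "alg_torus_iso G \<phi> \<longleftrightarrow>
     bij_betw \<phi> torus_T (complex_points G) \<and>
     (\<forall>s\<in>torus_T. \<forall>t\<in>torus_T. \<phi> (\<chi> i. s $ i * t $ i) = \<phi> s ** \<phi> t) \<and>
     (\<forall>i j. \<exists>p\<in>poly_fun. \<exists>k::nat. \<forall>z\<in>torus_T.
          \<phi> z $ i $ j * (\<Prod>l\<in>UNIV. z $ l) ^ k = p (vec_nth z)) \<and>
     (\<forall>l. \<exists>q\<in>poly_fun. \<forall>x\<in>complex_points G. inv_into torus_T \<phi> x $ l = q (mcoords x))"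

definition torus_datum :: "real^'n^'n \<Rightarrow> (real^'n^'n) set \<Rightarrow> (complex^'m \<Rightarrow> complex^'n^'n) \<Rightarrow> bool" where
  "torus_datum Q G \<phi> \<longleftrightarrow>
     transpose Q = Q \<and> (\<forall>v. v \<noteq> 0 \<longrightarrow> v \<bullet> (Q *v v) > 0) \<and>
     mat 1 \<in> G \<and> (\<forall>g\<in>G. invertible g \<and> matrix_inv g \<in> G) \<and> (\<forall>g\<in>G. \<forall>h\<in>G. g ** h \<in> G) \<and>
     zariski_closed_real G \<and>
     (\<forall>g\<in>G. transpose g ** Q ** g = Q) \<and>
     (\<exists>\<psi>. continuous_on circle_torus \<psi> \<and> bij_betw \<psi> (circle_torus :: (complex^'m) set) G \<and>
          (\<forall>s\<in>circle_torus. \<forall>t\<in>circle_torus. \<psi> (\<chi> i. s $ i * t $ i) = \<psi> s ** \<psi> t)) \<and>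
     alg_torus_iso G \<phi>"

definition weights :: "(complex^'m \<Rightarrow> complex^'n^'n) \<Rightarrow> (int^'m) set" where
  "weights \<phi> = {w. \<exists>v::complex^'n. v \<noteq> 0 \<and>
      (\<forall>t\<in>torus_T. \<phi> t *v v = (\<Prod>i\<in>UNIV. (t $ i) powi (w $ i)) *s v)}"

definition norm_vol :: "(int^'m) set \<Rightarrow> real" where
  "norm_vol X = fact CARD('m) *
     measure lborel (convex hull ((\<lambda>w. \<chi> i. real_of_int (w $ i)) ` X))"

end

theory Submission
  imports Defs
begin

text \<open>
  Over the torus, \<open>\<phi> t = (\<Sum>w. t\<^sup>w P\<^sub>w)\<close> with orthogonal idempotents
  \<open>P\<^sub>w\<close>, and the ED equations for \<open>u\<close> say that \<open>t\<close> is a critical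
  point on the torus of the Laurent polynomial \<open>\<Sum>w. c w t\<^sup>w\<close>, where
  \<open>c w = tr (u\<^sup>t P\<^sub>w)\<close>; the map from \<open>u\<close> to \<open>c\<close> is linear
  and onto. So only the set \<open>X\<close> of weights matters, once the number of critical points is known to
  be constant for generic \<open>c\<close>.

  In the coordinates \<open>b w = c w t\<^sup>w\<close> the pairs (coefficients, critical point) form a linear space
  times the torus, of dimension \<open>card X\<close>. Hence each coordinate \<open>t i\<close>, as well as the Hessian
  determinant, satisfies a polynomial equation over the polynomials in \<open>c\<close>. Where the extreme
  coefficients of these equations do not vanish, all critical points are nondegenerate and stay in a compact part of
  the torus, so their number is locally constant, and it is constant since the complement of finitely many points
  on a complex line is connected.

  For the volume bound, let \<open>L\<close> be the system of \<open>m\<close> equations, \<open>F\<close> a set of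
  nondegenerate solutions and \<open>e t\<close> (\<open>t \<in> F\<close>) Laurent polynomials separating them. As \<open>L\<close> gives
  local coordinates at each \<open>t \<in> F\<close>, the products \<open>e t * L\<^sup>a\<close> with
  \<open>\<bar>a\<bar> \<le> k\<close> are linearly independent. Their exponents lie in a dilate of the polytope by
  \<open>k + O(1)\<close>, and comparing \<open>card F * k\<^sup>m / m!\<close> with the number of lattice points gives the
  bound as \<open>k\<close> tends to infinity.
\<close>

section \<open>Linear relations and polynomial functions\<close>

text \<open>Two features of the data shape the proof. The isomorphism \<open>\<phi>\<close> is tied
  to \<open>G\<close> only through the complex points; that it matches \<open>G\<close> with the
  unit torus must be derived from compactness and Zariski density before the Lie algebra can be
  computed. And genericity is asked of real matrices \<open>u\<close>, whereas the coefficients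
  \<open>c w\<close> are complex. Orthogonality removes the quadratic part of the ED equations:
  \<open>x\<^sup>t x\<close> is the identity and the Lie algebra is trace-free, so the equations are
  linear in \<open>u\<close>. It also makes the set of weights symmetric, so that 0 is interior to
  the polytope and its dilates are nested. Dimension theory is replaced by counting: more functions
  than spanning monomials force a linear relation. One such count gives the volume bound, another
  the algebraic dependence. The Hessian determinant needs extra care. Unlike the coordinates
  \<open>t i\<close> it may vanish at a solution, so its powers cannot simply be cancelled from a
  relation. Symmetry of the weights puts \<open>b = 1\<close> into the linear space, where the
  determinant is not 0, and this makes the cancellation legitimate.\<close>

lemma exists_linear_relation:
  fixes a :: "'i \<Rightarrow> 'j \<Rightarrow> 'a::field"
  assumes "finite J" "finite I" "card J < card I"
  shows "\<exists>y. (\<exists>i\<in>I. y i \<noteq> 0) \<and> (\<forall>j\<in>J. (\<Sum>i\<in>I. y i * a i j) = 0)"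
  using assms
proof (induction J arbitrary: I a rule: finite_induct)
  case empty
  then have "I \<noteq> {}" by auto
  then show ?case by (intro exI[of _ "\<lambda>_. 1"]) auto
next
  case (insert j J)
  show ?case
  proof (cases "\<forall>i\<in>I. a i j = 0")
    case True
    obtain y where "\<exists>i\<in>I. y i \<noteq> 0" "\<forall>j\<in>J. (\<Sum>i\<in>I. y i * a i j) = 0"
      using insert.IH[of I a] insert.prems insert.hyps by auto
    then show ?thesis using True by (intro exI[of _ y]) auto
  next
    case False
    then obtain k where k: "k \<in> I" "a k j \<noteq> 0" by auto
    define I' where "I' = I - {k}"
    have I': "finite I'" "k \<notin> I'" "I = insert k I'" using k insert.prems by (auto simp: I'_def)
    have "card J < card I'" using insert.prems insert.hyps k by (simp add: I'_def)
    from insert.IH[OF I'(1) this, of "\<lambda>i l. a i l - a i j / a k j * a k l"] obtain y where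
      y: "\<exists>i\<in>I'. y i \<noteq> 0" "\<And>l. l \<in> J \<Longrightarrow> (\<Sum>i\<in>I'. y i * (a i l - a i j / a k j * a k l)) = 0"
      by auto
    \<comment> \<open>The coefficient of the pivot row \<open>k\<close> is chosen to satisfy
      equation \<open>j\<close>; the other equations then hold because the induction hypothesis was
      applied to the rows with column \<open>j\<close> cleared.\<close>
    define z where "z = (\<lambda>i. if i = k then - (\<Sum>i\<in>I'. y i * a i j) / a k j else y i)"
    have z: "(\<Sum>i\<in>I. z i * a i l) = - (\<Sum>i\<in>I'. y i * a i j) / a k j * a k l + (\<Sum>i\<in>I'. y i * a i l)" for l
    proof -
      have "(\<Sum>i\<in>I'. z i * a i l) = (\<Sum>i\<in>I'. y i * a i l)"
        using I'(2) by (intro sum.cong) (auto simp: z_def)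
      then show ?thesis using I' by (simp add: z_def)
    qed
    have "(\<Sum>i\<in>I. z i * a i l) = 0" if "l \<in> insert j J" for l
    proof (cases "l = j")
      case True
      then show ?thesis using k by (simp add: z)
    next
      case False
      then have "0 = (\<Sum>i\<in>I'. y i * a i l - y i * a i j * (a k l / a k j))"
        using y(2)[of l] that by (simp add: algebra_simps)
      also have "\<dots> = (\<Sum>i\<in>I'. y i * a i l) - (\<Sum>i\<in>I'. y i * a i j) * (a k l / a k j)"
        by (simp add: sum_subtractf sum_distrib_right sum_divide_distrib mult.assoc)
      finally show ?thesis by (simp add: z)
    qed
    moreover have "\<exists>i\<in>I. z i \<noteq> 0" using y(1) I' by (auto simp: z_def)
    ultimately show ?thesis by blast
  qed
qed

text \<open>Agreement is demanded on \<open>\<Omega>\<close> only. With the torus or the incidence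
  variety for \<open>\<Omega>\<close> this is a span of restricted functions, without passing to a
  quotient of the function ring.\<close>

definition span_on :: "'w set \<Rightarrow> ('j \<Rightarrow> 'w \<Rightarrow> 'a::comm_ring_1) \<Rightarrow> 'j set \<Rightarrow> ('w \<Rightarrow> 'a) set" where
  "span_on \<Omega> m J = {f. \<exists>x. \<forall>w\<in>\<Omega>. f w = (\<Sum>j\<in>J. x j * m j w)}"

lemma span_on_cong:
  assumes "f \<in> span_on \<Omega> m J" "\<And>w. w \<in> \<Omega> \<Longrightarrow> f w = g w"
  shows "g \<in> span_on \<Omega> m J"
  using assms unfolding span_on_def by auto

lemma span_on_generator:
  assumes "finite J" "j \<in> J"
  shows "m j \<in> span_on \<Omega> m J"
proof -
  have "(\<Sum>k\<in>J. (if k = j then 1 else 0) * m k w) = m j w" for w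
    using assms by (simp add: if_distrib[of "\<lambda>x. x * _"] cong: if_cong)
  then show ?thesis unfolding span_on_def by (auto intro!: exI[of _ "\<lambda>k. if k = j then 1 else 0"])
qed

lemma span_on_scale:
  assumes "f \<in> span_on \<Omega> m J"
  shows "(\<lambda>w. c * f w) \<in> span_on \<Omega> m J"
proof -
  obtain x where "\<forall>w\<in>\<Omega>. f w = (\<Sum>j\<in>J. x j * m j w)" using assms by (auto simp: span_on_def)
  then have "\<forall>w\<in>\<Omega>. c * f w = (\<Sum>j\<in>J. (c * x j) * m j w)" by (simp add: sum_distrib_left mult.assoc)
  then show ?thesis unfolding span_on_def by (auto intro!: exI[of _ "\<lambda>j. c * x j"])
qed

lemma span_on_zero: "(\<lambda>_. 0) \<in> span_on \<Omega> m J"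
  unfolding span_on_def by (auto intro!: exI[of _ "\<lambda>_. 0"])

lemma span_on_add:
  assumes "f \<in> span_on \<Omega> m J" "g \<in> span_on \<Omega> m J"
  shows "(\<lambda>w. f w + g w) \<in> span_on \<Omega> m J"
proof -
  obtain x y where "\<forall>w\<in>\<Omega>. f w = (\<Sum>j\<in>J. x j * m j w)" "\<forall>w\<in>\<Omega>. g w = (\<Sum>j\<in>J. y j * m j w)"
    using assms by (auto simp: span_on_def)
  then have "\<forall>w\<in>\<Omega>. f w + g w = (\<Sum>j\<in>J. (x j + y j) * m j w)"
    by (simp add: sum.distrib algebra_simps)
  then show ?thesis unfolding span_on_def by (auto intro!: exI[of _ "\<lambda>j. x j + y j"])
qed

lemma span_on_sum:
  assumes "\<And>i. i \<in> I \<Longrightarrow> f i \<in> span_on \<Omega> m J"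
  shows "(\<lambda>w. \<Sum>i\<in>I. f i w) \<in> span_on \<Omega> m J"
  using assms by (induction I rule: infinite_finite_induct) (auto simp: span_on_zero span_on_add)

lemma span_on_mono:
  assumes "f \<in> span_on \<Omega> m J" "J \<subseteq> K" "finite K"
  shows "f \<in> span_on \<Omega> m K"
proof -
  obtain x where x: "\<forall>w\<in>\<Omega>. f w = (\<Sum>j\<in>J. x j * m j w)" using assms by (auto simp: span_on_def)
  have "(\<lambda>w. \<Sum>j\<in>J. x j * m j w) \<in> span_on \<Omega> m K"
    using assms by (intro span_on_sum span_on_scale span_on_generator) auto
  then show ?thesis by (rule span_on_cong) (use x in auto)
qed

lemma span_on_mult:
  assumes "f \<in> span_on \<Omega> m J" "g \<in> span_on \<Omega> m K"
    and "\<And>j k. j \<in> J \<Longrightarrow> k \<in> K \<Longrightarrow> (\<lambda>w. m j w * m k w) \<in> span_on \<Omega> m L"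
  shows "(\<lambda>w. f w * g w) \<in> span_on \<Omega> m L"
proof -
  obtain x y where xy: "\<forall>w\<in>\<Omega>. f w = (\<Sum>j\<in>J. x j * m j w)" "\<forall>w\<in>\<Omega>. g w = (\<Sum>k\<in>K. y k * m k w)"
    using assms by (auto simp: span_on_def)
  have "(\<lambda>w. \<Sum>j\<in>J. \<Sum>k\<in>K. (x j * y k) * (m j w * m k w)) \<in> span_on \<Omega> m L"
    using assms(3) by (intro span_on_sum span_on_scale) auto
  then show ?thesis
    by (rule span_on_cong) (simp add: xy sum_product algebra_simps)
qed

text \<open>The counting principle that stands in for dimension theory. The family \<open>m\<close>
  may itself be dependent: it suffices that the relation kills the chosen coordinate
  vectors.\<close>

lemma span_on_linear_relation:
  fixes f :: "'i \<Rightarrow> 'w \<Rightarrow> 'a::field"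
  assumes "finite J" "finite I" "card J < card I" "\<And>i. i \<in> I \<Longrightarrow> f i \<in> span_on \<Omega> m J"
  shows "\<exists>y. (\<exists>i\<in>I. y i \<noteq> 0) \<and> (\<forall>w\<in>\<Omega>. (\<Sum>i\<in>I. y i * f i w) = 0)"
proof -
  obtain a where a: "\<And>i w. i \<in> I \<Longrightarrow> w \<in> \<Omega> \<Longrightarrow> f i w = (\<Sum>j\<in>J. a i j * m j w)"
  proof -
    have "\<exists>x. \<forall>i\<in>I. \<forall>w\<in>\<Omega>. f i w = (\<Sum>j\<in>J. x i j * m j w)"
      by (rule bchoice) (use assms(4) in \<open>auto simp: span_on_def\<close>)
    then show ?thesis using that by blast
  qed
  obtain y where y: "\<exists>i\<in>I. y i \<noteq> 0" "\<And>j. j \<in> J \<Longrightarrow> (\<Sum>i\<in>I. y i * a i j) = 0"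
    using exists_linear_relation[OF assms(1-3), of a] by blast
  have "(\<Sum>i\<in>I. y i * f i w) = 0" if "w \<in> \<Omega>" for w
  proof -
    have "(\<Sum>i\<in>I. y i * f i w) = (\<Sum>i\<in>I. \<Sum>j\<in>J. y i * a i j * m j w)"
      using a that by (intro sum.cong) (auto simp: sum_distrib_left mult.assoc)
    also have "\<dots> = (\<Sum>j\<in>J. (\<Sum>i\<in>I. y i * a i j) * m j w)"
      by (subst sum.swap) (simp add: sum_distrib_right)
    finally show ?thesis using y(2) by simp
  qed
  then show ?thesis using y(1) by blast
qed

text \<open>\<open>A k\<close> plays the role of the functions of degree at most \<open>k\<close>.
  The filtrations in question are the Laurent polynomials supported in the dilates of the polytope
  and \<open>chart_span\<close>.\<close>

lemma filtration_power:
  fixes A :: "nat \<Rightarrow> ('w \<Rightarrow> 'a::comm_ring_1) set"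
  assumes "(\<lambda>_. 1) \<in> A 0" "\<And>k l f g. f \<in> A k \<Longrightarrow> g \<in> A l \<Longrightarrow> (\<lambda>x. f x * g x) \<in> A (k + l)" "f \<in> A k"
  shows "(\<lambda>x. f x ^ n) \<in> A (n * k)"
proof (induction n)
  case (Suc n)
  from assms(2)[OF assms(3) Suc] show ?case by simp
qed (use assms(1) in simp)

lemma filtration_prod:
  fixes A :: "nat \<Rightarrow> ('w \<Rightarrow> 'a::comm_ring_1) set"
  assumes "(\<lambda>_. 1) \<in> A 0" "\<And>k l f g. f \<in> A k \<Longrightarrow> g \<in> A l \<Longrightarrow> (\<lambda>x. f x * g x) \<in> A (k + l)"
    and "finite I" "\<And>i. i \<in> I \<Longrightarrow> f i \<in> A (k i)"
  shows "(\<lambda>x. \<Prod>i\<in>I. f i x) \<in> A (sum k I)"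
  using assms(3,4)
proof (induction I rule: finite_induct)
  case (insert i I)
  then have "f i \<in> A (k i)" "(\<lambda>x. \<Prod>i\<in>I. f i x) \<in> A (sum k I)" by auto
  from assms(2)[OF this] insert.hyps show ?case by simp
qed (use assms(1) in simp)

lemma power_sum_zero_imp_coeff_zero:
  fixes x :: "nat \<Rightarrow> 'a::{idom,ring_char_0}"
  assumes "\<And>s. (\<Sum>j<k. x j * s ^ j) = 0" "j < k"
  shows "x j = 0"
proof -
  let ?P = "\<Sum>j<k. monom (x j) j"
  have "poly ?P s = 0" for s
    using assms(1)[of s] by (simp add: poly_sum poly_monom)
  then have "?P = 0" using poly_all_0_iff_0 by blast
  then have "coeff ?P j = 0" by simp
  then show ?thesis using assms(2) by (simp add: coeff_sum)
qed

text \<open>Induction on the variables: with the others fixed, the sum is a univariate polynomial in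
  the new one, so each of its coefficients vanishes. The variables range over a finite
  \<open>S\<close> inside a possibly infinite type because the polynomials in \<open>c\<close> are
  indexed by all of \<open>int^'m\<close>.\<close>

lemma box_monomials_independent:
  fixes x :: "('i \<Rightarrow> nat) \<Rightarrow> 'a::{idom,ring_char_0}"
  assumes "finite S"
    and "\<And>c. (\<Sum>a\<in>PiE S (\<lambda>_. {..<k}). x a * (\<Prod>i\<in>S. c i ^ a i)) = 0"
    and "a \<in> PiE S (\<lambda>_. {..<k})"
  shows "x a = 0"
  using assms
proof (induction S arbitrary: x a rule: finite_induct)
  case empty
  then show ?case by auto
next
  case (insert j S)
  let ?B = "PiE S (\<lambda>_. {..<k})"
  have inj: "inj_on (\<lambda>(y, g). g(j := y)) ({..<k} \<times> ?B)"
    using inj_combinator[OF insert.hyps(2), of "\<lambda>_. {..<k}"] by simp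
  have img: "PiE (insert j S) (\<lambda>_. {..<k}) = (\<lambda>(y, g). g(j := y)) ` ({..<k} \<times> ?B)"
    using PiE_insert_eq[of j S "\<lambda>_. {..<k}"] by simp
  have "(\<Sum>b\<in>?B. x (b(j := l)) * (\<Prod>i\<in>S. c i ^ b i)) = 0" if "l < k" for l c
  proof (rule power_sum_zero_imp_coeff_zero[OF _ that])
    fix s
    have "0 = (\<Sum>a\<in>PiE (insert j S) (\<lambda>_. {..<k}). x a * (\<Prod>i\<in>insert j S. (c(j := s)) i ^ a i))"
      using insert.prems(1) by simp
    also have "\<dots> = (\<Sum>(y, b)\<in>{..<k} \<times> ?B. x (b(j := y)) * (\<Prod>i\<in>insert j S. (c(j := s)) i ^ (b(j := y)) i))"
      unfolding img by (subst sum.reindex[OF inj]) (simp add: case_prod_unfold)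
    also have "\<dots> = (\<Sum>(y, b)\<in>{..<k} \<times> ?B. x (b(j := y)) * ((\<Prod>i\<in>S. c i ^ b i) * s ^ y))"
    proof (intro sum.cong refl, clarify)
      fix y b
      have "(\<Prod>i\<in>S. (c(j := s)) i ^ (b(j := y)) i) = (\<Prod>i\<in>S. c i ^ b i)"
        using insert.hyps by (intro prod.cong) auto
      then show "x (b(j := y)) * (\<Prod>i\<in>insert j S. (c(j := s)) i ^ (b(j := y)) i) = x (b(j := y)) * ((\<Prod>i\<in>S. c i ^ b i) * s ^ y)"
        using insert.hyps by (simp add: mult.commute)
    qed
    also have "\<dots> = (\<Sum>y<k. \<Sum>b\<in>?B. x (b(j := y)) * ((\<Prod>i\<in>S. c i ^ b i) * s ^ y))"
      by (simp add: sum.cartesian_product)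
    also have "\<dots> = (\<Sum>y<k. (\<Sum>b\<in>?B. x (b(j := y)) * (\<Prod>i\<in>S. c i ^ b i)) * s ^ y)"
      by (simp add: sum_distrib_right mult.assoc)
    finally show "(\<Sum>y<k. (\<Sum>b\<in>?B. x (b(j := y)) * (\<Prod>i\<in>S. c i ^ b i)) * s ^ y) = 0" by simp
  qed
  note IH = insert.IH[OF this]
  from insert.prems(2) obtain l b where "l < k" "b \<in> ?B" "a = b(j := l)" unfolding img by auto
  then show ?case using IH by simp
qed

lemma monomials_independent:
  fixes x :: "('i::finite \<Rightarrow> nat) \<Rightarrow> 'a::{idom,ring_char_0}"
  assumes "finite A" and "\<And>c. (\<Sum>a\<in>A. x a * (\<Prod>i\<in>UNIV. c i ^ a i)) = 0" and "a \<in> A"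
  shows "x a = 0"
proof -
  define k where "k = Suc (Max ((\<lambda>(a, i). a i) ` (A \<times> UNIV)))"
  have "b i < k" if "b \<in> A" for b i
    unfolding k_def less_Suc_eq_le by (rule Max_ge) (use assms(1) that in auto)
  then have sub: "A \<subseteq> PiE UNIV (\<lambda>_. {..<k})" by (auto simp: PiE_def)
  define y where "y a = (if a \<in> A then x a else 0)" for a
  have "(\<Sum>a\<in>PiE UNIV (\<lambda>_. {..<k}). y a * (\<Prod>i\<in>UNIV. c i ^ a i)) = 0" for c
  proof -
    have "(\<Sum>a\<in>A. x a * (\<Prod>i\<in>UNIV. c i ^ a i)) = (\<Sum>a\<in>PiE UNIV (\<lambda>_. {..<k}). y a * (\<Prod>i\<in>UNIV. c i ^ a i))"
      by (rule sum.mono_neutral_cong_left) (use sub in \<open>auto simp: y_def intro!: finite_PiE\<close>)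
    then show ?thesis using assms(2)[of c] by simp
  qed
  from box_monomials_independent[OF _ this, of a] sub assms(3) have "y a = 0" by auto
  then show ?thesis using assms(3) by (simp add: y_def)
qed

section \<open>Polynomial functions and their restrictions to lines\<close>

lemma poly_fun_sum: "(\<And>i. i \<in> I \<Longrightarrow> f i \<in> poly_fun) \<Longrightarrow> (\<lambda>x. \<Sum>i\<in>I. f i x) \<in> poly_fun"
  by (induction I rule: infinite_finite_induct) (auto intro: poly_fun.intros)

lemma poly_fun_prod: "(\<And>i. i \<in> I \<Longrightarrow> f i \<in> poly_fun) \<Longrightarrow> (\<lambda>x. \<Prod>i\<in>I. f i x) \<in> poly_fun"
  by (induction I rule: infinite_finite_induct) (auto intro: poly_fun.intros)

lemma poly_fun_power: "f \<in> poly_fun \<Longrightarrow> (\<lambda>x. f x ^ k) \<in> poly_fun"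
  by (induction k) (auto intro: poly_fun.intros)

lemma poly_fun_diff:
  assumes "f \<in> poly_fun" "g \<in> poly_fun"
  shows "(\<lambda>x. f x - g x) \<in> poly_fun"
proof -
  have "(\<lambda>x. f x + (- 1) * g x) \<in> poly_fun" using assms by (intro poly_fun.intros)
  then show ?thesis by simp
qed

lemma poly_fun_compose:
  assumes "p \<in> poly_fun" "\<And>i. q i \<in> poly_fun"
  shows "(\<lambda>x. p (\<lambda>i. q i x)) \<in> poly_fun"
  using assms(1) by induction (auto intro: poly_fun.intros assms(2))

text \<open>Restriction to a line reduces questions of genericity and of continuity to univariate
  polynomials, whatever the index type.\<close>

lemma poly_fun_on_line:
  fixes p :: "('i \<Rightarrow> 'a::comm_ring_1) \<Rightarrow> 'a"
  assumes "p \<in> poly_fun"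
  shows "\<exists>P. \<forall>s. p (\<lambda>i. x i + s * v i) = poly P s"
  using assms
proof induction
  case (const c)
  show ?case by (intro exI[of _ "[:c:]"]) simp
next
  case (var i)
  show ?case by (intro exI[of _ "[:x i, v i:]"]) simp
next
  case (add p q)
  then obtain P R where "\<forall>s. p (\<lambda>i. x i + s * v i) = poly P s" "\<forall>s. q (\<lambda>i. x i + s * v i) = poly R s" by auto
  then show ?case by (intro exI[of _ "P + R"]) simp
next
  case (mult p q)
  then obtain P R where "\<forall>s. p (\<lambda>i. x i + s * v i) = poly P s" "\<forall>s. q (\<lambda>i. x i + s * v i) = poly R s" by auto
  then show ?case by (intro exI[of _ "P * R"]) simp
qed

lemma poly_fun_line_zeros_finite:
  fixes p :: "('i \<Rightarrow> 'a::idom) \<Rightarrow> 'a"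
  assumes "p \<in> poly_fun" "p (\<lambda>i. x i + r * v i) \<noteq> 0"
  shows "finite {s. p (\<lambda>i. x i + s * v i) = 0}"
proof -
  obtain P where "\<forall>s. p (\<lambda>i. x i + s * v i) = poly P s" using poly_fun_on_line[OF assms(1)] by blast
  moreover from this assms(2) have "P \<noteq> 0" by auto
  ultimately show ?thesis using poly_roots_finite[of P] by simp
qed

text \<open>Irreducibility of affine space in explicit form: on the line joining \<open>x\<close>
  and \<open>y\<close> both polynomials have finitely many zeros. That the common point lies on this
  line is used later, where the line must stay inside a linear subspace.\<close>

lemma poly_fun_common_nonzero:
  fixes p q :: "('i \<Rightarrow> 'a::{idom,ring_char_0}) \<Rightarrow> 'a"
  assumes "p \<in> poly_fun" "q \<in> poly_fun" "p x \<noteq> 0" "q y \<noteq> 0"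
  shows "\<exists>s. p (\<lambda>i. x i + s * (y i - x i)) \<noteq> 0 \<and> q (\<lambda>i. x i + s * (y i - x i)) \<noteq> 0"
proof -
  have "finite {s. p (\<lambda>i. x i + s * (y i - x i)) = 0}"
    by (rule poly_fun_line_zeros_finite[where r = 0]) (use assms in auto)
  moreover have "finite {s. q (\<lambda>i. x i + s * (y i - x i)) = 0}"
    by (rule poly_fun_line_zeros_finite[where r = 1]) (use assms in auto)
  ultimately have "finite ({s. p (\<lambda>i. x i + s * (y i - x i)) = 0} \<union> {s. q (\<lambda>i. x i + s * (y i - x i)) = 0})"
    by simp
  moreover have "infinite (UNIV :: 'a set)" by (simp add: infinite_UNIV_char_0)
  ultimately obtain s where "s \<notin> {s. p (\<lambda>i. x i + s * (y i - x i)) = 0} \<union> {s. q (\<lambda>i. x i + s * (y i - x i)) = 0}"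
    using ex_new_if_finite by blast
  then show ?thesis by blast
qed

lemma poly_fun_mult_nonzero:
  fixes p q :: "('i \<Rightarrow> 'a::{idom,ring_char_0}) \<Rightarrow> 'a"
  assumes "p \<in> poly_fun" "q \<in> poly_fun" "p \<noteq> (\<lambda>_. 0)" "q \<noteq> (\<lambda>_. 0)"
  shows "(\<lambda>x. p x * q x) \<noteq> (\<lambda>_. 0)"
proof -
  obtain x y where "p x \<noteq> 0" "q y \<noteq> 0" using assms(3,4) by (auto simp: fun_eq_iff)
  then obtain z where "p z \<noteq> 0 \<and> q z \<noteq> 0"
    using poly_fun_common_nonzero[of p q x y] assms(1,2) by blast
  then show ?thesis by (metis mult_eq_0_iff)
qed

lemma poly_fun_prod_nonzero:
  fixes p :: "'j \<Rightarrow> ('i \<Rightarrow> 'a::{idom,ring_char_0}) \<Rightarrow> 'a"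
  assumes "finite J" "\<And>j. j \<in> J \<Longrightarrow> p j \<in> poly_fun" "\<And>j. j \<in> J \<Longrightarrow> p j \<noteq> (\<lambda>_. 0)"
  shows "(\<lambda>x. \<Prod>j\<in>J. p j x) \<noteq> (\<lambda>_. 0)"
  using assms
proof (induction J rule: finite_induct)
  case empty
  then show ?case by (simp add: fun_eq_iff)
next
  case (insert j J)
  have "(\<lambda>x. p j x * (\<Prod>j\<in>J. p j x)) \<noteq> (\<lambda>_. 0)"
    by (rule poly_fun_mult_nonzero) (simp_all add: insert poly_fun_prod)
  then show ?case using insert.hyps by simp
qed

lemma poly_fun_normal_form:
  fixes p :: "('i::finite \<Rightarrow> 'a::comm_ring_1) \<Rightarrow> 'a"
  assumes "p \<in> poly_fun"
  shows "\<exists>A. finite A \<and> p \<in> span_on UNIV (\<lambda>a z. \<Prod>i\<in>UNIV. z i ^ a i) A"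
  using assms
proof induction
  case (const c)
  have "(\<lambda>_. c * 1) \<in> span_on UNIV (\<lambda>a z. \<Prod>i\<in>UNIV. z i ^ a i) {\<lambda>i::'i. 0}"
    by (rule span_on_scale, rule span_on_cong[OF span_on_generator]) auto
  then show ?case by (intro exI[of _ "{\<lambda>i. 0}"]) auto
next
  case (var i)
  have "(\<lambda>z. z i) \<in> span_on UNIV (\<lambda>a z. \<Prod>i\<in>UNIV. z i ^ a i) {\<lambda>l::'i. if l = i then 1 else 0}"
    by (intro span_on_cong[OF span_on_generator[of "{\<lambda>l. if l = i then 1 else 0}" "\<lambda>l. if l = i then 1 else 0" "\<lambda>a z. \<Prod>i\<in>UNIV. z i ^ a i"]])
      (simp_all add: if_distrib[of "power _"] cong: if_cong)
  then show ?case by (intro exI[of _ "{\<lambda>l. if l = i then 1 else 0}"]) auto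
next
  case (add p q)
  then obtain A B where "finite A" "finite B"
     "p \<in> span_on UNIV (\<lambda>a z. \<Prod>i\<in>UNIV. z i ^ a i) A" "q \<in> span_on UNIV (\<lambda>a z. \<Prod>i\<in>UNIV. z i ^ a i) B" by blast
  then show ?case by (intro exI[of _ "A \<union> B"] conjI span_on_add) (auto intro: span_on_mono)
next
  case (mult p q)
  then obtain A B where AB: "finite A" "finite B"
     "p \<in> span_on UNIV (\<lambda>a z. \<Prod>i\<in>UNIV. z i ^ a i) A" "q \<in> span_on UNIV (\<lambda>a z. \<Prod>i\<in>UNIV. z i ^ a i) B" by blast
  let ?C = "(\<lambda>(a, b) i. a i + b i) ` (A \<times> B)"
  have "(\<lambda>z. p z * q z) \<in> span_on UNIV (\<lambda>a z. \<Prod>i\<in>UNIV. z i ^ a i) ?C"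
  proof (rule span_on_mult[OF AB(3,4)])
    fix a b assume "a \<in> A" "b \<in> B"
    then have "(\<lambda>i. a i + b i) \<in> ?C" by force
    from span_on_generator[OF _ this, of "\<lambda>a z. \<Prod>i\<in>UNIV. z i ^ a i" UNIV] AB
    show "(\<lambda>w. (\<Prod>i\<in>UNIV. w i ^ a i) * (\<Prod>i\<in>UNIV. w i ^ b i)) \<in> span_on UNIV (\<lambda>a z. \<Prod>i\<in>UNIV. z i ^ a i) ?C"
      by (auto simp: power_add prod.distrib)
  qed
  then show ?case using AB by (intro exI[of _ ?C]) auto
qed

section \<open>Laurent monomials on the torus\<close>

definition lmon :: "int^'m \<Rightarrow> complex^'m \<Rightarrow> complex" where
  "lmon w t = (\<Prod>i\<in>UNIV. (t $ i) powi (w $ i))"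

definition tmul :: "complex^'m \<Rightarrow> complex^'m \<Rightarrow> complex^'m" where
  "tmul s t = (\<chi> i. s $ i * t $ i)"

definition texp :: "complex^'m \<Rightarrow> complex^'m" where
  "texp z = (\<chi> i. exp (z $ i))"

lemma lmon_add: "t \<in> torus_T \<Longrightarrow> lmon (v + w) t = lmon v t * lmon w t"
  by (simp add: lmon_def torus_T_def power_int_add prod.distrib)

lemma lmon_zero [simp]: "lmon 0 t = 1"
  by (simp add: lmon_def)

lemma lmon_nonzero: "t \<in> torus_T \<Longrightarrow> lmon w t \<noteq> 0"
  by (simp add: lmon_def torus_T_def)

lemma lmon_uminus: "lmon (- w) t = inverse (lmon w t)"
  by (simp add: lmon_def power_int_minus prod_inversef[unfolded o_def, symmetric])

lemma lmon_tmul: "lmon w (tmul s t) = lmon w s * lmon w t"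
  by (simp add: lmon_def tmul_def power_int_mult_distrib prod.distrib)

lemma lmon_inverse: "lmon w (\<chi> i. inverse (t $ i)) = inverse (lmon w t)"
  by (simp add: lmon_def power_int_inverse prod_inversef[unfolded o_def, symmetric])

lemma lmon_texp: "lmon w (texp z) = exp (\<Sum>i\<in>UNIV. of_int (w $ i) * z $ i)"
  by (simp add: lmon_def texp_def exp_sum exp_power_int)

lemma lmon_one [simp]: "lmon w 1 = 1"
  by (simp add: lmon_def)

lemma lmon_axis: "lmon (axis i 1) t = t $ i"
proof -
  have "lmon (axis i 1) t = (\<Prod>l\<in>UNIV. if l = i then t $ l else 1)"
    unfolding lmon_def by (intro prod.cong) (auto simp: axis_def)
  then show ?thesis by simp
qed

lemma torus_T_tmul: "s \<in> torus_T \<Longrightarrow> t \<in> torus_T \<Longrightarrow> tmul s t \<in> torus_T"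
  by (simp add: torus_T_def tmul_def)

lemma torus_T_texp: "texp z \<in> torus_T"
  by (simp add: torus_T_def texp_def)

lemma torus_T_one: "1 \<in> torus_T"
  by (simp add: torus_T_def)

lemma torus_T_inverse: "t \<in> torus_T \<Longrightarrow> (\<chi> i. inverse (t $ i)) \<in> torus_T"
  by (simp add: torus_T_def)

text \<open>The exponents are made strictly positive, not merely nonnegative, so that the cleared
  monomials all vanish on the coordinate hyperplanes; this is the purpose of the summand 1 in
  \<open>k\<close>. Injectivity of \<open>e\<close> keeps distinct weights distinct.\<close>

lemma lmon_clear_denominators:
  fixes A :: "(int^'m) set"
  assumes "finite A"
  shows "\<exists>k e. inj_on e A \<and> (\<forall>w\<in>A. \<forall>i. 0 < e w i) \<and>
    (\<forall>w\<in>A. \<forall>t\<in>torus_T. lmon k t * lmon w t = (\<Prod>i\<in>UNIV. (t $ i) ^ e w i))"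
proof -
  define k where "k = 1 + (\<Sum>w\<in>A. \<Sum>i\<in>UNIV. \<bar>w $ i\<bar>)"
  have k: "0 < v $ i + k" if "v \<in> A" for v i
  proof -
    have "\<bar>v $ i\<bar> \<le> (\<Sum>i\<in>UNIV. \<bar>v $ i\<bar>)" by (rule member_le_sum) auto
    also have "\<dots> \<le> (\<Sum>w\<in>A. \<Sum>i\<in>UNIV. \<bar>w $ i\<bar>)"
      by (rule member_le_sum[OF that]) (auto intro: sum_nonneg assms)
    finally show ?thesis by (simp add: k_def)
  qed
  define e where "e v = (\<lambda>i. nat (v $ i + k))" for v :: "int^'m"
  have "inj_on e A"
  proof (rule inj_onI)
    fix v u assume vu: "v \<in> A" "u \<in> A" "e v = e u"
    have "v $ i = u $ i" for i
      using fun_cong[OF vu(3), of i] k[OF vu(1), of i] k[OF vu(2), of i] by (simp add: e_def)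
    then show "v = u" by (simp add: vec_eq_iff)
  qed
  moreover have "lmon (\<chi> i. k) t * lmon w t = (\<Prod>i\<in>UNIV. (t $ i) ^ e w i)" if "w \<in> A" "t \<in> torus_T" for w t
  proof -
    have "(t $ i) ^ e w i = (t $ i) powi (((\<chi> i. k) + w) $ i)" for i
      using k[OF that(1), of i] by (simp add: e_def power_int_def add.commute)
    then have "(\<Prod>i\<in>UNIV. (t $ i) ^ e w i) = lmon ((\<chi> i. k) + w) t" by (simp add: lmon_def)
    then show ?thesis using that(2) by (simp add: lmon_add)
  qed
  moreover have "\<forall>w\<in>A. \<forall>i. 0 < e w i" using k by (simp add: e_def)
  ultimately show ?thesis by blast
qed

text \<open>After clearing denominators the relation is a polynomial identity on the torus. Off the
  torus it holds trivially, every exponent being positive, so independence of ordinary monomials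
  applies.\<close>

lemma lmon_independent:
  assumes "finite A" "\<And>t. t \<in> torus_T \<Longrightarrow> (\<Sum>w\<in>A. x w * lmon w t) = 0" "w \<in> A"
  shows "x w = 0"
proof -
  obtain k e where e: "inj_on e A" "\<And>v i. v \<in> A \<Longrightarrow> 0 < e v i"
    "\<And>v t. v \<in> A \<Longrightarrow> t \<in> torus_T \<Longrightarrow> lmon k t * lmon v t = (\<Prod>i\<in>UNIV. (t $ i) ^ e v i)"
    using lmon_clear_denominators[OF assms(1)] by blast
  have "(\<Sum>a\<in>e ` A. x (inv_into A e a) * (\<Prod>i\<in>UNIV. c i ^ a i)) = 0" for c
  proof -
    have eq: "(\<Sum>a\<in>e ` A. x (inv_into A e a) * (\<Prod>i\<in>UNIV. c i ^ a i)) = (\<Sum>v\<in>A. x v * (\<Prod>i\<in>UNIV. c i ^ e v i))"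
      by (simp add: sum.reindex[OF e(1)] e(1))
    show ?thesis
    proof (cases "\<forall>i. c i \<noteq> 0")
      case True
      define t where "t = (\<chi> i. c i)"
      have t: "t \<in> torus_T" using True by (simp add: t_def torus_T_def)
      have "(\<Sum>v\<in>A. x v * (\<Prod>i\<in>UNIV. c i ^ e v i)) = lmon k t * (\<Sum>v\<in>A. x v * lmon v t)"
        unfolding sum_distrib_left
        by (intro sum.cong refl) (use e(3)[OF _ t] in \<open>simp add: t_def mult.left_commute\<close>)
      then show ?thesis using eq assms(2)[OF t] by simp
    next
      case False
      then obtain i where "c i = 0" by auto
      then have "(\<Prod>i\<in>UNIV. c i ^ e v i) = 0" if "v \<in> A" for v
        using e(2)[OF that, of i] by (auto intro!: exI[of _ i])
      then have "(\<Sum>v\<in>A. x v * (\<Prod>i\<in>UNIV. c i ^ e v i)) = 0"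
        by (intro sum.neutral ballI) (metis mult_zero_right)
      then show ?thesis using eq by simp
    qed
  qed
  from monomials_independent[OF _ this, of "e w"] assms(1,3) show ?thesis by (simp add: e(1))
qed

section \<open>Counting nondegenerate critical points by lattice points\<close>

lemma
  fixes A :: "'a::semiring_1^'n^'m"
  assumes "invertible A"
  shows matrix_inv_right: "A ** matrix_inv A = mat 1" and matrix_inv_left: "matrix_inv A ** A = mat 1"
proof -
  have "A ** matrix_inv A = mat 1 \<and> matrix_inv A ** A = mat 1"
    unfolding matrix_inv_def by (rule someI_ex) (use assms in \<open>simp add: invertible_def\<close>)
  then show "A ** matrix_inv A = mat 1" "matrix_inv A ** A = mat 1" by auto
qed

definition rvec :: "int^'m \<Rightarrow> real^'m" where
  "rvec w = (\<chi> i. real_of_int (w $ i))"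

definition polytope_of :: "(int^'m) set \<Rightarrow> (real^'m) set" where
  "polytope_of X = convex hull (rvec ` X)"

text \<open>Scaling the polytope instead of dividing \<open>w\<close> by \<open>k\<close> keeps the
  case \<open>k = 0\<close> meaningful; the filtration starts there.\<close>

definition lattice_dilate :: "(int^'m) set \<Rightarrow> nat \<Rightarrow> (int^'m) set" where
  "lattice_dilate X k = {w. rvec w \<in> (\<lambda>x. real k *\<^sub>R x) ` polytope_of X}"

text \<open>The logarithmic derivative \<open>t\<^sub>i d/dt\<^sub>i\<close> of the Laurent
  polynomial with coefficients \<open>c\<close>. On the torus it has the same zeros as the ordinary
  partial derivative, and its exponents stay in \<open>X\<close>.\<close>

definition crit_eq :: "(int^'m) set \<Rightarrow> (int^'m \<Rightarrow> complex) \<Rightarrow> 'm \<Rightarrow> complex^'m \<Rightarrow> complex" where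
  "crit_eq X c i t = (\<Sum>w\<in>X. c w * of_int (w $ i) * lmon w t)"

definition crit_points :: "(int^'m) set \<Rightarrow> (int^'m \<Rightarrow> complex) \<Rightarrow> (complex^'m) set" where
  "crit_points X c = {t \<in> torus_T. \<forall>i. crit_eq X c i t = 0}"

text \<open>For \<open>b w = c w * lmon w t\<close> this is the Hessian at \<open>t\<close> in
  logarithmic coordinates. Taking \<open>b\<close> as the argument makes its determinant a
  polynomial in the coordinates of the incidence space.\<close>

definition hess :: "(int^'m) set \<Rightarrow> (int^'m \<Rightarrow> complex) \<Rightarrow> complex^'m^'m" where
  "hess X b = (\<chi> i j. \<Sum>w\<in>X. b w * of_int (w $ i) * of_int (w $ j))"

text \<open>What the study of critical points retains of the group: symmetry of the weights comes
  from orthogonality, spanning from injectivity of \<open>\<phi>\<close>.\<close>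

definition symmetric_spanning :: "(int^'m) set \<Rightarrow> bool" where
  "symmetric_spanning X \<longleftrightarrow> finite X \<and> (\<forall>w\<in>X. - w \<in> X) \<and> span (rvec ` X) = UNIV"

section \<open>The weight polytope, its dilates and their lattice points\<close>

lemma rvec_add: "rvec (v + w) = rvec v + rvec w"
  by (simp add: rvec_def vec_eq_iff)

lemma rvec_uminus: "rvec (- w) = - rvec w"
  by (simp add: rvec_def vec_eq_iff)

lemma rvec_zero [simp]: "rvec 0 = 0"
  by (simp add: rvec_def vec_eq_iff)

text \<open>The polytope contains 0 as the midpoint of \<open>w\<close> and \<open>- w\<close>,
  hence its affine hull is its span, the whole space. So there is an interior point
  \<open>x\<close>; by symmetry \<open>- x\<close> is interior as well, and so is their midpoint
  0.\<close>

lemma zero_in_interior_polytope: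
  fixes X :: "(int^'m) set"
  assumes "symmetric_spanning X"
  shows "0 \<in> interior (polytope_of X)"
proof -
  let ?D = "polytope_of X"
  have X: "\<And>w. w \<in> X \<Longrightarrow> - w \<in> X" "span (rvec ` X) = UNIV"
    using assms by (auto simp: symmetric_spanning_def)
  have "X \<noteq> {}"
  proof
    assume "X = {}"
    then have "(UNIV :: (real^'m) set) = {0}" using X(2) by simp
    then have "axis undefined (1::real) = (0 :: real^'m)" by blast
    then show False by simp
  qed
  then obtain w where w: "w \<in> X" by auto
  have sym: "uminus ` ?D = ?D"
  proof -
    have "uminus ` rvec ` X = rvec ` X"
    proof -
      have "uminus ` X = X"
      proof (rule set_eqI)
        show "w \<in> uminus ` X \<longleftrightarrow> w \<in> X" for w
          using X(1)[of w] X(1)[of "- w"] image_eqI[of w uminus "- w" X] by auto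
      qed
      then have "rvec ` X = rvec ` uminus ` X" by simp
      also have "\<dots> = uminus ` rvec ` X" by (simp add: image_image rvec_uminus)
      finally show ?thesis by simp
    qed
    then show ?thesis
      using convex_hull_linear_image[of "uminus :: real^'m \<Rightarrow> _" "rvec ` X"]
      by (simp add: polytope_of_def linear_iff)
  qed
  have "rvec w \<in> ?D" "- rvec w \<in> ?D"
    using w X(1)[OF w] by (auto simp: polytope_of_def rvec_uminus[symmetric] intro!: hull_inc)
  then have "(1/2) *\<^sub>R rvec w + (1/2) *\<^sub>R (- rvec w) \<in> ?D"
    unfolding polytope_of_def by (intro convexD[OF convex_convex_hull]) auto
  then have "0 \<in> ?D" by simp
  then have "affine hull ?D = span ?D" by (simp add: affine_hull_span_0 hull_inc)
  moreover have "span (rvec ` X) \<subseteq> span ?D"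
    unfolding polytope_of_def by (intro span_mono hull_subset)
  ultimately have "affine hull ?D = UNIV" using X(2) by auto
  then have "interior ?D = rel_interior ?D" by (simp add: rel_interior_interior)
  moreover have "rel_interior ?D \<noteq> {}"
    using \<open>0 \<in> ?D\<close> unfolding polytope_of_def by (subst rel_interior_eq_empty) auto
  ultimately obtain x where x: "x \<in> interior ?D" by auto
  have "uminus ` interior ?D = interior ?D"
    using interior_negations[of ?D] by (simp only: sym)
  then have "- x \<in> interior ?D" using x by blast
  then have "(1/2) *\<^sub>R x + (1/2) *\<^sub>R (- x) \<in> interior ?D"
    using x by (intro convexD[OF convex_interior]) (auto simp: polytope_of_def)
  then show ?thesis by simp
qed

text \<open>Turns a bounded error, such as finitely many exponents or a unit cube, into an additive
  constant in the dilation factor.\<close>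

lemma polytope_of_absorbs:
  assumes "symmetric_spanning X" "bounded S"
  shows "\<exists>k. S \<subseteq> (\<lambda>x. real k *\<^sub>R x) ` polytope_of X"
proof -
  obtain e where e: "e > 0" "ball 0 e \<subseteq> polytope_of X"
    using zero_in_interior_polytope[OF assms(1)] by (meson mem_interior)
  obtain B where B: "\<And>x. x \<in> S \<Longrightarrow> norm x \<le> B" using assms(2) by (auto simp: bounded_iff)
  obtain k :: nat where k: "B / e + 1 < real k" using reals_Archimedean2 by blast
  have "S \<subseteq> (\<lambda>x. real (Suc k) *\<^sub>R x) ` polytope_of X"
  proof
    fix x assume "x \<in> S"
    then have "norm x \<le> B" by (rule B)
    also have "B < e * real (Suc k)" using k e(1) by (simp add: field_simps)
    finally have "norm (x /\<^sub>R real (Suc k)) < e" by (simp add: field_simps del: of_nat_Suc)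
    then have "x /\<^sub>R real (Suc k) \<in> polytope_of X" using e(2) by (auto simp: dist_norm)
    moreover have "x = real (Suc k) *\<^sub>R (x /\<^sub>R real (Suc k))" by simp
    ultimately show "x \<in> (\<lambda>x. real (Suc k) *\<^sub>R x) ` polytope_of X" by blast
  qed
  then show ?thesis by blast
qed

lemma polytope_of_dilate_add:
  assumes "x \<in> (\<lambda>x. real k *\<^sub>R x) ` polytope_of X" "y \<in> (\<lambda>x. real l *\<^sub>R x) ` polytope_of X"
  shows "x + y \<in> (\<lambda>x. real (k + l) *\<^sub>R x) ` polytope_of X"
proof -
  obtain u v where uv: "u \<in> polytope_of X" "v \<in> polytope_of X" "x = real k *\<^sub>R u" "y = real l *\<^sub>R v"
    using assms by auto
  show ?thesis
  proof (cases "k + l = 0")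
    case True
    then show ?thesis using uv by auto
  next
    case False
    have "(real k / real (k + l)) *\<^sub>R u + (real l / real (k + l)) *\<^sub>R v \<in> polytope_of X"
      using uv False unfolding polytope_of_def
      by (intro convexD[OF convex_convex_hull]) (auto simp flip: add_divide_distrib)
    moreover have "x + y = real (k + l) *\<^sub>R ((real k / real (k + l)) *\<^sub>R u + (real l / real (k + l)) *\<^sub>R v)"
      using False by (simp add: uv scaleR_add_right del: of_nat_add)
    ultimately show ?thesis by blast
  qed
qed

lemma lattice_dilate_add:
  "v \<in> lattice_dilate X k \<Longrightarrow> w \<in> lattice_dilate X l \<Longrightarrow> v + w \<in> lattice_dilate X (k + l)"
  using polytope_of_dilate_add[of "rvec v" k X "rvec w" l] by (simp add: lattice_dilate_def rvec_add)

lemma zero_in_lattice_dilate: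
  assumes "symmetric_spanning X"
  shows "0 \<in> lattice_dilate X k"
  using interior_subset zero_in_interior_polytope[OF assms]
  by (force simp: lattice_dilate_def image_iff intro!: bexI[of _ 0])

lemma lattice_dilate_mono:
  assumes "symmetric_spanning X" "k \<le> l"
  shows "lattice_dilate X k \<subseteq> lattice_dilate X l"
proof
  fix w assume "w \<in> lattice_dilate X k"
  from lattice_dilate_add[OF this zero_in_lattice_dilate[OF assms(1), of "l - k"]]
  show "w \<in> lattice_dilate X l" using assms(2) by simp
qed

lemma subset_lattice_dilate_one: "X \<subseteq> lattice_dilate X 1"
  by (auto simp: lattice_dilate_def polytope_of_def image_iff intro: hull_inc)

lemma finite_subset_lattice_dilate:
  assumes "symmetric_spanning X" "finite A"
  shows "\<exists>k. A \<subseteq> lattice_dilate X k"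
proof -
  have "bounded (rvec ` A)" using assms(2) by (simp add: finite_imp_bounded)
  from polytope_of_absorbs[OF assms(1) this] show ?thesis by (auto simp: lattice_dilate_def)
qed

lemma compact_polytope_of:
  assumes "finite X"
  shows "compact (polytope_of X)"
  unfolding polytope_of_def using assms by (simp add: compact_convex_hull finite_imp_compact)

lemma measure_dilate:
  fixes K :: "(real^'m) set"
  assumes "compact K"
  shows "measure lborel ((\<lambda>x. real k *\<^sub>R x) ` K) = real k ^ CARD('m) * measure lborel K"
proof -
  have "compact ((\<lambda>x. real k *\<^sub>R x) ` K)" using assms by (rule compact_scaling)
  then have "measure lebesgue ((\<lambda>x. real k *\<^sub>R x) ` K) = measure lborel ((\<lambda>x. real k *\<^sub>R x) ` K)"
    by (intro measure_completion) (simp add: borel_compact)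
  moreover have "measure lebesgue K = measure lborel K"
    using assms by (intro measure_completion) (simp add: borel_compact)
  ultimately show ?thesis using measure_lebesgue_affine[of "real k" 0 K] by simp
qed

text \<open>The open unit cubes at the lattice points are disjoint and have volume 1. If the
  \<open>l\<close>-th dilate contains the unit cube, the cubes based in the \<open>k\<close>-th
  dilate lie in the \<open>(k + l)\<close>-th one, whose volume is known.\<close>

lemma lattice_dilate_card:
  fixes X :: "(int^'m) set"
  assumes "symmetric_spanning X"
  shows "\<exists>l. \<forall>k. finite (lattice_dilate X k) \<and>
    real (card (lattice_dilate X k)) \<le> real (k + l) ^ CARD('m) * measure lborel (polytope_of X)"
proof -
  have fin: "finite X" using assms by (simp add: symmetric_spanning_def)
  let ?cube = "\<lambda>w::int^'m. box (rvec w) (rvec w + 1)"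
  obtain l where l: "cbox 0 1 \<subseteq> (\<lambda>x. real l *\<^sub>R x) ` polytope_of X"
    using polytope_of_absorbs[OF assms bounded_cbox] by blast
  have bound: "real (card F) \<le> real (k + l) ^ CARD('m) * measure lborel (polytope_of X)"
    if F: "F \<subseteq> lattice_dilate X k" "finite F" for F k
  proof -
    have "measure lborel (?cube w) = 1" for w
    proof -
      have "(rvec w + 1 - rvec w) \<bullet> b = 1" if "b \<in> Basis" for b
        using that by (auto simp: Basis_vec_def inner_axis)
      moreover have "rvec w \<bullet> b \<le> (rvec w + 1) \<bullet> b" if "b \<in> Basis" for b
        using that by (auto simp: Basis_vec_def inner_axis)
      ultimately show ?thesis by (simp add: measure_lborel_box_eq)
    qed
    moreover have "disjoint_family_on ?cube F"
    proof (unfold disjoint_family_on_def, intro ballI impI)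
      fix v w assume "v \<in> F" "w \<in> F" "v \<noteq> w"
      then obtain i where i: "v $ i \<noteq> w $ i" by (auto simp: vec_eq_iff)
      show "?cube v \<inter> ?cube w = {}"
      proof (rule ccontr)
        assume "?cube v \<inter> ?cube w \<noteq> {}"
        then obtain x where "x \<in> ?cube v" "x \<in> ?cube w" by auto
        then have "real_of_int (v $ i) < x $ i" "x $ i < real_of_int (v $ i) + 1"
          "real_of_int (w $ i) < x $ i" "x $ i < real_of_int (w $ i) + 1"
          by (auto simp: mem_box_cart rvec_def)
        then show False using i by linarith
      qed
    qed
    ultimately have "real (card F) = measure lborel (\<Union>w\<in>F. ?cube w)"
      using F(2) emeasure_lborel_box_finite by (subst measure_finite_Union) (auto simp: less_top)
    also have "\<dots> \<le> measure lborel ((\<lambda>x. real (k + l) *\<^sub>R x) ` polytope_of X)"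
    proof (rule measure_mono_fmeasurable)
      show "(\<Union>w\<in>F. ?cube w) \<subseteq> (\<lambda>x. real (k + l) *\<^sub>R x) ` polytope_of X"
      proof clarify
        fix w x assume "w \<in> F" "x \<in> ?cube w"
        then have "rvec w \<in> (\<lambda>x. real k *\<^sub>R x) ` polytope_of X" "x - rvec w \<in> cbox 0 1"
          using F by (auto simp: lattice_dilate_def mem_box_cart algebra_simps less_imp_le)
        from polytope_of_dilate_add[OF this(1) subsetD[OF l this(2)]]
        show "x \<in> (\<lambda>x. real (k + l) *\<^sub>R x) ` polytope_of X" by simp
      qed
      have "compact ((\<lambda>x. real (k + l) *\<^sub>R x) ` polytope_of X)"
        using compact_polytope_of[OF fin] by (rule compact_scaling)
      then show "(\<lambda>x. real (k + l) *\<^sub>R x) ` polytope_of X \<in> fmeasurable lborel"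
        by (rule fmeasurable_compact)
    qed (use F in auto)
    also have "\<dots> = real (k + l) ^ CARD('m) * measure lborel (polytope_of X)"
      by (rule measure_dilate[OF compact_polytope_of[OF fin]])
    finally show ?thesis .
  qed
  have "finite (lattice_dilate X k) \<and>
    real (card (lattice_dilate X k)) \<le> real (k + l) ^ CARD('m) * measure lborel (polytope_of X)" for k
  proof -
    let ?B = "real (k + l) ^ CARD('m) * measure lborel (polytope_of X)"
    \<comment> \<open>The volume bound holds for each finite subset, and a set whose finite subsets
      have bounded cardinality is finite.\<close>
    have "finite (lattice_dilate X k)"
    proof -
      have "card F \<le> nat \<lfloor>?B\<rfloor>" if "F \<subseteq> lattice_dilate X k" "finite F" for F
        using bound[OF that] by linarith
      then show ?thesis using finite_if_finite_subsets_card_bdd by metis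
    qed
    then show ?thesis using bound[OF subset_refl] by blast
  qed
  then show ?thesis by blast
qed

section \<open>Counting exponents of bounded total degree\<close>

lemma finite_exponents_le: "finite {a :: 'm::finite \<Rightarrow> nat. sum a UNIV \<le> k}"
proof (rule finite_subset)
  show "{a. sum a UNIV \<le> k} \<subseteq> PiE UNIV (\<lambda>_::'m. {..k})"
    using member_le_sum[of _ "UNIV :: 'm set", OF UNIV_I _ finite] by (auto simp: PiE_def intro: order_trans)
qed (auto intro: finite_PiE)

lemma power_le_fact_binomial: "k ^ m \<le> fact m * ((k + m) choose k)"
proof (induction m)
  case (Suc m)
  have "fact (Suc m) * ((k + Suc m) choose k) = fact m * (Suc m * (Suc (k + m) choose Suc m))"
    using binomial_symmetric[of k "k + Suc m"] by (simp add: algebra_simps del: binomial_Suc_Suc)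
  also have "Suc m * (Suc (k + m) choose Suc m) = Suc (k + m) * ((k + m) choose m)"
    by (rule Suc_times_binomial)
  also have "(k + m) choose m = (k + m) choose k"
    using binomial_symmetric[of k "k + m"] by simp
  also have "fact m * (Suc (k + m) * ((k + m) choose k)) = Suc (k + m) * (fact m * ((k + m) choose k))"
    by (simp only: mult.left_commute)
  also have "\<dots> \<ge> k * k ^ m" by (intro mult_mono Suc.IH) auto
  finally show ?case by simp
qed simp

text \<open>Stars and bars: lists of length \<open>CARD('m) + 1\<close> with sum \<open>k\<close>
  give exponents of degree at most \<open>k\<close>, the last entry being the slack. Their number, a
  binomial coefficient, is at least \<open>k ^ CARD('m) / fact CARD('m)\<close>, and this factorial
  becomes the normalisation of the volume.\<close>

lemma card_exponents_le_ge:
  "k ^ CARD('m) \<le> fact CARD('m) * card {a :: 'm::finite \<Rightarrow> nat. sum a UNIV \<le> k}"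
proof -
  let ?m = "CARD('m)"
  let ?L = "{l :: nat list. size l = Suc ?m \<and> sum_list l = k}"
  obtain h :: "'m \<Rightarrow> nat" where h: "bij_betw h UNIV {0..<?m}"
    using ex_bij_betw_finite_nat[of "UNIV :: 'm set"] by auto
  have s: "sum_list l = (\<Sum>i\<in>UNIV. l ! h i) + l ! ?m" if "length l = Suc ?m" for l :: "nat list"
  proof -
    have "sum_list l = (\<Sum>j<Suc ?m. l ! j)" using that by (simp add: sum_list_sum_nth atLeast0LessThan)
    also have "\<dots> = (\<Sum>j\<in>{0..<?m}. l ! j) + l ! ?m" by (simp add: atLeast0LessThan)
    also have "(\<Sum>j\<in>{0..<?m}. l ! j) = (\<Sum>i\<in>UNIV. l ! h i)"
      by (rule sum.reindex_bij_betw[OF h, symmetric])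
    finally show ?thesis .
  qed
  have "card ?L \<le> card {a :: 'm \<Rightarrow> nat. sum a UNIV \<le> k}"
  proof (rule card_inj_on_le)
    show "inj_on (\<lambda>l i. l ! h i) ?L"
    proof (rule inj_onI)
      fix l l' assume l: "l \<in> ?L" "l' \<in> ?L" "(\<lambda>i. l ! h i) = (\<lambda>i. l' ! h i)"
      have "l ! ?m = l' ! ?m" using s[of l] s[of l'] l fun_cong[OF l(3)] by auto
      moreover have "l ! j = l' ! j" if "j < ?m" for j
      proof -
        have "j \<in> h ` UNIV" using h that by (simp add: bij_betw_def)
        then obtain i where "h i = j" by blast
        then show ?thesis using fun_cong[OF l(3), of i] by simp
      qed
      ultimately show "l = l'" using l by (intro nth_equalityI) (auto simp: less_Suc_eq)
    qed
    show "(\<lambda>l i. l ! h i) ` ?L \<subseteq> {a. sum a UNIV \<le> k}"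
      using s by auto
  qed (rule finite_exponents_le)
  moreover have "card ?L = (k + ?m) choose k" using card_length_sum_list[of "Suc ?m" k] by simp
  ultimately have "(k + ?m) choose k \<le> card {a :: 'm \<Rightarrow> nat. sum a UNIV \<le> k}" by simp
  then have "fact ?m * ((k + ?m) choose k) \<le> fact ?m * card {a :: 'm \<Rightarrow> nat. sum a UNIV \<le> k}" by (rule mult_le_mono2)
  then show ?thesis using power_le_fact_binomial[of k ?m] by (rule order_trans[rotated])
qed

text \<open>Lagrange interpolation: for each unwanted point \<open>s\<close> a coordinate
  \<open>i\<close> with \<open>t $ i \<noteq> s $ i\<close> supplies the factor
  \<open>(x $ i - s $ i) / (t $ i - s $ i)\<close>.\<close>

lemma exists_separating_laurent:
  fixes F :: "(complex^'m) set"
  assumes "finite F" "F \<subseteq> torus_T" "t \<in> F"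
  shows "\<exists>A e. finite A \<and> e \<in> span_on torus_T lmon A \<and> (\<forall>s\<in>F. e s = (if s = t then 1 else 0))"
proof -
  have "\<exists>A e. finite A \<and> e \<in> span_on torus_T lmon A \<and> e t = 1 \<and> (\<forall>s\<in>S. e s = 0)"
    if "finite S" "t \<notin> S" for S
    using that
  proof (induction S rule: finite_induct)
    case empty
    have "(\<lambda>_. 1) \<in> span_on torus_T lmon {0 :: int^'m}"
      by (rule span_on_cong[OF span_on_generator]) auto
    then show ?case by (intro exI[of _ "{0}"] exI[of _ "\<lambda>_. 1"]) auto
  next
    case (insert s S)
    then obtain A e where e: "finite A" "e \<in> span_on torus_T lmon A" "e t = 1" "\<forall>s\<in>S. e s = 0" by auto
    obtain i where i: "t $ i \<noteq> s $ i" using insert.prems by (auto simp: vec_eq_iff)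
    let ?g = "\<lambda>x :: complex^'m. 1 / (t $ i - s $ i) * (x $ i + (- (s $ i)) * 1)"
    have "?g \<in> span_on torus_T lmon {axis i 1, 0}"
    proof (intro span_on_scale span_on_add)
      show "(\<lambda>x. x $ i) \<in> span_on torus_T lmon {axis i 1, 0}"
        by (rule span_on_cong[OF span_on_generator[of _ "axis i 1"]]) (auto simp: lmon_axis)
      show "(\<lambda>x. 1) \<in> span_on torus_T lmon {axis i 1, 0}"
        by (rule span_on_cong[OF span_on_generator[of _ 0]]) auto
    qed
    let ?C = "(\<lambda>(v, w). v + w) ` (A \<times> {axis i 1, 0})"
    have "(\<lambda>x. e x * ?g x) \<in> span_on torus_T lmon ?C"
    proof (rule span_on_mult[OF e(2) \<open>?g \<in> _\<close>])
      fix v w assume "v \<in> A" "w \<in> {axis i 1, 0 :: int^'m}"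
      then have "v + w \<in> ?C" by force
      then have "lmon (v + w) \<in> span_on torus_T lmon ?C"
        using e(1) by (intro span_on_generator) auto
      then show "(\<lambda>x. lmon v x * lmon w x) \<in> span_on torus_T lmon ?C"
        by (rule span_on_cong) (simp add: lmon_add)
    qed
    moreover have "e t * ?g t = 1" "\<forall>x\<in>insert s S. e x * ?g x = 0" using i e by auto
    ultimately show ?case using e(1) by (intro exI[of _ ?C] exI[of _ "\<lambda>x. e x * ?g x"]) auto
  qed
  from this[of "F - {t}"] assms show ?thesis by (fastforce split: if_splits)
qed

section \<open>Nondegenerate solutions and independence of the separated products\<close>

lemma lmon_path:
  "lmon w (tmul t (texp (s *s v))) = lmon w t * exp (s * (\<Sum>i\<in>UNIV. of_int (w $ i) * v $ i))"
  by (simp add: lmon_tmul lmon_texp sum_distrib_left mult.left_commute)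

lemma hess_mult_vec:
  "(hess X b *v v) $ i = (\<Sum>w\<in>X. b w * of_int (w $ i) * (\<Sum>j\<in>UNIV. of_int (w $ j) * v $ j))"
proof -
  have "(hess X b *v v) $ i = (\<Sum>j\<in>UNIV. \<Sum>w\<in>X. b w * of_int (w $ i) * (of_int (w $ j) * v $ j))"
    by (simp add: hess_def matrix_vector_mult_def sum_distrib_right mult.assoc)
  then show ?thesis by (subst (asm) sum.swap) (simp add: sum_distrib_left)
qed

lemma crit_eq_path_derivative:
  "((\<lambda>s. crit_eq X c i (tmul t (texp (s *s v)))) has_field_derivative
     (hess X (\<lambda>w. c w * lmon w t) *v v) $ i) (at 0)"
  unfolding crit_eq_def lmon_path hess_mult_vec
  by (auto intro!: derivative_eq_intros sum.cong)

text \<open>A nontrivial relation has a term of least degree \<open>r\<close>, at some point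
  \<open>u\<close>. Along a path through \<open>u\<close> with logarithmic velocity
  \<open>v\<close>, the relation divided by \<open>s ^ r\<close> tends to a form of degree
  \<open>r\<close> evaluated at \<open>H v\<close>, where \<open>H\<close> is the Hessian at
  \<open>u\<close>. As \<open>H\<close> is invertible this form vanishes identically, contradicting
  the choice of the term.\<close>

lemma separated_products_independent:
  fixes F :: "(complex^'m) set" and A :: "('m \<Rightarrow> nat) set"
  assumes F: "finite F" "F \<subseteq> crit_points X c" "\<And>t. t \<in> F \<Longrightarrow> det (hess X (\<lambda>w. c w * lmon w t)) \<noteq> 0"
    and A: "finite A"
    and e: "\<And>t. t \<in> F \<Longrightarrow> e t \<in> span_on torus_T lmon B" "\<And>t s. t \<in> F \<Longrightarrow> s \<in> F \<Longrightarrow> e t s = (if s = t then 1 else 0)"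
    and rel: "\<And>x. x \<in> torus_T \<Longrightarrow> (\<Sum>(t, a)\<in>F \<times> A. y (t, a) * (e t x * (\<Prod>i\<in>UNIV. crit_eq X c i x ^ a i))) = 0"
    and ta: "t \<in> F" "a \<in> A"
  shows "y (t, a) = 0"
proof (rule ccontr)
  assume ya: "y (t, a) \<noteq> 0"
  define r where "r = (LEAST n. \<exists>p\<in>F \<times> A. y p \<noteq> 0 \<and> sum (snd p) UNIV = n)"
  have "\<exists>p\<in>F \<times> A. y p \<noteq> 0 \<and> sum (snd p) UNIV = r"
    unfolding r_def by (rule LeastI[of _ "sum a UNIV"]) (use ya ta in force)
  then obtain u b where ub: "u \<in> F" "b \<in> A" "y (u, b) \<noteq> 0" "sum b UNIV = r" by auto
  have r_le: "r \<le> sum d UNIV" if "x \<in> F" "d \<in> A" "y (x, d) \<noteq> 0" for x d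
    unfolding r_def by (rule Least_le) (use that in force)
  have u: "u \<in> torus_T" "\<And>i. crit_eq X c i u = 0" using F(2) ub(1) by (auto simp: crit_points_def)
  let ?H = "hess X (\<lambda>w. c w * lmon w u)"
  let ?A = "{d \<in> A. sum d UNIV = r}"
  have "(\<Sum>d\<in>?A. y (u, d) * (\<Prod>i\<in>UNIV. (?H *v v) $ i ^ d i)) = 0" for v
  proof -
    define x where "x s = tmul u (texp (s *s v))" for s
    have x: "x s \<in> torus_T" for s unfolding x_def using u(1) by (intro torus_T_tmul torus_T_texp)
    have x0: "x 0 = u" by (simp add: x_def tmul_def texp_def vec_eq_iff)
    have lim_quot: "((\<lambda>s. crit_eq X c i (x s) / s) \<longlongrightarrow> (?H *v v) $ i) (at 0)" for i
      using crit_eq_path_derivative[of X c i u v] u(2)[of i] x0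
      unfolding DERIV_def x_def by simp
    have lim_e: "((\<lambda>s. e p (x s)) \<longlongrightarrow> e p u) (at 0)" if p: "p \<in> F" for p
    proof -
      obtain z where z: "\<And>q. q \<in> torus_T \<Longrightarrow> e p q = (\<Sum>w\<in>B. z w * lmon w q)"
        using e(1)[OF p] by (auto simp: span_on_def)
      have "((\<lambda>s. \<Sum>w\<in>B. z w * lmon w (x s)) \<longlongrightarrow> (\<Sum>w\<in>B. z w * lmon w (x 0))) (at 0)"
        unfolding x_def lmon_path by (auto intro!: tendsto_eq_intros)
      then show ?thesis using z[OF x] z[OF u(1)] x0 by simp
    qed
    \<comment> \<open>Each factor \<open>crit_eq\<close> takes one power of \<open>s\<close>,
      leaving \<open>s ^ (sum d UNIV - r)\<close>. The truncated subtraction is harmless: a term of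
      degree below \<open>r\<close> has coefficient 0.\<close>
    let ?g = "\<lambda>s. \<Sum>(p, d)\<in>F \<times> A. y (p, d) *
        (s ^ (sum d UNIV - r) * (e p (x s) * (\<Prod>i\<in>UNIV. (crit_eq X c i (x s) / s) ^ d i)))"
    have "(?g \<longlongrightarrow> (\<Sum>(p, d)\<in>F \<times> A. y (p, d) *
        (0 ^ (sum d UNIV - r) * (e p u * (\<Prod>i\<in>UNIV. ((?H *v v) $ i) ^ d i))))) (at 0)"
      by (intro tendsto_sum, clarify, intro tendsto_intros lim_e lim_quot) auto
    moreover have "(?g \<longlongrightarrow> 0) (at 0)"
    proof (rule Lim_transform_eventually[OF tendsto_const])
      have "?g s = 0" if s: "s \<noteq> 0" for s
      proof -
        have "s ^ r * ?g s = (\<Sum>(p, d)\<in>F \<times> A. y (p, d) * (e p (x s) * (\<Prod>i\<in>UNIV. crit_eq X c i (x s) ^ d i)))"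
          unfolding sum_distrib_left
        proof (intro sum.cong refl, clarify)
          fix p d assume pd: "p \<in> F" "d \<in> A"
          show "s ^ r * (y (p, d) * (s ^ (sum d UNIV - r) * (e p (x s) * (\<Prod>i\<in>UNIV. (crit_eq X c i (x s) / s) ^ d i))))
              = y (p, d) * (e p (x s) * (\<Prod>i\<in>UNIV. crit_eq X c i (x s) ^ d i))"
          proof (cases "y (p, d) = 0")
            case False
            have "s ^ r * s ^ (sum d UNIV - r) = s ^ sum d UNIV"
              using r_le[OF pd False] by (simp flip: power_add)
            moreover have "(\<Prod>i\<in>UNIV. (crit_eq X c i (x s) / s) ^ d i) = (\<Prod>i\<in>UNIV. crit_eq X c i (x s) ^ d i) / s ^ sum d UNIV"
              by (simp add: power_divide prod_dividef power_sum)
            moreover have "s ^ sum d UNIV \<noteq> 0" using s by simp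
            ultimately have E: "(s ^ r * s ^ (sum d UNIV - r)) * (\<Prod>i\<in>UNIV. (crit_eq X c i (x s) / s) ^ d i)
                = (\<Prod>i\<in>UNIV. crit_eq X c i (x s) ^ d i)"
              by (simp only: nonzero_mult_div_cancel_left times_divide_eq_right not_False_eq_True)
            show ?thesis unfolding E[symmetric] by (simp only: mult_ac)
          qed simp
        qed
        then show ?thesis using rel[OF x] s by simp
      qed
      then show "\<forall>\<^sub>F s in at 0. 0 = ?g s" by (auto simp: eventually_at_filter)
    qed
    ultimately have lim: "(\<Sum>(p, d)\<in>F \<times> A. y (p, d) *
        (0 ^ (sum d UNIV - r) * (e p u * (\<Prod>i\<in>UNIV. ((?H *v v) $ i) ^ d i)))) = 0"
      by (rule tendsto_unique[OF at_neq_bot])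
    define M where "M d = (\<Prod>i\<in>UNIV. ((?H *v v) $ i) ^ d i)" for d :: "'m \<Rightarrow> nat"
    define f where "f q = y q * (0 ^ (sum (snd q) UNIV - r) * (e (fst q) u * M (snd q)))" for q
    \<comment> \<open>In the limit the points other than \<open>u\<close> are removed by the
      separating functions, the degrees above \<open>r\<close> by the surplus power of 0.\<close>
    have "sum f (F \<times> A) = sum f ({u} \<times> ?A)"
    proof (rule sum.mono_neutral_right)
      show "finite (F \<times> A)" using F(1) A by simp
      show "{u} \<times> ?A \<subseteq> F \<times> A" using ub by auto
      show "\<forall>q\<in>F \<times> A - {u} \<times> ?A. f q = 0"
      proof
        fix q assume q: "q \<in> F \<times> A - {u} \<times> ?A"
        obtain p d where qpd: "q = (p, d)" by (cases q)
        with q have pd: "p \<in> F" "d \<in> A" "(p, d) \<notin> {u} \<times> ?A" by auto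
        show "f q = 0"
        proof (cases "y (p, d) = 0 \<or> p \<noteq> u")
          case True
          then show ?thesis using e(2)[OF pd(1) ub(1)] by (auto simp: f_def qpd)
        next
          case False
          then have "r < sum d UNIV" using pd r_le[of p d] by fastforce
          then show ?thesis by (simp add: f_def qpd)
        qed
      qed
    qed
    also have "sum f ({u} \<times> ?A) = (\<Sum>d\<in>?A. f (u, d))"
      by (simp add: sum.cartesian_product')
    also have "\<dots> = (\<Sum>d\<in>?A. y (u, d) * M d)"
      by (intro sum.cong) (auto simp: f_def e(2)[OF ub(1) ub(1)])
    finally show ?thesis using lim by (simp add: f_def M_def case_prod_unfold)
  qed
  note zero = this
  \<comment> \<open>Any \<open>q\<close> is of the form \<open>H v\<close>, with the velocity
    \<open>v\<close> obtained from the inverse Hessian.\<close>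
  have "(\<Sum>d\<in>?A. y (u, d) * (\<Prod>i\<in>UNIV. q i ^ d i)) = 0" for q :: "'m \<Rightarrow> complex"
  proof -
    have "?H *v (matrix_inv ?H *v (\<chi> i. q i)) = (\<chi> i. q i)"
      using F(3)[OF ub(1)] by (simp add: matrix_vector_mul_assoc matrix_inv_right invertible_det_nz)
    then show ?thesis using zero[of "matrix_inv ?H *v (\<chi> i. q i)"] by simp
  qed
  from monomials_independent[OF _ this, of b] A ub show False by simp
qed

lemma span_lattice_mult:
  assumes "symmetric_spanning X" "f \<in> span_on torus_T lmon (lattice_dilate X k)" "g \<in> span_on torus_T lmon (lattice_dilate X l)"
  shows "(\<lambda>t. f t * g t) \<in> span_on torus_T lmon (lattice_dilate X (k + l))"
proof (rule span_on_mult[OF assms(2,3)])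
  fix v w assume "v \<in> lattice_dilate X k" "w \<in> lattice_dilate X l"
  then have "lmon (v + w) \<in> span_on torus_T lmon (lattice_dilate X (k + l))"
    using lattice_dilate_card[OF assms(1)] by (intro span_on_generator lattice_dilate_add) auto
  then show "(\<lambda>t. lmon v t * lmon w t) \<in> span_on torus_T lmon (lattice_dilate X (k + l))"
    by (rule span_on_cong) (simp add: lmon_add)
qed

lemma span_lattice_one:
  assumes "symmetric_spanning X"
  shows "(\<lambda>_. 1) \<in> span_on torus_T lmon (lattice_dilate X 0)"
  by (rule span_on_cong[OF span_on_generator[of _ 0]])
    (use lattice_dilate_card[OF assms] zero_in_lattice_dilate[OF assms] in auto)

lemma crit_eq_span_lattice:
  assumes "symmetric_spanning X"
  shows "crit_eq X c i \<in> span_on torus_T lmon (lattice_dilate X 1)"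
proof -
  have "crit_eq X c i \<in> span_on torus_T lmon X"
    unfolding crit_eq_def span_on_def by (auto intro!: exI[of _ "\<lambda>w. c w * of_int (w $ i)"])
  then show ?thesis
    using lattice_dilate_card[OF assms] subset_lattice_dilate_one by (metis span_on_mono)
qed

theorem card_nondegenerate_crit_points_le:
  fixes X :: "(int^'m) set"
  assumes X: "symmetric_spanning X" and F: "finite F" "F \<subseteq> crit_points X c"
    and nondeg: "\<And>t. t \<in> F \<Longrightarrow> det (hess X (\<lambda>w. c w * lmon w t)) \<noteq> 0"
  shows "real (card F) \<le> norm_vol X"
proof -
  let ?m = "CARD('m)"
  have FT: "F \<subseteq> torus_T" using F(2) by (auto simp: crit_points_def)
  obtain S e where S: "\<And>t. t \<in> F \<Longrightarrow> finite (S t)" "\<And>t. t \<in> F \<Longrightarrow> e t \<in> span_on torus_T lmon (S t)"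
      "\<And>t s. t \<in> F \<Longrightarrow> s \<in> F \<Longrightarrow> e t s = (if s = t then 1 else 0)"
    using exists_separating_laurent[OF F(1) FT] by metis
  obtain k0 where k0: "(\<Union>t\<in>F. S t) \<subseteq> lattice_dilate X k0"
    using finite_subset_lattice_dilate[OF X, of "\<Union>t\<in>F. S t"] F(1) S(1) by auto
  obtain l where l: "\<And>k. finite (lattice_dilate X k)"
      "\<And>k. real (card (lattice_dilate X k)) \<le> real (k + l) ^ ?m * measure lborel (polytope_of X)"
    using lattice_dilate_card[OF X] by blast
  have e: "e t \<in> span_on torus_T lmon (lattice_dilate X k0)" if "t \<in> F" for t
    using S(2)[OF that] k0 that l(1) by (auto intro: span_on_mono)
  have count: "card F * card {a :: 'm \<Rightarrow> nat. sum a UNIV \<le> k} \<le> card (lattice_dilate X (k0 + k))" for k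
  proof (rule ccontr)
    let ?A = "{a :: 'm \<Rightarrow> nat. sum a UNIV \<le> k}"
    assume "\<not> ?thesis"
    then have less: "card (lattice_dilate X (k0 + k)) < card (F \<times> ?A)"
      by (simp add: card_cartesian_product)
    have mem: "(\<lambda>x. e (fst p) x * (\<Prod>i\<in>UNIV. crit_eq X c i x ^ snd p i)) \<in> span_on torus_T lmon (lattice_dilate X (k0 + k))"
      if "p \<in> F \<times> ?A" for p
    proof (intro span_lattice_mult[OF X] e)
      let ?S = "\<lambda>k. span_on torus_T lmon (lattice_dilate X k)"
      have "(\<lambda>x. \<Prod>i\<in>UNIV. crit_eq X c i x ^ snd p i) \<in> span_on torus_T lmon (lattice_dilate X (\<Sum>i\<in>UNIV. snd p i * 1))"
        by (intro filtration_prod[of ?S] filtration_power[of ?S] span_lattice_one[OF X]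
            span_lattice_mult[OF X] crit_eq_span_lattice[OF X]) auto
      then show "(\<lambda>x. \<Prod>i\<in>UNIV. crit_eq X c i x ^ snd p i) \<in> span_on torus_T lmon (lattice_dilate X k)"
        by (rule span_on_mono)
          (use that l(1) lattice_dilate_mono[OF X, of "sum (snd p) UNIV" k] in \<open>simp_all add: mem_Times_iff\<close>)
    qed (use that in auto)
    have fin: "finite (F \<times> ?A)" using F(1) finite_exponents_le by auto
    obtain y where y: "\<exists>p\<in>F \<times> ?A. y p \<noteq> 0"
      "\<And>x. x \<in> torus_T \<Longrightarrow> (\<Sum>p\<in>F \<times> ?A. y p * (e (fst p) x * (\<Prod>i\<in>UNIV. crit_eq X c i x ^ snd p i))) = 0"
      using span_on_linear_relation[OF l(1) fin less, where \<Omega> = torus_T and m = lmon and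
        f = "\<lambda>p x. e (fst p) x * (\<Prod>i\<in>UNIV. crit_eq X c i x ^ snd p i)"] mem by auto
    have "y (t, a) = 0" if "t \<in> F" "a \<in> ?A" for t a
      using separated_products_independent[OF F nondeg finite_exponents_le e S(3) _ that, of y] y(2)
      by (simp add: case_prod_unfold)
    then show False using y(1) by auto
  qed
  \<comment> \<open>The fixed loss: \<open>k0\<close> makes room for the separating functions,
    \<open>l\<close> for the unit cube in the lattice point count. Its effect is the factor
    \<open>(1 + K / k) ^ CARD('m)\<close>, which tends to 1.\<close>
  define K where "K = real (k0 + l)"
  let ?v = "measure lborel (polytope_of X)"
  have ineq: "real (card F) \<le> fact ?m * ?v * (1 + K / real k) ^ ?m" if "k > 0" for k
  proof -
    have "card F * k ^ ?m \<le> card F * (fact ?m * card {a :: 'm \<Rightarrow> nat. sum a UNIV \<le> k})"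
      by (intro mult_le_mono2 card_exponents_le_ge)
    also have "\<dots> \<le> fact ?m * card (lattice_dilate X (k0 + k))"
      using mult_le_mono2[OF count[of k], of "fact ?m"] by (simp only: mult.left_commute)
    finally have "real (card F * k ^ ?m) \<le> real (fact ?m * card (lattice_dilate X (k0 + k)))"
      by (simp only: of_nat_le_iff)
    then have "real (card F) * real k ^ ?m \<le> fact ?m * real (card (lattice_dilate X (k0 + k)))"
      by simp
    also have "\<dots> \<le> fact ?m * (real (k0 + k + l) ^ ?m * ?v)" by (intro mult_left_mono l(2)) auto
    also have "real (k0 + k + l) = (1 + K / real k) * real k" using that by (simp add: K_def field_simps)
    finally have "real (card F) * real k ^ ?m \<le> (fact ?m * ?v * (1 + K / real k) ^ ?m) * real k ^ ?m"
      by (simp only: power_mult_distrib mult_ac)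
    then show ?thesis using that by simp
  qed
  have "(\<lambda>k. fact ?m * ?v * (1 + K / real k) ^ ?m) \<longlonglongrightarrow> fact ?m * ?v * (1 + 0) ^ ?m"
    by (intro tendsto_intros lim_const_over_n)
  then have "real (card F) \<le> fact ?m * ?v * (1 + 0) ^ ?m"
    by (rule LIMSEQ_le_const) (use ineq in \<open>auto intro!: exI[of _ 1]\<close>)
  then show ?thesis by (simp add: norm_vol_def polytope_of_def rvec_def image_def)
qed

section \<open>The generic locus\<close>

definition incidence :: "(int^'m) set \<Rightarrow> ((int^'m \<Rightarrow> complex) \<times> (complex^'m)) set" where
  "incidence X = {(b, t). t \<in> torus_T \<and> (\<forall>i. (\<Sum>w\<in>X. b w * of_int (w $ i)) = 0)}"

text \<open>The index type of the coefficients is infinite, and the coefficient map from matrices is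
  under control on \<open>X\<close> only; a generic condition can be pulled back to matrices when it
  ignores the other coefficients.\<close>

definition depends_on :: "'i set \<Rightarrow> (('i \<Rightarrow> 'a) \<Rightarrow> 'b) \<Rightarrow> bool" where
  "depends_on X p \<longleftrightarrow> (\<forall>c d. (\<forall>w\<in>X. c w = d w) \<longrightarrow> p c = p d)"

lemma rvec_inj: "inj rvec"
  by (auto simp: inj_def rvec_def vec_eq_iff)

text \<open>\<open>Y\<close> is a part of \<open>X\<close> whose vectors form a basis, so the linear
  conditions on \<open>b\<close> can be solved for the \<open>b y\<close>. The remaining
  \<open>card X - CARD('m)\<close> free parameters and the torus coordinates together number
  \<open>card X\<close>, the dimension used in the count.\<close>

lemma eliminate_basis:
  fixes X :: "(int^'m) set"
  assumes "symmetric_spanning X"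
  shows "\<exists>Y r. Y \<subseteq> X \<and> card Y = CARD('m) \<and>
    (\<forall>b :: int^'m \<Rightarrow> complex. (\<forall>i. (\<Sum>w\<in>X. b w * of_int (w $ i)) = 0) \<longrightarrow> (\<forall>y\<in>Y. b y = (\<Sum>w\<in>X - Y. r w y * b w)))"
proof -
  have X: "finite X" "span (rvec ` X) = UNIV" using assms by (auto simp: symmetric_spanning_def)
  obtain B where B: "B \<subseteq> rvec ` X" "independent B" "rvec ` X \<subseteq> span B"
    using maximal_independent_subset by blast
  define Y where "Y = {w \<in> X. rvec w \<in> B}"
  have Y: "rvec ` Y = B" "Y \<subseteq> X" using B(1) by (auto simp: Y_def)
  have finY: "finite Y" using Y(2) X(1) by (rule finite_subset)
  have spanB: "span B = UNIV" using B(3) X(2) by (metis span_eq top.extremum_uniqueI span_mono span_span)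
  have "card Y = card B" using Y(1) rvec_inj by (metis card_image inj_on_subset subset_UNIV)
  also have "card B = dim (UNIV :: (real^'m) set)" using B(2) spanB by (metis dim_span_eq_card_independent)
  finally have cardY: "card Y = CARD('m)" by simp
  have indep: "g y = 0" if "(\<Sum>y\<in>Y. g y *\<^sub>R rvec y) = 0" "y \<in> Y" for g y
  proof -
    have "independent (rvec ` Y)" using B(2) Y(1) by simp
    moreover have "(\<Sum>v\<in>rvec ` Y. g (inv rvec v) *\<^sub>R v) = 0"
      using that(1) by (subst sum.reindex) (auto intro: inj_on_subset[OF rvec_inj] simp: inv_f_f[OF rvec_inj])
    ultimately have "g (inv rvec (rvec y)) = 0"
      using that(2) finY independentD[of "rvec ` Y" "rvec ` Y" "\<lambda>v. g (inv rvec v)" "rvec y"] by auto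
    then show ?thesis by (simp add: inv_f_f[OF rvec_inj])
  qed
  have "\<exists>r. rvec w = (\<Sum>y\<in>Y. r y *\<^sub>R rvec y)" for w
  proof -
    have "rvec w \<in> span (rvec ` Y)" using spanB Y(1) by auto
    then obtain u where "rvec w = (\<Sum>v\<in>rvec ` Y. u v *\<^sub>R v)" using span_finite[of "rvec ` Y"] finY by auto
    then have "rvec w = (\<Sum>y\<in>Y. u (rvec y) *\<^sub>R rvec y)"
      by (subst (asm) sum.reindex) (auto intro: inj_on_subset[OF rvec_inj])
    then show ?thesis by (rule exI[of _ "\<lambda>y. u (rvec y)"])
  qed
  then obtain r where r: "\<And>w. rvec w = (\<Sum>y\<in>Y. r w y *\<^sub>R rvec y)" by metis
  have "b y = (\<Sum>w\<in>X - Y. complex_of_real (- r w y) * b w)"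
    if b: "\<And>i. (\<Sum>w\<in>X. b w * of_int (w $ i)) = 0" and y: "y \<in> Y" for b :: "int^'m \<Rightarrow> complex" and y
  proof -
    define g where "g y = b y + (\<Sum>w\<in>X - Y. b w * complex_of_real (r w y))" for y
    have g: "(\<Sum>y\<in>Y. g y * of_int (y $ i)) = 0" for i
    proof -
      have w: "of_int (w $ i) = (\<Sum>y\<in>Y. complex_of_real (r w y) * of_int (y $ i))" for w
      proof -
        have "real_of_int (w $ i) = (\<Sum>y\<in>Y. r w y * real_of_int (y $ i))"
          using arg_cong[OF r[of w], of "\<lambda>v. v $ i"] by (simp add: rvec_def)
        from arg_cong[OF this, of complex_of_real] show ?thesis by simp
      qed
      have "0 = (\<Sum>w\<in>X - Y. b w * of_int (w $ i)) + (\<Sum>y\<in>Y. b y * of_int (y $ i))"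
        using b[of i] by (simp add: sum.subset_diff[OF Y(2) X(1)])
      also have "(\<Sum>w\<in>X - Y. b w * of_int (w $ i)) = (\<Sum>w\<in>X - Y. \<Sum>y\<in>Y. b w * complex_of_real (r w y) * of_int (y $ i))"
        by (subst w) (simp add: sum_distrib_left mult.assoc)
      also have "\<dots> = (\<Sum>y\<in>Y. (\<Sum>w\<in>X - Y. b w * complex_of_real (r w y)) * of_int (y $ i))"
        by (subst sum.swap) (simp add: sum_distrib_right)
      finally show ?thesis by (simp add: g_def sum.distrib algebra_simps)
    qed
    \<comment> \<open>Independence is known over the reals, hence it is applied to the real and
      imaginary parts of \<open>g\<close> separately.\<close>
    have "(\<Sum>y\<in>Y. Re (g y) *\<^sub>R rvec y) = 0" and "(\<Sum>y\<in>Y. Im (g y) *\<^sub>R rvec y) = 0"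
      using arg_cong[OF g, of Re] arg_cong[OF g, of Im] by (simp_all add: vec_eq_iff rvec_def)
    from this[THEN indep, OF y] have "g y = 0" by (simp add: complex_eq_iff)
    then show ?thesis by (simp add: g_def add_eq_0_iff sum_negf mult.commute)
  qed
  then show ?thesis using Y(2) cardY by (intro exI[of _ Y] exI[of _ "\<lambda>w y. complex_of_real (- r w y)"]) auto
qed

text \<open>\<open>U\<close> holds the free weights, and the single bound \<open>E\<close> serves
  both kinds of coordinates: the \<open>b w\<close> have exponents from 0 to \<open>E\<close>, the
  torus coordinates from \<open>- E\<close> to \<open>E\<close>. The spans of these monomials filter
  the coordinate ring of the incidence variety.\<close>

definition chart_index :: "(int^'m) set \<Rightarrow> nat \<Rightarrow> ((int^'m \<Rightarrow> nat) \<times> (int^'m)) set" where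
  "chart_index U E = PiE U (\<lambda>_. {..E}) \<times> {v. \<forall>i. \<bar>v $ i\<bar> \<le> int E}"

definition chart_mon :: "(int^'m) set \<Rightarrow> (int^'m \<Rightarrow> nat) \<times> (int^'m) \<Rightarrow> (int^'m \<Rightarrow> complex) \<times> (complex^'m) \<Rightarrow> complex" where
  "chart_mon U = (\<lambda>(\<beta>, v) (b, t). (\<Prod>w\<in>U. b w ^ \<beta> w) * lmon v t)"

definition chart_span :: "(int^'m) set \<Rightarrow> (int^'m) set \<Rightarrow> nat \<Rightarrow> ((int^'m \<Rightarrow> complex) \<times> (complex^'m) \<Rightarrow> complex) set" where
  "chart_span X U E = span_on (incidence X) (chart_mon U) (chart_index U E)"

lemma chart_index_card:
  fixes U :: "(int^'m) set"
  assumes "finite U"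
  shows "finite (chart_index U E)" "card (chart_index U E) \<le> (2 * E + 1) ^ (card U + CARD('m))"
proof -
  let ?V = "{v :: int^'m. \<forall>i. \<bar>v $ i\<bar> \<le> int E}"
  let ?P = "PiE UNIV (\<lambda>_ :: 'm. {- int E..int E})"
  have inj: "inj_on vec_nth ?V" by (auto simp: inj_on_def vec_nth_inject)
  have sub: "vec_nth ` ?V \<subseteq> ?P" by (auto simp: abs_le_iff minus_le_iff)
  have fin: "finite ?P" by (auto intro: finite_PiE)
  have finV: "finite ?V" using inj sub fin by (meson finite_imageD finite_subset)
  then show "finite (chart_index U E)" using assms by (auto simp: chart_index_def intro!: finite_PiE)
  have "card ?V \<le> card ?P" using inj sub fin by (rule card_inj_on_le)
  also have "card ?P = (2 * E + 1) ^ CARD('m)" by (simp add: card_PiE nat_add_distrib nat_mult_distrib)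
  finally have "card ?V \<le> (2 * E + 1) ^ CARD('m)" .
  moreover have "card (PiE U (\<lambda>_. {..E})) = (E + 1) ^ card U" using assms by (simp add: card_PiE)
  moreover have "(E + 1) ^ card U \<le> (2 * E + 1) ^ card U" by (rule power_mono) auto
  ultimately show "card (chart_index U E) \<le> (2 * E + 1) ^ (card U + CARD('m))"
    unfolding chart_index_def card_cartesian_product power_add by (metis mult_le_mono)
qed

lemma chart_span_mult:
  assumes "finite U" "f \<in> chart_span X U k" "g \<in> chart_span X U l"
  shows "(\<lambda>p. f p * g p) \<in> chart_span X U (k + l)"
  unfolding chart_span_def
proof (rule span_on_mult[OF assms(2,3)[unfolded chart_span_def]])
  fix p q assume pq: "p \<in> chart_index U k" "q \<in> chart_index U l"
  let ?s = "(restrict (\<lambda>w. fst p w + fst q w) U, snd p + snd q)"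
  have "?s \<in> chart_index U (k + l)"
  proof -
    have "\<bar>(snd p + snd q) $ i\<bar> \<le> int (k + l)" for i
    proof -
      have "\<bar>snd p $ i\<bar> \<le> int k" "\<bar>snd q $ i\<bar> \<le> int l" using pq by (auto simp: chart_index_def)
      then show ?thesis by simp
    qed
    then show ?thesis using pq by (auto simp: chart_index_def intro!: add_mono)
  qed
  then have "chart_mon U ?s \<in> span_on (incidence X) (chart_mon U) (chart_index U (k + l))"
    using chart_index_card[OF assms(1)] by (intro span_on_generator)
  then show "(\<lambda>x. chart_mon U p x * chart_mon U q x) \<in> span_on (incidence X) (chart_mon U) (chart_index U (k + l))"
    by (rule span_on_cong)
      (auto simp: chart_mon_def case_prod_unfold incidence_def lmon_add power_add prod.distrib)
qed

lemma chart_span_mono: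
  assumes "finite U" "f \<in> chart_span X U k" "k \<le> l"
  shows "f \<in> chart_span X U l"
proof -
  have "chart_index U k \<subseteq> chart_index U l"
    using assms(3) by (auto simp: chart_index_def PiE_iff intro: order_trans)
  then show ?thesis using assms(1,2) unfolding chart_span_def by (meson chart_index_card(1) span_on_mono)
qed

lemma chart_span_lmon:
  assumes "finite U" "\<And>i. \<bar>v $ i\<bar> \<le> int k"
  shows "(\<lambda>(b, t). lmon v t) \<in> chart_span X U k"
proof -
  have "(restrict (\<lambda>_. 0) U, v) \<in> chart_index U k" using assms(2) by (auto simp: chart_index_def)
  then have "chart_mon U (restrict (\<lambda>_. 0) U, v) \<in> chart_span X U k"
    unfolding chart_span_def using assms(1) chart_index_card by (intro span_on_generator)
  then show ?thesis unfolding chart_span_def by (rule span_on_cong) (auto simp: chart_mon_def)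
qed

lemma chart_span_one: "finite U \<Longrightarrow> (\<lambda>_. 1) \<in> chart_span X U 0"
  using chart_span_lmon[of U 0 0 X] by (simp add: case_prod_unfold)

lemma chart_span_coordinate:
  fixes X :: "(int^'m) set"
  assumes "finite X" "Y \<subseteq> X"
    and "\<And>b :: int^'m \<Rightarrow> complex. (\<forall>i. (\<Sum>w\<in>X. b w * of_int (w $ i)) = 0) \<Longrightarrow> \<forall>y\<in>Y. b y = (\<Sum>w\<in>X - Y. r w y * b w)"
    and "w \<in> X"
  shows "(\<lambda>(b, t). b w) \<in> chart_span X (X - Y) 1"
proof -
  let ?U = "X - Y"
  have U: "(\<lambda>(b, t). b w) \<in> chart_span X ?U 1" if "w \<in> ?U" for w
  proof -
    let ?p = "(restrict (\<lambda>v. if v = w then 1 else 0) ?U, 0)"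
    have "?p \<in> chart_index ?U 1" by (auto simp: chart_index_def)
    then have "chart_mon ?U ?p \<in> chart_span X ?U 1"
      unfolding chart_span_def by (rule span_on_generator[OF chart_index_card(1)[OF finite_Diff[OF assms(1)]]])
    moreover have "(\<Prod>v\<in>?U. b v ^ restrict (\<lambda>v. if v = w then 1 else 0) ?U v) = b w" for b :: "int^'m \<Rightarrow> complex"
    proof -
      have "(\<Prod>v\<in>?U. b v ^ restrict (\<lambda>v. if v = w then 1 else 0) ?U v) = (\<Prod>v\<in>?U. if v = w then b v else 1)"
        by (intro prod.cong) auto
      then show ?thesis using that assms(1) by simp
    qed
    ultimately show ?thesis
      unfolding chart_span_def by (elim span_on_cong) (simp add: chart_mon_def case_prod_unfold)
  qed
  show ?thesis
  proof (cases "w \<in> Y")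
    case True
    have "(\<lambda>p. \<Sum>v\<in>?U. r v w * (case p of (b, t) \<Rightarrow> b v)) \<in> chart_span X ?U 1"
      using U unfolding chart_span_def by (intro span_on_sum span_on_scale)
    then show ?thesis
      unfolding chart_span_def by (rule span_on_cong) (use assms(3) True in \<open>auto simp: incidence_def\<close>)
  qed (use U assms(4) in auto)
qed

text \<open>The functions \<open>c w = b w * lmon (- w) t\<close> (\<open>w \<in> X\<close>) and \<open>\<theta>\<close> are \<open>card X + 1\<close> many
  regular functions on a variety of dimension \<open>card X\<close>, hence algebraically dependent.\<close>

lemma algebraic_dependence:
  fixes X :: "(int^'m) set"
  assumes X: "finite X" and U: "finite U" "card U + CARD('m) = card X"
    and b: "\<And>w. w \<in> X \<Longrightarrow> (\<lambda>(b, t). b w) \<in> chart_span X U 1"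
    and \<theta>: "\<theta> \<in> chart_span X U D"
  shows "\<exists>K a. (\<forall>j. a j \<in> poly_fun \<and> depends_on X (a j)) \<and> (\<exists>j<K. a j \<noteq> (\<lambda>_. 0)) \<and>
    (\<forall>(b, t)\<in>incidence X. (\<Sum>j<K. a j (\<lambda>w. b w * lmon (- w) t) * \<theta> (b, t) ^ j) = 0)"
proof -
  define D0 where "D0 = nat (\<Sum>w\<in>X. \<Sum>i\<in>UNIV. \<bar>w $ i\<bar>)"
  have D0: "\<bar>(- w) $ i\<bar> \<le> int D0" if "w \<in> X" for w i
  proof -
    have "\<bar>w $ i\<bar> \<le> (\<Sum>i\<in>UNIV. \<bar>w $ i\<bar>)" by (rule member_le_sum) auto
    also have "\<dots> \<le> (\<Sum>w\<in>X. \<Sum>i\<in>UNIV. \<bar>w $ i\<bar>)"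
      by (rule member_le_sum[OF that]) (auto intro: sum_nonneg X)
    finally have "\<bar>w $ i\<bar> \<le> (\<Sum>w\<in>X. \<Sum>i\<in>UNIV. \<bar>w $ i\<bar>)" .
    moreover have "0 \<le> (\<Sum>w\<in>X. \<Sum>i\<in>UNIV. \<bar>w $ i\<bar>)" by (intro sum_nonneg) auto
    ultimately show ?thesis by (simp add: D0_def)
  qed
  define c where "c w = (\<lambda>(b :: int^'m \<Rightarrow> complex, t :: complex^'m). b w * lmon (- w) t)" for w
  have c: "c w \<in> chart_span X U (1 + D0)" if "w \<in> X" for w
    using chart_span_mult[OF U(1) b[OF that] chart_span_lmon[OF U(1) D0[OF that]]]
    by (simp add: c_def case_prod_unfold)
  \<comment> \<open>Each \<open>c w\<close> has degree at most \<open>1 + D0\<close>, where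
    \<open>D0\<close> bounds the entries of the weights, and \<open>\<theta>\<close> has degree at
    most \<open>D\<close>. Products with all exponents below \<open>k\<close> thus have degree at
    most \<open>E\<close>. There are \<open>k ^ (card X + 1)\<close> of them against at most
    \<open>(2 * E + 1) ^ card X \<le> (k * C) ^ card X\<close> chart monomials, so
    \<open>k > C ^ card X\<close> is enough.\<close>
  define C where "C = 2 * ((1 + D0) * card X + D) + 1"
  define k where "k = C ^ card X + 1"
  define E where "E = k * ((1 + D0) * card X + D)"
  define I where "I = PiE X (\<lambda>_. {..<k}) \<times> {..<k}"
  define f where "f = (\<lambda>(\<alpha>, j) p. (\<Prod>w\<in>X. c w p ^ \<alpha> w) * \<theta> p ^ j)"
  have fE: "f i \<in> chart_span X U E" if iI: "i \<in> I" for i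
  proof -
    obtain \<alpha> j where i: "i = (\<alpha>, j)" "\<alpha> \<in> PiE X (\<lambda>_. {..<k})" "j < k"
      using iI by (auto simp: I_def)
    have "f i \<in> chart_span X U ((\<Sum>w\<in>X. \<alpha> w * (1 + D0)) + j * D)"
      unfolding f_def i(1) prod.case
      by (intro chart_span_mult[OF U(1)] filtration_prod[of "chart_span X U"] filtration_power[of "chart_span X U"]
          chart_span_one[OF U(1)] c \<theta> X)
    moreover have "(\<Sum>w\<in>X. \<alpha> w * (1 + D0)) + j * D \<le> E"
    proof -
      have "\<alpha> w * (1 + D0) \<le> k * (1 + D0)" if "w \<in> X" for w
        using i(2) that by (intro mult_le_mono1) (auto simp: PiE_iff less_imp_le)
      then have "(\<Sum>w\<in>X. \<alpha> w * (1 + D0)) \<le> (\<Sum>w\<in>X. k * (1 + D0))" by (rule sum_mono)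
      also have "\<dots> = k * ((1 + D0) * card X)" by (simp add: algebra_simps)
      finally have "(\<Sum>w\<in>X. \<alpha> w * (1 + D0)) \<le> k * ((1 + D0) * card X)" .
      moreover have "j * D \<le> k * D" using i(3) by (intro mult_le_mono1) simp
      ultimately show ?thesis unfolding E_def add_mult_distrib2[of k] by (rule add_mono)
    qed
    ultimately show ?thesis by (rule chart_span_mono[OF U(1)])
  qed
  have "card (chart_index U E) \<le> (2 * E + 1) ^ card X"
    using chart_index_card(2)[OF U(1), of E] U(2) by simp
  also have "\<dots> \<le> (k * C) ^ card X"
    by (rule power_mono) (auto simp: E_def C_def k_def algebra_simps)
  also have "\<dots> = k ^ card X * C ^ card X" by (rule power_mult_distrib)
  also have "\<dots> < k ^ card X * k" by (rule mult_strict_left_mono) (auto simp: k_def)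
  also have "\<dots> = card I" using X by (simp add: I_def card_cartesian_product card_PiE)
  finally have card: "card (chart_index U E) < card I" .
  have finI: "finite I" using X by (auto simp: I_def intro: finite_PiE)
  obtain y where y: "\<exists>i\<in>I. y i \<noteq> 0" "\<And>p. p \<in> incidence X \<Longrightarrow> (\<Sum>i\<in>I. y i * f i p) = 0"
    using span_on_linear_relation[OF chart_index_card(1)[OF U(1)] finI card, of f "incidence X" "chart_mon U"] fE
    by (auto simp: chart_span_def)
  define a where "a j q = (\<Sum>\<alpha>\<in>PiE X (\<lambda>_. {..<k}). y (\<alpha>, j) * (\<Prod>w\<in>X. q w ^ \<alpha> w))" for j and q :: "int^'m \<Rightarrow> complex"
  have "a j \<in> poly_fun" for j
    unfolding a_def by (intro poly_fun_sum poly_fun_prod poly_fun_power poly_fun.intros)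
  moreover have "depends_on X (a j)" for j
    unfolding depends_on_def a_def
    by (intro allI impI sum.cong arg_cong2[of _ _ _ _ times] prod.cong) auto
  moreover have "\<exists>j<k. a j \<noteq> (\<lambda>_. 0)"
  proof (rule ccontr)
    assume "\<not> ?thesis"
    then have a0: "a j q = 0" if "j < k" for j q using that by (auto dest: fun_cong)
    obtain \<alpha> j where "\<alpha> \<in> PiE X (\<lambda>_. {..<k})" "j < k" "y (\<alpha>, j) \<noteq> 0" using y(1) by (auto simp: I_def)
    then show False
      using box_monomials_independent[OF X, of "\<lambda>\<alpha>. y (\<alpha>, j)" k \<alpha>] a0[of j] by (auto simp: a_def)
  qed
  moreover have "(\<Sum>j<k. a j (\<lambda>w. b w * lmon (- w) t) * \<theta> (b, t) ^ j) = 0" if "(b, t) \<in> incidence X" for b t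
  proof -
    have "0 = (\<Sum>(\<alpha>, j)\<in>I. y (\<alpha>, j) * ((\<Prod>w\<in>X. (b w * lmon (- w) t) ^ \<alpha> w) * \<theta> (b, t) ^ j))"
      using y(2)[OF that] by (simp add: f_def c_def case_prod_unfold)
    also have "\<dots> = (\<Sum>\<alpha>\<in>PiE X (\<lambda>_. {..<k}). \<Sum>j<k. y (\<alpha>, j) * ((\<Prod>w\<in>X. (b w * lmon (- w) t) ^ \<alpha> w) * \<theta> (b, t) ^ j))"
      unfolding I_def by (rule sum.cartesian_product[symmetric])
    also have "\<dots> = (\<Sum>j<k. a j (\<lambda>w. b w * lmon (- w) t) * \<theta> (b, t) ^ j)"
      by (subst sum.swap) (simp add: a_def sum_distrib_right mult.assoc)
    finally show ?thesis by simp
  qed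
  ultimately show ?thesis by (intro exI[of _ k] exI[of _ a]) auto
qed

text \<open>Discards the coefficients that are identically zero at both ends. Where the two extreme
  ones do not vanish, a nonzero root is bounded both above and away from 0.\<close>

lemma trim_power_sum:
  fixes a :: "nat \<Rightarrow> 'q \<Rightarrow> 'a::comm_ring_1"
  assumes "\<exists>j<K. a j \<noteq> (\<lambda>_. 0)"
  shows "\<exists>l n. a l \<noteq> (\<lambda>_. 0) \<and> a (l + n) \<noteq> (\<lambda>_. 0) \<and>
    (\<forall>q z. (\<Sum>j<K. a j q * z ^ j) = z ^ l * (\<Sum>j\<le>n. a (l + j) q * z ^ j))"
proof -
  define S where "S = {j. j < K \<and> a j \<noteq> (\<lambda>_. 0)}"
  have S: "finite S" "S \<noteq> {}" using assms by (auto simp: S_def)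
  define l n where "l = Min S" and "n = Max S - Min S"
  have ln: "l \<in> S" "l + n \<in> S" "\<And>j. j \<in> S \<Longrightarrow> l \<le> j \<and> j \<le> l + n"
    using S by (auto simp: l_def n_def)
  have "(\<Sum>j<K. a j q * z ^ j) = z ^ l * (\<Sum>j\<le>n. a (l + j) q * z ^ j)" for q z
  proof -
    have "a j q = 0" if "j < K" "j \<notin> {l..l + n}" for j
    proof -
      have "a j = (\<lambda>_. 0)" using ln(3)[of j] that by (auto simp: S_def)
      then show ?thesis by simp
    qed
    then have "(\<Sum>j<K. a j q * z ^ j) = (\<Sum>j\<in>{l..l + n}. a j q * z ^ j)"
      using ln(2) by (intro sum.mono_neutral_right) (auto simp: S_def)
    also have "\<dots> = (\<Sum>j\<le>n. a (l + j) q * z ^ (l + j))"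
      by (simp add: sum.atLeastAtMost_shift_0 atLeast0AtMost)
    also have "\<dots> = z ^ l * (\<Sum>j\<le>n. a (l + j) q * z ^ j)"
      by (simp add: sum_distrib_left power_add mult_ac)
    finally show ?thesis .
  qed
  then show ?thesis using ln(1,2) unfolding S_def by blast
qed

text \<open>For \<open>b = 1\<close> the Hessian is the sum of the matrices
  \<open>w w\<^sup>t\<close>. Its Hermitian form at \<open>v\<close> is the sum of the squared
  moduli of the pairings of \<open>v\<close> with the weights, which is definite because the weights
  span.\<close>

lemma det_hess_one_nonzero:
  fixes X :: "(int^'m) set"
  assumes "symmetric_spanning X"
  shows "det (hess X (\<lambda>_. 1)) \<noteq> 0"
proof -
  let ?H = "hess X (\<lambda>_. 1)"
  have X: "finite X" "span (rvec ` X) = UNIV" using assms by (auto simp: symmetric_spanning_def)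
  have "v = 0" if v: "?H *v v = 0" for v :: "complex^'m"
  proof -
    define l where "l w = (\<Sum>j\<in>UNIV. of_int (w $ j) * v $ j)" for w :: "int^'m"
    have "0 = (\<Sum>i\<in>UNIV. cnj (v $ i) * (?H *v v) $ i)" using v by simp
    also have "\<dots> = (\<Sum>i\<in>UNIV. \<Sum>w\<in>X. cnj (of_int (w $ i) * v $ i) * l w)"
      by (simp add: hess_mult_vec l_def sum_distrib_left mult_ac)
    also have "\<dots> = (\<Sum>w\<in>X. cnj (l w) * l w)"
      by (subst sum.swap) (simp add: l_def sum_distrib_right)
    also have "\<dots> = complex_of_real (\<Sum>w\<in>X. (cmod (l w))\<^sup>2)"
      by (simp only: of_real_sum complex_norm_square mult.commute)
    finally have "(\<Sum>w\<in>X. (cmod (l w))\<^sup>2) = 0" by (metis of_real_eq_0_iff)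
    then have l0: "l w = 0" if "w \<in> X" for w
      using X(1) that by (subst (asm) sum_nonneg_eq_0_iff) auto
    have orth: "u = 0" if u: "\<And>w. w \<in> X \<Longrightarrow> rvec w \<bullet> u = 0" for u :: "real^'m"
    proof -
      have "orthogonal u x" if "x \<in> span (rvec ` X)" for x
        by (rule orthogonal_to_span[OF that]) (use u in \<open>auto simp: orthogonal_def inner_commute\<close>)
      then have "u \<bullet> u = 0" using X(2) by (auto simp: orthogonal_def)
      then show ?thesis by simp
    qed
    have "(\<chi> j. Re (v $ j)) = 0" "(\<chi> j. Im (v $ j)) = 0"
      by (rule orth, use arg_cong[OF l0, of _ Re] arg_cong[OF l0, of _ Im] in
          \<open>simp add: l_def rvec_def inner_vec_def\<close>)+
    then show "v = 0" by (simp add: vec_eq_iff complex_eq_iff)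
  qed
  then show ?thesis
    unfolding invertible_det_nz[symmetric] invertible_left_inverse matrix_left_invertible_ker by blast
qed

lemma det_hess_poly_fun: "(\<lambda>b. det (hess X b)) \<in> poly_fun"
  unfolding det_def hess_def by (auto intro!: poly_fun_sum poly_fun_prod poly_fun.intros)

lemma det_hess_chart_span:
  fixes X :: "(int^'m) set"
  assumes U: "finite U" and b: "\<And>w. w \<in> X \<Longrightarrow> (\<lambda>(b, t). b w) \<in> chart_span X U 1"
  shows "(\<lambda>(b, t). det (hess X b)) \<in> chart_span X U CARD('m)"
proof -
  have "(\<lambda>p. hess X (fst p) $ i $ j) \<in> chart_span X U 1" for i j
  proof -
    have "(\<lambda>p. \<Sum>w\<in>X. (of_int (w $ i) * of_int (w $ j)) * (case p of (b, t) \<Rightarrow> b w)) \<in> chart_span X U 1"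
      using b unfolding chart_span_def by (intro span_on_sum span_on_scale)
    then show ?thesis unfolding chart_span_def
      by (rule span_on_cong) (simp add: hess_def case_prod_unfold mult_ac)
  qed
  then have "(\<lambda>p. \<Prod>i\<in>UNIV. hess X (fst p) $ i $ q i) \<in> chart_span X U (\<Sum>i\<in>(UNIV :: 'm set). 1)" for q
    by (intro filtration_prod[of "chart_span X U"] chart_span_one[OF U] chart_span_mult[OF U]) auto
  then have "(\<lambda>p. \<Sum>q\<in>{q. q permutes UNIV}. of_int (sign q) * (\<Prod>i\<in>UNIV. hess X (fst p) $ i $ q i)) \<in> chart_span X U CARD('m)"
    unfolding chart_span_def by (intro span_on_sum span_on_scale) auto
  then show ?thesis by (simp add: det_def case_prod_unfold)
qed

lemma crit_point_incidence:
  assumes "t \<in> crit_points X c"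
  shows "(\<lambda>w. c w * lmon w t, t) \<in> incidence X" "(\<lambda>w. (c w * lmon w t) * lmon (- w) t) = c"
  using assms lmon_nonzero[of t]
  by (auto simp: crit_points_def incidence_def crit_eq_def lmon_uminus mult_ac fun_eq_iff)

text \<open>For fixed \<open>t\<close> the cofactor \<open>h\<close> is a polynomial in
  \<open>b\<close> that vanishes wherever the determinant does not. The line from
  \<open>b = 1\<close> to a given \<open>b\<close> stays in the linear space, so a nonzero value of
  \<open>h\<close> would yield a point on it with both \<open>h\<close> and the determinant
  nonzero.\<close>

lemma hess_relation_extends:
  fixes X :: "(int^'m) set"
  assumes X: "symmetric_spanning X" and a: "\<And>j. a j \<in> poly_fun"
    and rel: "\<And>b t. (b, t) \<in> incidence X \<Longrightarrow>
        det (hess X b) ^ l * (\<Sum>j\<le>n. a j (\<lambda>w. b w * lmon (- w) t) * det (hess X b) ^ j) = 0"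
    and bt: "(b, t) \<in> incidence X"
  shows "(\<Sum>j\<le>n. a j (\<lambda>w. b w * lmon (- w) t) * det (hess X b) ^ j) = 0"
proof (rule ccontr)
  assume nz: "\<not> ?thesis"
  define h where "h b = (\<Sum>j\<le>n. a j (\<lambda>w. b w * lmon (- w) t) * det (hess X b) ^ j)" for b
  have "(\<lambda>b. a j (\<lambda>w. b w * lmon (- w) t)) \<in> poly_fun" for j
    by (rule poly_fun_compose[OF a]) (intro poly_fun.intros)
  then have h: "h \<in> poly_fun"
    unfolding h_def by (intro poly_fun_sum poly_fun_power det_hess_poly_fun poly_fun.mult)
  have "h b \<noteq> 0" using nz by (simp add: h_def)
  then obtain s where s: "det (hess X (\<lambda>w. 1 + s * (b w - 1))) \<noteq> 0" "h (\<lambda>w. 1 + s * (b w - 1)) \<noteq> 0"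
    using poly_fun_common_nonzero[OF det_hess_poly_fun h, of X "\<lambda>_. 1" b] det_hess_one_nonzero[OF X] by blast
  \<comment> \<open>Here symmetry of \<open>X\<close> is used: the terms of \<open>w\<close> and
    \<open>- w\<close> cancel, so \<open>b = 1\<close> satisfies the linear conditions.\<close>
  have one: "(\<Sum>w\<in>X. of_int (w $ i)) = (0 :: complex)" for i
  proof -
    have "(\<Sum>w\<in>X. of_int (w $ i)) = (\<Sum>w\<in>X. of_int ((- w) $ i) :: complex)"
      by (rule sum.reindex_bij_witness[of _ uminus uminus]) (use X in \<open>auto simp: symmetric_spanning_def\<close>)
    then show ?thesis by (simp add: sum_negf)
  qed
  have "(\<lambda>w. 1 + s * (b w - 1), t) \<in> incidence X"
  proof -
    have "(\<Sum>w\<in>X. (1 + s * (b w - 1)) * of_int (w $ i)) = 0" for i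
    proof -
      have "(\<Sum>w\<in>X. (1 + s * (b w - 1)) * of_int (w $ i)) =
          (1 - s) * (\<Sum>w\<in>X. of_int (w $ i)) + s * (\<Sum>w\<in>X. b w * of_int (w $ i))"
        by (simp add: sum_distrib_left sum.distrib[symmetric] algebra_simps)
      then show ?thesis using one bt by (simp add: incidence_def)
    qed
    then show ?thesis using bt by (simp add: incidence_def)
  qed
  from rel[OF this] s show False by (simp add: h_def)
qed

lemma depends_on_mult: "depends_on X p \<Longrightarrow> depends_on X q \<Longrightarrow> depends_on X (\<lambda>c. p c * q c)"
  unfolding depends_on_def by metis

lemma depends_on_prod: "(\<And>i. i \<in> I \<Longrightarrow> depends_on X (p i)) \<Longrightarrow> depends_on X (\<lambda>c. \<Prod>i\<in>I. p i c)"
  unfolding depends_on_def by (meson prod.cong)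

text \<open>\<open>p\<close> multiplies the constant coefficient of the relation for the Hessian
  determinant with the extreme coefficients of the relations for the coordinates. The former rules
  out the root 0 of the determinant; the latter keep the critical points away from infinity and from
  the coordinate hyperplanes.\<close>

theorem generic_locus:
  fixes X :: "(int^'m) set"
  assumes X: "symmetric_spanning X"
  shows "\<exists>p N a. p \<in> poly_fun \<and> depends_on X p \<and> p \<noteq> (\<lambda>_. 0) \<and>
    (\<forall>c t. p c \<noteq> 0 \<longrightarrow> t \<in> crit_points X c \<longrightarrow> det (hess X (\<lambda>w. c w * lmon w t)) \<noteq> 0) \<and>
    (\<forall>i j. a i j \<in> poly_fun) \<and> (\<forall>i c. p c \<noteq> 0 \<longrightarrow> a i 0 c \<noteq> 0 \<and> a i (N i) c \<noteq> 0) \<and>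
    (\<forall>i c t. t \<in> crit_points X c \<longrightarrow> (\<Sum>j\<le>N i. a i j c * (t $ i) ^ j) = 0)"
proof -
  have finX: "finite X" using X by (simp add: symmetric_spanning_def)
  obtain Y r where Y: "Y \<subseteq> X" "card Y = CARD('m)"
     "\<And>b :: int^'m \<Rightarrow> complex. (\<forall>i. (\<Sum>w\<in>X. b w * of_int (w $ i)) = 0) \<Longrightarrow> \<forall>y\<in>Y. b y = (\<Sum>w\<in>X - Y. r w y * b w)"
    using eliminate_basis[OF X] by blast
  define U where "U = X - Y"
  have U: "finite U" "card U + CARD('m) = card X"
    using finX Y card_mono[OF finX Y(1)] by (auto simp: U_def card_Diff_subset finite_subset)
  have b: "(\<lambda>(b, t). b w) \<in> chart_span X U 1" if "w \<in> X" for w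
    unfolding U_def by (rule chart_span_coordinate[OF finX Y(1) _ that]) (rule Y(3))
  have ex: "\<exists>n a. (\<forall>j. a j \<in> poly_fun \<and> depends_on X (a j)) \<and> a 0 \<noteq> (\<lambda>_. 0) \<and> a n \<noteq> (\<lambda>_. 0) \<and>
      (\<exists>l. \<forall>b t. (b, t) \<in> incidence X \<longrightarrow> \<theta> (b, t) ^ l * (\<Sum>j\<le>n. a j (\<lambda>w. b w * lmon (- w) t) * \<theta> (b, t) ^ j) = 0)"
    if "\<theta> \<in> chart_span X U D" for \<theta> D
  proof -
    obtain K a where Ka: "\<And>j. a j \<in> poly_fun \<and> depends_on X (a j)" "\<exists>j<K. a j \<noteq> (\<lambda>_. 0)"
      "\<And>b t. (b, t) \<in> incidence X \<Longrightarrow> (\<Sum>j<K. a j (\<lambda>w. b w * lmon (- w) t) * \<theta> (b, t) ^ j) = 0"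
      using algebraic_dependence[OF finX U b \<open>\<theta> \<in> _\<close>]
      unfolding Ball_def split_paired_All case_prod_conv by blast
    obtain l n where "a l \<noteq> (\<lambda>_. 0)" "a (l + n) \<noteq> (\<lambda>_. 0)"
      "\<And>q z. (\<Sum>j<K. a j q * z ^ j) = z ^ l * (\<Sum>j\<le>n. a (l + j) q * z ^ j)"
      using trim_power_sum[OF Ka(2)] by blast
    then show ?thesis using Ka(1,3) by (intro exI[of _ n] exI[of _ "\<lambda>j. a (l + j)"]) auto
  qed
  define P where "P i n a \<longleftrightarrow> (\<forall>j. a j \<in> poly_fun \<and> depends_on X (a j)) \<and> a 0 \<noteq> (\<lambda>_. 0) \<and> a n \<noteq> (\<lambda>_. 0) \<and>
      (\<forall>c t. t \<in> crit_points X c \<longrightarrow> (\<Sum>j\<le>n. a j c * (t $ i) ^ j) = 0)" for i n a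
  have "\<exists>n a. P i n a" for i
  proof -
    have "(\<lambda>(b, t). lmon (axis i 1) t) \<in> chart_span X U 1"
      by (rule chart_span_lmon[OF U(1)]) (auto simp: axis_def)
    from ex[OF this] obtain n a l where
      a: "\<And>j. a j \<in> poly_fun \<and> depends_on X (a j)" "a 0 \<noteq> (\<lambda>_. 0)" "a n \<noteq> (\<lambda>_. 0)"
      "\<And>b t. (b, t) \<in> incidence X \<Longrightarrow> (t $ i) ^ l * (\<Sum>j\<le>n. a j (\<lambda>w. b w * lmon (- w) t) * (t $ i) ^ j) = 0"
      unfolding case_prod_conv lmon_axis by blast
    have "(\<Sum>j\<le>n. a j c * (t $ i) ^ j) = 0" if t: "t \<in> crit_points X c" for c t
      using a(4)[OF crit_point_incidence(1)[OF t]] t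
      unfolding crit_point_incidence(2)[OF t] by (auto simp: crit_points_def torus_T_def)
    then show ?thesis unfolding P_def using a(1-3) by blast
  qed
  then obtain N a where "\<And>i. P i (N i) (a i)" by metis
  then have a: "\<And>i j. a i j \<in> poly_fun \<and> depends_on X (a i j)" "\<And>i. a i 0 \<noteq> (\<lambda>_. 0)" "\<And>i. a i (N i) \<noteq> (\<lambda>_. 0)"
      "\<And>i c t. t \<in> crit_points X c \<Longrightarrow> (\<Sum>j\<le>N i. a i j c * (t $ i) ^ j) = 0"
    unfolding P_def by blast+
  obtain n d l where d: "\<And>j. d j \<in> poly_fun \<and> depends_on X (d j)" "d 0 \<noteq> (\<lambda>_. 0)"
    "\<And>b t. (b, t) \<in> incidence X \<Longrightarrow> det (hess X b) ^ l * (\<Sum>j\<le>n. d j (\<lambda>w. b w * lmon (- w) t) * det (hess X b) ^ j) = 0"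
    using ex[OF det_hess_chart_span[OF U(1) b]] unfolding case_prod_conv by blast
  define p where "p c = d 0 c * (\<Prod>i\<in>UNIV. a i 0 c * a i (N i) c)" for c
  have "det (hess X (\<lambda>w. c w * lmon w t)) \<noteq> 0" if "p c \<noteq> 0" and t: "t \<in> crit_points X c" for c t
  proof
    assume "det (hess X (\<lambda>w. c w * lmon w t)) = 0"
    moreover have "(\<Sum>j\<le>n. d j c * det (hess X (\<lambda>w. c w * lmon w t)) ^ j) = 0"
      using hess_relation_extends[OF X _ d(3) crit_point_incidence(1)[OF t]] d(1)
      unfolding crit_point_incidence(2)[OF t] by blast
    ultimately have "d 0 c = 0" by (simp add: power_0_left if_distrib cong: if_cong)
    then show False using \<open>p c \<noteq> 0\<close> by (simp add: p_def)
  qed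
  moreover have "p \<in> poly_fun" unfolding p_def using a(1) d(1) by (intro poly_fun.mult poly_fun_prod) auto
  moreover have "depends_on X p" unfolding p_def using a(1) d(1) by (intro depends_on_mult depends_on_prod) auto
  moreover have "p \<noteq> (\<lambda>_. 0)"
    unfolding p_def
    by (intro poly_fun_mult_nonzero poly_fun_prod_nonzero poly_fun_prod poly_fun.mult) (auto simp: a d)
  moreover have "a i 0 c \<noteq> 0 \<and> a i (N i) c \<noteq> 0" if "p c \<noteq> 0" for i c
    using that by (auto simp: p_def)
  ultimately show ?thesis using a(1,4) by (intro exI[of _ p] exI[of _ N] exI[of _ a]) auto
qed

section \<open>Local constancy of the number of critical points\<close>

lemma power_sum_root_bound:
  fixes a :: "nat \<Rightarrow> complex"
  assumes "(\<Sum>j\<le>n. a j * z ^ j) = 0"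
  shows "cmod (a n) * cmod z \<le> (\<Sum>j\<le>n. cmod (a j))"
proof (cases "cmod z \<le> 1")
  case True
  then have "cmod (a n) * cmod z \<le> cmod (a n)" by (simp add: mult_left_le)
  also have "\<dots> \<le> (\<Sum>j\<le>n. cmod (a j))" by (rule member_le_sum) auto
  finally show ?thesis .
next
  case False
  show ?thesis
  proof (cases n)
    case 0
    then show ?thesis using assms by simp
  next
    case (Suc k)
    have "a n * z ^ n = - (\<Sum>j\<le>k. a j * z ^ j)"
      using assms unfolding Suc by (simp add: add_eq_0_iff add.commute)
    then have "cmod (a n) * cmod z ^ n = cmod (\<Sum>j\<le>k. a j * z ^ j)"
      by (metis norm_minus_cancel norm_mult norm_power)
    also have "\<dots> \<le> (\<Sum>j\<le>k. cmod (a j) * cmod z ^ k)"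
      by (rule sum_norm_le) (use False in \<open>simp add: norm_mult norm_power mult_left_mono power_increasing\<close>)
    finally have "(cmod (a n) * cmod z) * cmod z ^ k \<le> (\<Sum>j\<le>k. cmod (a j)) * cmod z ^ k"
      by (simp add: Suc sum_distrib_right mult.assoc)
    moreover have "cmod z ^ k > 0" using False by (intro zero_less_power) linarith
    ultimately have "cmod (a n) * cmod z \<le> (\<Sum>j\<le>k. cmod (a j))" by (rule mult_right_le_imp_le)
    also have "\<dots> \<le> (\<Sum>j\<le>n. cmod (a j))" by (simp add: Suc)
    finally show ?thesis .
  qed
qed

text \<open>The upper bound applied to the reversed polynomial at \<open>inverse z\<close>.\<close>

lemma power_sum_root_lower_bound:
  fixes a :: "nat \<Rightarrow> complex"
  assumes "(\<Sum>j\<le>n. a j * z ^ j) = 0" "z \<noteq> 0"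
  shows "cmod (a 0) \<le> cmod z * (\<Sum>j\<le>n. cmod (a j))"
proof -
  have "(\<Sum>j\<le>n. a (n - j) * inverse z ^ j) = (\<Sum>j\<le>n. a j * inverse z ^ (n - j))"
    by (rule sum.reindex_bij_witness[of _ "\<lambda>j. n - j" "\<lambda>j. n - j"]) auto
  also have "\<dots> = inverse z ^ n * (\<Sum>j\<le>n. a j * z ^ j)"
    unfolding sum_distrib_left
  proof (intro sum.cong refl)
    fix j assume "j \<in> {..n}"
    then have "inverse z ^ n = inverse z ^ (n - j) * inverse z ^ j" by (simp flip: power_add)
    then show "a j * inverse z ^ (n - j) = inverse z ^ n * (a j * z ^ j)"
      using assms(2) by (simp add: field_simps)
  qed
  finally have "(\<Sum>j\<le>n. a (n - j) * inverse z ^ j) = 0" using assms(1) by simp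
  from power_sum_root_bound[OF this]
  have "cmod (a 0) / cmod z \<le> (\<Sum>j\<le>n. cmod (a (n - j)))" by (simp add: norm_inverse divide_inverse)
  also have "\<dots> = (\<Sum>j\<le>n. cmod (a j))"
    by (rule sum.reindex_bij_witness[of _ "\<lambda>j. n - j" "\<lambda>j. n - j"]) auto
  finally show ?thesis using assms(2) by (simp add: field_simps)
qed

text \<open>A covering argument: \<open>exist\<close> and \<open>unique\<close> express that the
  points of the fibre continue uniquely to nearby parameters, \<open>near\<close> that no point
  enters from elsewhere. Hence moving each point of \<open>Z s0\<close> to its continuation is a
  bijection of fibres.\<close>

lemma card_fibre_locally_constant:
  fixes Z :: "'s::topological_space \<Rightarrow> 't::metric_space set"
  assumes fin: "finite (Z s0)"
    and exist: "\<And>t e. t \<in> Z s0 \<Longrightarrow> e > 0 \<Longrightarrow> \<forall>\<^sub>F s in nhds s0. \<exists>u\<in>Z s. dist u t < e"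
    and unique: "\<And>t. t \<in> Z s0 \<Longrightarrow> \<exists>e>0. \<forall>\<^sub>F s in nhds s0. \<forall>u\<in>Z s. \<forall>v\<in>Z s. dist u t < e \<longrightarrow> dist v t < e \<longrightarrow> u = v"
    and near: "\<And>e. e > 0 \<Longrightarrow> \<forall>\<^sub>F s in nhds s0. \<forall>u\<in>Z s. \<exists>t\<in>Z s0. dist u t < e"
  shows "\<forall>\<^sub>F s in nhds s0. card (Z s) = card (Z s0)"
proof -
  obtain e1 where e1: "\<And>t. t \<in> Z s0 \<Longrightarrow> e1 t > 0"
    "\<And>t. t \<in> Z s0 \<Longrightarrow> \<forall>\<^sub>F s in nhds s0. \<forall>u\<in>Z s. \<forall>v\<in>Z s. dist u t < e1 t \<longrightarrow> dist v t < e1 t \<longrightarrow> u = v"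
  proof -
    let ?R = "\<lambda>t e. e > 0 \<and> (\<forall>\<^sub>F s in nhds s0. \<forall>u\<in>Z s. \<forall>v\<in>Z s. dist u t < e \<longrightarrow> dist v t < e \<longrightarrow> u = v)"
    have "\<forall>t\<in>Z s0. \<exists>e. ?R t e" using unique by blast
    from bchoice[OF this] show ?thesis using that by blast
  qed
  let ?P = "(\<lambda>(t, u). dist t u / 2) ` {(t, u). t \<in> Z s0 \<and> u \<in> Z s0 \<and> t \<noteq> u}"
  \<comment> \<open>\<open>e\<close> must be at most each uniqueness radius and half of each mutual
    distance, so that the balls around the points of \<open>Z s0\<close> are disjoint. The 1 keeps
    the set nonempty when the fibre is empty.\<close>
  let ?E = "insert 1 (e1 ` Z s0 \<union> ?P)"
  define e where "e = Min ?E"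
  have finE: "finite ?E"
  proof -
    have "{(t, u). t \<in> Z s0 \<and> u \<in> Z s0 \<and> t \<noteq> u} \<subseteq> Z s0 \<times> Z s0" by auto
    then have "finite {(t, u). t \<in> Z s0 \<and> u \<in> Z s0 \<and> t \<noteq> u}"
      by (rule finite_subset) (use fin in auto)
    then show ?thesis using fin by simp
  qed
  have "e > 0" unfolding e_def using finE e1(1) by (subst Min_gr_iff) auto
  have ele: "e \<le> x" if "x \<in> ?E" for x unfolding e_def using finE that by (rule Min_le)
  have e_sep: "t = u" if "t \<in> Z s0" "u \<in> Z s0" "dist v t < e" "dist v u < e" for t u v
  proof (rule ccontr)
    assume "t \<noteq> u"
    then have "e \<le> dist t u / 2" using that by (intro ele) force
    moreover have "dist t u \<le> dist v t + dist v u" by (metis dist_commute dist_triangle)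
    ultimately show False using that by linarith
  qed
  have "\<forall>\<^sub>F s in nhds s0. \<forall>t\<in>Z s0. (\<exists>u\<in>Z s. dist u t < e) \<and>
      (\<forall>u\<in>Z s. \<forall>v\<in>Z s. dist u t < e1 t \<longrightarrow> dist v t < e1 t \<longrightarrow> u = v)"
    using fin exist \<open>e > 0\<close> e1(2) by (intro eventually_ball_finite ballI eventually_conj) auto
  moreover have "\<forall>\<^sub>F s in nhds s0. \<forall>u\<in>Z s. \<exists>t\<in>Z s0. dist u t < e" using near \<open>e > 0\<close> by auto
  ultimately show ?thesis
  proof eventually_elim
    case (elim s)
    obtain h where h: "\<And>t. t \<in> Z s0 \<Longrightarrow> h t \<in> Z s \<and> dist (h t) t < e" using elim(1) by metis
    have "bij_betw h (Z s0) (Z s)"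
    proof (rule bij_betw_imageI)
      show "inj_on h (Z s0)"
        by (rule inj_onI) (metis e_sep h)
      show "h ` Z s0 = Z s"
      proof
        show "h ` Z s0 \<subseteq> Z s" using h by auto
        show "Z s \<subseteq> h ` Z s0"
        proof
          fix u assume u: "u \<in> Z s"
          then obtain t where t: "t \<in> Z s0" "dist u t < e" using elim(2) by auto
          have "e \<le> e1 t" using t(1) by (intro ele) auto
          then have "u = h t" using elim(1) t u h[OF t(1)] by fastforce
          then show "u \<in> h ` Z s0" using t(1) by auto
        qed
      qed
    qed
    then show ?case using bij_betw_same_card by metis
  qed
qed

section \<open>Critical points in exponential coordinates\<close>

definition cvec :: "int^'m \<Rightarrow> complex^'m" where
  "cvec w = (\<chi> i. of_int (w $ i))"

definition wlin :: "int^'m \<Rightarrow> complex^'m \<Rightarrow> complex" where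
  "wlin w z = (\<Sum>j\<in>UNIV. of_int (w $ j) * z $ j)"

lemma crit_eq_tmul_texp:
  "(\<Sum>w\<in>X. (c w * lmon w t * exp (wlin w z)) *s cvec w) = (\<chi> i. crit_eq X c i (tmul t (texp z)))"
  by (simp add: vec_eq_iff crit_eq_def lmon_tmul lmon_texp cvec_def wlin_def sum_component mult_ac)

lemma bounded_linear_scalar_mult_vec: "bounded_linear (\<lambda>a :: complex. a *s v)"
  by (intro linear_conv_bounded_linear[THEN iffD1] linearI) (auto simp: vec_eq_iff algebra_simps)

lemma bounded_linear_wlin: "bounded_linear (wlin w)"
  unfolding wlin_def
  by (intro linear_conv_bounded_linear[THEN iffD1] linearI)
     (auto simp: algebra_simps sum.distrib scaleR_sum_right)

text \<open>Carrying \<open>s\<close> along as a first component makes the inverse function theorem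
  serve as an implicit function theorem. The derivative is block triangular, with the identity and
  the Hessian on the diagonal.\<close>

lemma nondegenerate_local_homeomorphism:
  fixes X :: "(int^'m) set" and c0 d :: "int^'m \<Rightarrow> complex" and t :: "complex^'m" and s0 :: complex
  defines "c \<equiv> \<lambda>s w. c0 w + s * d w"
  defines "\<Phi> \<equiv> \<lambda>p :: complex \<times> (complex^'m). (fst p, \<chi> i. crit_eq X (c (fst p)) i (tmul t (texp (snd p))))"
  assumes nondeg: "det (hess X (\<lambda>w. c s0 w * lmon w t)) \<noteq> 0"
  shows "\<exists>U V g. open U \<and> (s0, 0) \<in> U \<and> open V \<and> homeomorphism U V \<Phi> g"
proof -
  define D where "D p h = (fst h, \<Sum>w\<in>X. (fst h * d w * lmon w t * exp (wlin w (snd p)) +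
      c (fst p) w * lmon w t * (exp (wlin w (snd p)) * wlin w (snd h))) *s cvec w)"
    for p h :: "complex \<times> (complex^'m)"
  have \<Phi>: "\<Phi> = (\<lambda>p. (fst p, \<Sum>w\<in>X. (c (fst p) w * lmon w t * exp (wlin w (snd p))) *s cvec w))"
    by (simp add: \<Phi>_def crit_eq_tmul_texp)
  have der: "(\<Phi> has_derivative D p) (at p)" for p
  proof -
    have 1: "((\<lambda>p. wlin w (snd p)) has_derivative (\<lambda>h. wlin w (snd h))) (at p)" for w :: "int^'m"
      by (intro bounded_linear.has_derivative[OF bounded_linear_wlin] has_derivative_snd has_derivative_ident)
    have 2: "((\<lambda>p. exp (wlin w (snd p))) has_derivative (\<lambda>h. exp (wlin w (snd p)) * wlin w (snd h))) (at p)" for w :: "int^'m"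
      by (rule has_derivative_compose[OF 1 DERIV_exp[unfolded has_field_derivative_def]])
    have "((\<lambda>p. c (fst p) w * lmon w t * exp (wlin w (snd p))) has_derivative
        (\<lambda>h. fst h * d w * lmon w t * exp (wlin w (snd p)) +
          c (fst p) w * lmon w t * (exp (wlin w (snd p)) * wlin w (snd h)))) (at p)" for w
      unfolding c_def by (rule derivative_eq_intros refl 2 | simp add: fun_eq_iff algebra_simps)+
    note bounded_linear.has_derivative[OF bounded_linear_scalar_mult_vec this]
    then show ?thesis
      unfolding \<Phi> D_def by (intro has_derivative_Pair has_derivative_fst has_derivative_ident has_derivative_sum)
  qed
  have bl: "bounded_linear (D p)" for p using der by (rule has_derivative_bounded_linear)
  define f' where "f' p = Blinfun (D p)" for p
  have f': "blinfun_apply (f' p) = D p" for p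
    unfolding f'_def by (rule bounded_linear_Blinfun_apply[OF bl])
  have cont: "continuous_on UNIV f'"
  proof (rule continuous_on_blinfun_componentwise)
    fix h :: "complex \<times> (complex^'m)"
    have w: "continuous_on UNIV (\<lambda>p. wlin w (snd p))" for w :: "int^'m"
      by (intro bounded_linear.continuous_on[OF bounded_linear_wlin] continuous_intros)
    show "continuous_on UNIV (\<lambda>p. blinfun_apply (f' p) h)"
      unfolding f' D_def c_def
      by (intro continuous_intros w bounded_linear.continuous_on[OF bounded_linear_scalar_mult_vec])
  qed
  have "inj (D (s0, 0))"
  proof (rule linear_injective_0[THEN iffD2, OF bounded_linear.linear[OF bl]], intro allI impI)
    fix h assume h: "D (s0, 0) h = 0"
    then have fst0: "fst h = 0" by (simp add: D_def zero_prod_def)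
    have wz: "wlin w 0 = 0" for w :: "int^'m" by (simp add: wlin_def)
    let ?H = "hess X (\<lambda>w. c s0 w * lmon w t)"
    have "(?H *v snd h) $ i = snd (D (s0, 0) h) $ i" for i
      by (simp add: D_def hess_mult_vec fst0 wz sum_component cvec_def wlin_def mult_ac)
    then have "?H *v snd h = 0" using h by (simp add: vec_eq_iff)
    then have "snd h = 0"
      using nondeg unfolding invertible_det_nz[symmetric] invertible_left_inverse matrix_left_invertible_ker by blast
    then show "h = 0" using fst0 by (simp add: prod_eq_iff)
  qed
  then obtain g where g: "linear g" "g \<circ> D (s0, 0) = id"
    using linear_injective_left_inverse[OF bounded_linear.linear[OF bl]] by blast
  have "blinfun_apply (Blinfun g) = g"
    using g(1) by (intro bounded_linear_Blinfun_apply) (simp add: linear_conv_bounded_linear)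
  then have inv: "Blinfun g o\<^sub>L f' (s0, 0) = id_blinfun"
    by (intro blinfun_eqI) (use fun_cong[OF g(2)] in \<open>simp add: f'\<close>)
  show ?thesis
    by (rule inverse_function_theorem[OF open_UNIV der[folded f'] cont UNIV_I inv]) blast
qed

lemma torus_chart_inverse:
  assumes "t \<in> torus_T" "u \<in> torus_T"
  shows "tmul t (texp (\<chi> i. Ln (u $ i / t $ i))) = u"
  using assms by (simp add: vec_eq_iff tmul_def texp_def torus_T_def)

text \<open>Critical points for the parameter \<open>s\<close> near \<open>t\<close> are the
  preimages of \<open>(s, 0)\<close> under the local homeomorphism. Injectivity gives uniqueness;
  continuity of its inverse gives a critical point close to \<open>t\<close>.\<close>

lemma crit_points_locally_unique:
  fixes X :: "(int^'m) set" and c0 d :: "int^'m \<Rightarrow> complex"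
  defines "c \<equiv> \<lambda>s w. c0 w + s * d w"
  assumes t: "t \<in> crit_points X (c s0)" and nondeg: "det (hess X (\<lambda>w. c s0 w * lmon w t)) \<noteq> 0"
  shows "\<exists>e>0. \<forall>\<^sub>F s in nhds s0. \<forall>u\<in>crit_points X (c s). \<forall>v\<in>crit_points X (c s). dist u t < e \<longrightarrow> dist v t < e \<longrightarrow> u = v"
    and "\<And>e. e > 0 \<Longrightarrow> \<forall>\<^sub>F s in nhds s0. \<exists>u\<in>crit_points X (c s). dist u t < e"
proof -
  define \<Phi> where "\<Phi> = (\<lambda>p :: complex \<times> (complex^'m). (fst p, \<chi> i. crit_eq X (c (fst p)) i (tmul t (texp (snd p)))))"
  obtain U V g where U: "open U" "(s0, 0) \<in> U" "open V" "homeomorphism U V \<Phi> g"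
    using nondegenerate_local_homeomorphism[of X c0 s0 d t] nondeg unfolding \<Phi>_def c_def by blast
  have tT: "t \<in> torus_T" and te: "\<And>i. crit_eq X (c s0) i t = 0" using t by (auto simp: crit_points_def)
  have texp0: "tmul t (texp 0) = t" by (simp add: tmul_def texp_def vec_eq_iff)
  obtain A B where AB: "open A" "open B" "s0 \<in> A" "0 \<in> B" "A \<times> B \<subseteq> U"
    by (rule open_prod_elim[OF U(1,2)]) blast
  \<comment> \<open>Principal logarithms suffice: at \<open>u = t\<close> the quotients are 1, away
    from the branch cut, so \<open>z\<close> is continuous there.\<close>
  define z where "z u = (\<chi> i. Ln (u $ i / t $ i))" for u
  have "isCont z t"
    unfolding z_def isCont_def using tT
    by (intro tendsto_vec_lambda tendsto_intros) (auto simp: torus_T_def)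
  then have "(z \<longlongrightarrow> z t) (nhds t)" by (simp only: isCont_def tendsto_at_iff_tendsto_nhds)
  moreover have "z t = 0" using tT by (simp add: z_def vec_eq_iff torus_T_def)
  ultimately have "\<forall>\<^sub>F u in nhds t. z u \<in> B"
    using AB(2,4) topological_tendstoD[of z 0 "nhds t" B]
    by simp
  then obtain e where e: "e > 0" "\<And>u. dist u t < e \<Longrightarrow> z u \<in> B"
    unfolding eventually_nhds_metric by auto
  have "u = v" if s: "s \<in> A" and uv: "u \<in> crit_points X (c s)" "v \<in> crit_points X (c s)" "dist u t < e" "dist v t < e" for s u v
  proof -
    have T: "u \<in> torus_T" "v \<in> torus_T" using uv by (auto simp: crit_points_def)
    have "\<Phi> (s, z u) = (s, 0)" "\<Phi> (s, z v) = (s, 0)"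
      unfolding \<Phi>_def z_def fst_conv snd_conv torus_chart_inverse[OF tT T(1)] torus_chart_inverse[OF tT T(2)]
      using uv(1,2) by (auto simp: crit_points_def vec_eq_iff)
    moreover have "(s, z u) \<in> U" "(s, z v) \<in> U" using AB(5) s e(2) uv(3,4) by blast+
    ultimately have "z u = z v" using U(4) by (metis homeomorphism_apply1 snd_conv)
    then show ?thesis
      using torus_chart_inverse[OF tT T(1)] torus_chart_inverse[OF tT T(2)] unfolding z_def by metis
  qed
  then show "\<exists>e>0. \<forall>\<^sub>F s in nhds s0. \<forall>u\<in>crit_points X (c s). \<forall>v\<in>crit_points X (c s). dist u t < e \<longrightarrow> dist v t < e \<longrightarrow> u = v"
    using e(1) AB(1,3) by (auto simp: eventually_nhds intro!: exI[of _ e] exI[of _ A])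
  fix e :: real assume "e > 0"
  have \<Phi>0: "\<Phi> (s0, 0) = (s0, 0)" by (simp add: \<Phi>_def texp0 te vec_eq_iff)
  then have V0: "(s0, 0) \<in> V" "g (s0, 0) = (s0, 0)"
    using U(2,4) by (metis homeomorphism_image1 imageI, metis homeomorphism_apply1)
  have "isCont (\<lambda>s. g (s, 0)) s0"
  proof -
    have "continuous_on V g" using U(4) by (rule homeomorphism_cont2)
    then have "isCont g (s0, 0)" using U(3) V0(1) by (simp add: continuous_on_eq_continuous_at)
    moreover have "isCont (\<lambda>s :: complex. (s, 0 :: complex^'m)) s0" by (intro continuous_intros)
    ultimately show ?thesis by (rule isCont_o2[rotated])
  qed
  then have "isCont (\<lambda>s. tmul t (texp (snd (g (s, 0))))) s0"
    unfolding tmul_def texp_def isCont_def by (intro tendsto_vec_lambda tendsto_intros)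
  then have "((\<lambda>s. tmul t (texp (snd (g (s, 0))))) \<longlongrightarrow> tmul t (texp (snd (g (s0, 0))))) (nhds s0)"
    unfolding isCont_def tendsto_at_iff_tendsto_nhds[of "\<lambda>s. tmul t (texp (snd (g (s, 0))))"] .
  then have "((\<lambda>s. tmul t (texp (snd (g (s, 0))))) \<longlongrightarrow> t) (nhds s0)"
    by (simp add: V0(2) texp0)
  then have "\<forall>\<^sub>F s in nhds s0. dist (tmul t (texp (snd (g (s, 0))))) t < e"
    using \<open>e > 0\<close> by (rule tendstoD)
  moreover have "\<forall>\<^sub>F s in nhds s0. (s, 0) \<in> V"
  proof -
    have "open ((\<lambda>s. (s, 0)) -` V)" using U(3) by (intro open_vimage continuous_intros)
    then show ?thesis using V0(1) unfolding eventually_nhds by blast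
  qed
  ultimately show "\<forall>\<^sub>F s in nhds s0. \<exists>u\<in>crit_points X (c s). dist u t < e"
  proof eventually_elim
    case (elim s)
    have "\<Phi> (g (s, 0)) = (s, 0)" using U(4) elim(2) by (metis homeomorphism_apply2)
    then have "fst (g (s, 0)) = s" "\<And>i. crit_eq X (c s) i (tmul t (texp (snd (g (s, 0))))) = 0"
      by (auto simp: \<Phi>_def vec_eq_iff)
    then have "tmul t (texp (snd (g (s, 0)))) \<in> crit_points X (c s)"
      using tT torus_T_texp torus_T_tmul by (auto simp: crit_points_def)
    then show ?case using elim(1) by blast
  qed
qed

lemma poly_fun_line_tendsto:
  fixes p :: "('i \<Rightarrow> complex) \<Rightarrow> complex"
  assumes "p \<in> poly_fun" "(f \<longlongrightarrow> s0) F"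
  shows "((\<lambda>n. p (\<lambda>i. x i + f n * v i)) \<longlongrightarrow> p (\<lambda>i. x i + s0 * v i)) F"
proof -
  obtain P where "\<forall>s. p (\<lambda>i. x i + s * v i) = poly P s" using poly_fun_on_line[OF assms(1)] by blast
  then show ?thesis using assms(2) by (simp add: tendsto_poly)
qed

text \<open>Properness. Otherwise there is a sequence of critical points, with parameters tending to
  \<open>s0\<close>, that stays away from those at \<open>s0\<close>. Nonzero leading coefficients
  bound it, so a subsequence converges; nonzero constant coefficients keep the limit in the torus,
  where by continuity it is a critical point for \<open>s0\<close>.\<close>

lemma crit_points_near_limit:
  fixes X :: "(int^'m) set" and c0 d :: "int^'m \<Rightarrow> complex"
  defines "c \<equiv> \<lambda>s w. c0 w + s * d w"
  assumes a: "\<And>i j. a i j \<in> poly_fun" "\<And>i. a i 0 (c s0) \<noteq> 0 \<and> a i (N i) (c s0) \<noteq> 0"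
    and rel: "\<And>i s t. t \<in> crit_points X (c s) \<Longrightarrow> (\<Sum>j\<le>N i. a i j (c s) * (t $ i) ^ j) = 0"
    and "e > 0"
  shows "\<forall>\<^sub>F s in nhds s0. \<forall>u\<in>crit_points X (c s). \<exists>t\<in>crit_points X (c s0). dist u t < e"
proof (rule ccontr)
  let ?P = "\<lambda>s. \<forall>u\<in>crit_points X (c s). \<exists>t\<in>crit_points X (c s0). dist u t < e"
  let ?Q = "\<lambda>s. \<forall>i. a i (N i) (c s) \<noteq> 0"
  assume "\<not> ?thesis"
  moreover have "eventually ?Q (nhds s0)"
  proof (rule eventually_all_finite)
    fix i
    have "((\<lambda>s. a i (N i) (c s)) \<longlongrightarrow> a i (N i) (c s0)) (nhds s0)"
      unfolding c_def by (rule poly_fun_line_tendsto[OF a(1) filterlim_ident])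
    then show "\<forall>\<^sub>F s in nhds s0. a i (N i) (c s) \<noteq> 0"
      using a(2) by (intro tendsto_imp_eventually_ne) auto
  qed
  ultimately have ev: "\<not> eventually (\<lambda>s. ?Q s \<longrightarrow> ?P s) (nhds s0)"
    using eventually_mp[of ?Q ?P "nhds s0"] by argo
  then have "\<exists>s. dist s s0 < inverse (real (Suc n)) \<and> ?Q s \<and> \<not> ?P s" for n
  proof -
    have "inverse (real (Suc n)) > 0" by simp
    with ev show ?thesis unfolding eventually_nhds_metric by blast
  qed
  then obtain S where S: "\<And>n. dist (S n) s0 < inverse (real (Suc n))" "\<And>n. ?Q (S n)" "\<And>n. \<not> ?P (S n)"
    by metis
  have limS: "S \<longlonglongrightarrow> s0"
    by (rule tendsto_dist_iff[THEN iffD2], rule tendsto_sandwich[OF _ _ tendsto_const LIMSEQ_inverse_real_of_nat])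
       (use S(1) in \<open>auto intro!: always_eventually less_imp_le\<close>)
  obtain u where u: "\<And>n. u n \<in> crit_points X (c (S n))" "\<And>n t. t \<in> crit_points X (c s0) \<Longrightarrow> dist (u n) t \<ge> e"
    using S(3) by (metis not_less)
  have lim: "((\<lambda>n. a i j (c (f n))) \<longlonglongrightarrow> a i j (c s0))" if "f \<longlonglongrightarrow> s0" for f i j
    unfolding c_def by (rule poly_fun_line_tendsto[OF a(1) that])
  have B: "(\<lambda>n. \<Sum>j\<le>N i. cmod (a i j (c (f n)))) \<longlonglongrightarrow> (\<Sum>j\<le>N i. cmod (a i j (c s0)))" if "f \<longlonglongrightarrow> s0" for f i
    by (intro tendsto_intros lim that)
  have "\<exists>M. \<forall>n. cmod (u n $ i) \<le> M" for i
  proof -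
    let ?r = "\<lambda>n. (\<Sum>j\<le>N i. cmod (a i j (c (S n)))) / cmod (a i (N i) (c (S n)))"
    have "?r \<longlonglongrightarrow> (\<Sum>j\<le>N i. cmod (a i j (c s0))) / cmod (a i (N i) (c s0))"
      using a(2) by (intro tendsto_intros B lim limS) auto
    then have "Bseq ?r" by (rule convergent_imp_Bseq[OF convergentI])
    then obtain M where M: "\<And>n. norm (?r n) \<le> M" by (auto simp: Bseq_def)
    have "cmod (u n $ i) \<le> M" for n
    proof -
      have "cmod (u n $ i) \<le> ?r n"
        using power_sum_root_bound[OF rel[OF u(1)[of n], of i]] S(2)[of n] by (simp add: field_simps)
      also have "?r n \<le> norm (?r n)" by (simp only: real_norm_def abs_ge_self)
      also have "\<dots> \<le> M" by (rule M)
      finally show ?thesis .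
    qed
    then show ?thesis by blast
  qed
  then obtain M where M: "\<And>n i. cmod (u n $ i) \<le> M i" by metis
  have "bounded (range u)"
  proof (rule boundedI)
    fix x assume "x \<in> range u"
    then obtain n where "x = u n" by auto
    then have "norm x \<le> (\<Sum>i\<in>UNIV. cmod (u n $ i))" by (simp add: norm_vec_def L2_set_le_sum)
    also have "\<dots> \<le> (\<Sum>i\<in>UNIV. M i)" by (intro sum_mono M)
    finally show "norm x \<le> (\<Sum>i\<in>UNIV. M i)" .
  qed
  from bounded_imp_convergent_subsequence[OF this] obtain v q where q: "strict_mono q" "(u \<circ> q) \<longlonglongrightarrow> v" by auto
  have Sq: "(\<lambda>n. S (q n)) \<longlonglongrightarrow> s0" using LIMSEQ_subseq_LIMSEQ[OF limS q(1)] by (simp add: o_def)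
  have uq: "(\<lambda>n. u (q n) $ i) \<longlonglongrightarrow> v $ i" for i
    using q(2) by (intro tendsto_vec_nth) (simp add: o_def)
  have v0: "v $ i \<noteq> 0" for i
  proof -
    have "cmod (a i 0 (c s0)) \<le> cmod (v $ i) * (\<Sum>j\<le>N i. cmod (a i j (c s0)))"
    proof (rule LIMSEQ_le)
      show "(\<lambda>n. cmod (a i 0 (c (S (q n))))) \<longlonglongrightarrow> cmod (a i 0 (c s0))" by (intro tendsto_intros lim Sq)
      show "(\<lambda>n. cmod (u (q n) $ i) * (\<Sum>j\<le>N i. cmod (a i j (c (S (q n)))))) \<longlonglongrightarrow>
          cmod (v $ i) * (\<Sum>j\<le>N i. cmod (a i j (c s0)))" by (intro tendsto_intros B Sq uq)
      have "u n $ i \<noteq> 0" for n using u(1)[of n] by (simp add: crit_points_def torus_T_def)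
      then show "\<exists>n0. \<forall>n\<ge>n0. cmod (a i 0 (c (S (q n)))) \<le> cmod (u (q n) $ i) * (\<Sum>j\<le>N i. cmod (a i j (c (S (q n)))))"
        using power_sum_root_lower_bound[OF rel[OF u(1)]] by blast
    qed
    then show ?thesis using a(2)[of i] by auto
  qed
  have "(\<lambda>n. crit_eq X (c (S (q n))) i (u (q n))) \<longlonglongrightarrow> crit_eq X (c s0) i v" for i
    unfolding crit_eq_def c_def lmon_def by (intro tendsto_intros Sq uq v0)
  moreover have "crit_eq X (c (S (q n))) i (u (q n)) = 0" for i n
    using u(1)[of "q n"] by (simp add: crit_points_def)
  ultimately have "crit_eq X (c s0) i v = 0" for i by (simp add: LIMSEQ_const_iff)
  then have "v \<in> crit_points X (c s0)" using v0 by (simp add: crit_points_def torus_T_def)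
  then have "e \<le> dist (u (q n)) v" for n by (rule u(2))
  moreover have "(\<lambda>n. dist (u (q n)) v) \<longlonglongrightarrow> 0" using tendsto_dist_iff[THEN iffD1, OF q(2)] by (simp add: o_def)
  ultimately have "e \<le> 0" by (meson LIMSEQ_le_const)
  then show False using \<open>e > 0\<close> by simp
qed

theorem generic_card_crit_points:
  fixes X :: "(int^'m) set"
  assumes X: "symmetric_spanning X"
  shows "\<exists>p n. p \<in> poly_fun \<and> depends_on X p \<and> p \<noteq> (\<lambda>_. 0) \<and>
    (\<forall>c. p c \<noteq> 0 \<longrightarrow> finite (crit_points X c) \<and> card (crit_points X c) = n) \<and> real n \<le> norm_vol X"
proof -
  obtain p N a where p: "p \<in> poly_fun" "depends_on X p" "p \<noteq> (\<lambda>_. 0)"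
    and nondeg: "\<And>c t. p c \<noteq> 0 \<Longrightarrow> t \<in> crit_points X c \<Longrightarrow> det (hess X (\<lambda>w. c w * lmon w t)) \<noteq> 0"
    and a: "\<And>i j. a i j \<in> poly_fun" "\<And>i c. p c \<noteq> 0 \<Longrightarrow> a i 0 c \<noteq> 0 \<and> a i (N i) c \<noteq> 0"
    and rel: "\<And>i c t. t \<in> crit_points X c \<Longrightarrow> (\<Sum>j\<le>N i. a i j c * (t $ i) ^ j) = 0"
    using generic_locus[OF X] by blast
  \<comment> \<open>The volume bound applies to each finite set of critical points, and thereby also
    shows that there are finitely many.\<close>
  have fin: "finite (crit_points X c) \<and> real (card (crit_points X c)) \<le> norm_vol X" if "p c \<noteq> 0" for c
  proof -
    have le: "real (card F) \<le> norm_vol X" if "F \<subseteq> crit_points X c" "finite F" for F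
      using card_nondegenerate_crit_points_le[OF X that(2,1)] nondeg[OF \<open>p c \<noteq> 0\<close>] that(1) by blast
    have "card F \<le> nat \<lfloor>norm_vol X\<rfloor>" if "F \<subseteq> crit_points X c" "finite F" for F
      using le[OF that] by linarith
    then have "finite (crit_points X c)" using finite_if_finite_subsets_card_bdd by metis
    then show ?thesis using le by blast
  qed
  have const: "card (crit_points X c0) = card (crit_points X c1)" if c01: "p c0 \<noteq> 0" "p c1 \<noteq> 0" for c0 c1
  proof -
    define d where "d w = c1 w - c0 w" for w
    define c where "c s = (\<lambda>w. c0 w + s * d w)" for s
    define S where "S = {s. p (c s) \<noteq> 0}"
    have c: "c 0 = c0" "c 1 = c1" by (auto simp: c_def d_def)
    have "finite {s. p (c s) = 0}"
      using poly_fun_line_zeros_finite[OF p(1), of c0 0 d] c01(1) by (simp add: c_def)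
    moreover have "S = - {s. p (c s) = 0}" by (auto simp: S_def)
    ultimately have S: "connected S" "open S"
      by (auto intro!: path_connected_imp_connected path_connected_complement_countable countable_finite
          open_Compl finite_imp_closed)
    have "(\<lambda>s. card (crit_points X (c s))) constant_on S"
    proof (rule locally_constant_imp_constant[OF S(1)])
      fix s0 assume "s0 \<in> S"
      then have s0: "p (c s0) \<noteq> 0" by (simp add: S_def)
      have "\<forall>\<^sub>F s in nhds s0. card (crit_points X (c s)) = card (crit_points X (c s0))"
      proof (rule card_fibre_locally_constant)
        show "finite (crit_points X (c s0))" using fin[OF s0] by simp
        show "\<forall>\<^sub>F s in nhds s0. \<exists>u\<in>crit_points X (c s). dist u t < e"
          if "t \<in> crit_points X (c s0)" "e > 0" for t e
          using crit_points_locally_unique(2)[of t X c0 s0 d e] that nondeg[OF s0] unfolding c_def by blast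
        show "\<exists>e>0. \<forall>\<^sub>F s in nhds s0. \<forall>u\<in>crit_points X (c s). \<forall>v\<in>crit_points X (c s).
            dist u t < e \<longrightarrow> dist v t < e \<longrightarrow> u = v" if "t \<in> crit_points X (c s0)" for t
          using crit_points_locally_unique(1)[of t X c0 s0 d] that nondeg[OF s0] unfolding c_def by blast
        show "\<forall>\<^sub>F s in nhds s0. \<forall>u\<in>crit_points X (c s). \<exists>t\<in>crit_points X (c s0). dist u t < e" if "e > 0" for e
          using crit_points_near_limit[of a c0 s0 d N X e] a(1) a(2)[OF s0] rel that unfolding c_def by blast
      qed
      then obtain T where T: "open T" "s0 \<in> T" "\<And>s. s \<in> T \<Longrightarrow> card (crit_points X (c s)) = card (crit_points X (c s0))"
        unfolding eventually_nhds by blast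
      show "\<exists>T. openin (top_of_set S) T \<and> s0 \<in> T \<and> (\<forall>s\<in>T. card (crit_points X (c s)) = card (crit_points X (c s0)))"
      proof (intro exI conjI ballI)
        show "openin (top_of_set S) (S \<inter> T)" by (rule openin_open_Int[OF T(1)])
        show "s0 \<in> S \<inter> T" using T(2) \<open>s0 \<in> S\<close> by (rule IntI[rotated])
        show "card (crit_points X (c s)) = card (crit_points X (c s0))" if "s \<in> S \<inter> T" for s
          by (rule T(3)[OF IntD2[OF that]])
      qed
    qed
    moreover have "0 \<in> S" "1 \<in> S" using c01 by (auto simp: S_def c)
    ultimately have "card (crit_points X (c 0)) = card (crit_points X (c 1))" by (auto simp: constant_on_def)
    then show ?thesis by (simp add: c)
  qed
  obtain c0 where c0: "p c0 \<noteq> 0" using p(3) by (auto simp: fun_eq_iff)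
  have "\<forall>c. p c \<noteq> 0 \<longrightarrow> finite (crit_points X c) \<and> card (crit_points X c) = card (crit_points X c0)"
    using fin const[OF _ c0] by blast
  then show ?thesis using p fin[OF c0] by blast
qed

section \<open>Weight decomposition of a torus datum\<close>

definition lincomb :: "'x set \<Rightarrow> ('x \<Rightarrow> complex) \<Rightarrow> ('x \<Rightarrow> complex^'n^'k) \<Rightarrow> complex^'n^'k" where
  "lincomb S f A = (\<chi> i j. \<Sum>w\<in>S. f w * A w $ i $ j)"

lemma lincomb_nth: "lincomb S f A $ i $ j = (\<Sum>w\<in>S. f w * A w $ i $ j)"
  by (simp add: lincomb_def)

lemma matrix_mult_nth: "(A ** B) $ i $ j = (\<Sum>k\<in>UNIV. A $ i $ k * B $ k $ j)"
  by (simp add: matrix_matrix_mult_def)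

lemma lincomb_mult_right: "lincomb S f A ** B = lincomb S f (\<lambda>w. A w ** B)"
  unfolding vec_eq_iff lincomb_nth matrix_mult_nth sum_distrib_left sum_distrib_right
  by (subst sum.swap) (simp add: mult.assoc)

lemma lincomb_mult_left: "B ** lincomb S f A = lincomb S f (\<lambda>w. B ** A w)"
  unfolding vec_eq_iff lincomb_nth matrix_mult_nth sum_distrib_left sum_distrib_right
  by (subst sum.swap) (simp add: mult.left_commute)

lemma trace_lincomb: "trace (lincomb S f A) = (\<Sum>w\<in>S. f w * trace (A w))"
  unfolding trace_def lincomb_nth sum_distrib_left by (rule sum.swap)

lemma lincomb_cong: "(\<And>w. w \<in> S \<Longrightarrow> f w = g w) \<Longrightarrow> (\<And>w. w \<in> S \<Longrightarrow> A w = B w) \<Longrightarrow> lincomb S f A = lincomb S g B"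
  by (simp add: lincomb_def)

lemma lincomb_single:
  assumes "finite S" "v \<in> S" "\<And>w. w \<in> S \<Longrightarrow> A w = (if w = v then B else 0)"
  shows "lincomb S f A = (\<chi> i j. f v * B $ i $ j)"
proof -
  have "(\<Sum>w\<in>S. f w * A w $ i $ j) = (\<Sum>w\<in>S. if w = v then f v * B $ i $ j else 0)" for i j
    using assms(3) by (intro sum.cong) auto
  then show ?thesis using assms(1,2) by (simp add: lincomb_def)
qed

lemma lincomb_coeff_eq:
  fixes S :: "(int^'m) set"
  assumes "finite S" "\<And>t. t \<in> torus_T \<Longrightarrow> lincomb S (\<lambda>w. lmon w t) A = lincomb S (\<lambda>w. lmon w t) B" "w \<in> S"
  shows "A w = B w"
proof -
  have "A w $ i $ j - B w $ i $ j = 0" for i j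
  proof (rule lmon_independent[OF assms(1) _ assms(3)])
    fix t :: "complex^'m" assume "t \<in> torus_T"
    from arg_cong[OF assms(2)[OF this], of "\<lambda>M. M $ i $ j"]
    show "(\<Sum>w\<in>S. (A w $ i $ j - B w $ i $ j) * lmon w t) = 0"
      by (simp add: lincomb_nth algebra_simps sum_subtractf)
  qed
  then show ?thesis by (simp add: vec_eq_iff)
qed

lemma cmat_nth: "cmat A $ i $ j = complex_of_real (A $ i $ j)"
  by (simp add: cmat_def)

lemma cmat_mult: "cmat (A ** B) = cmat A ** cmat B"
  by (simp add: vec_eq_iff cmat_nth matrix_mult_nth)

lemma cmat_mat_one: "cmat (mat 1) = mat 1"
  by (simp add: vec_eq_iff cmat_nth mat_def)

lemma cmat_transpose: "cmat (transpose A) = transpose (cmat A)"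
  by (simp add: vec_eq_iff cmat_nth transpose_def)

lemma matrix_mult_diff_left: "(A - B) ** C = A ** C - B ** (C :: complex^'n^'k)"
  by (simp add: vec_eq_iff matrix_mult_nth algebra_simps sum_subtractf)

lemma laurent_entries:
  assumes "alg_torus_iso G \<phi>"
  shows "\<exists>S A. finite S \<and> (\<forall>t\<in>torus_T. \<phi> t = lincomb S (\<lambda>w. lmon w t) A)"
proof -
  have ex: "\<exists>S. finite S \<and> (\<lambda>t. \<phi> t $ i $ j) \<in> span_on torus_T lmon S" for i j
  proof -
    obtain p k where p: "p \<in> poly_fun" "\<And>z. z \<in> torus_T \<Longrightarrow> \<phi> z $ i $ j * (\<Prod>l\<in>UNIV. z $ l) ^ k = p (vec_nth z)"
      using assms unfolding alg_torus_iso_def by blast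
    obtain B x where B: "finite B" "\<And>z. p z = (\<Sum>a\<in>B. x a * (\<Prod>i\<in>UNIV. z i ^ a i))"
      using poly_fun_normal_form[OF p(1)] by (auto simp: span_on_def)
    \<comment> \<open>Dividing by the \<open>k\<close>-th power of the product of the coordinates
      lowers every exponent by \<open>k\<close>.\<close>
    define e where "e a = (\<chi> l. int (a l) - int k)" for a :: "'b \<Rightarrow> nat"
    have "(\<lambda>t. \<Sum>a\<in>B. x a * lmon (e a) t) \<in> span_on torus_T lmon (e ` B)"
      using B(1) by (intro span_on_sum span_on_scale span_on_generator) auto
    then have "(\<lambda>t. \<phi> t $ i $ j) \<in> span_on torus_T lmon (e ` B)"
    proof (rule span_on_cong)
      fix t :: "complex^'b" assume t: "t \<in> torus_T"
      have "(\<Prod>l\<in>UNIV. (t $ l) ^ a l) = lmon (e a) t * (\<Prod>l\<in>UNIV. t $ l) ^ k" for a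
      proof -
        have "(t $ l) ^ a l = (t $ l) powi (int (a l) - int k) * (t $ l) ^ k" for l
          using t power_int_add[of "t $ l" "int (a l) - int k" "int k"] by (simp add: torus_T_def)
        then show ?thesis by (simp add: lmon_def e_def prod.distrib prod_power_distrib)
      qed
      then have "\<phi> t $ i $ j * (\<Prod>l\<in>UNIV. t $ l) ^ k = (\<Sum>a\<in>B. x a * lmon (e a) t) * (\<Prod>l\<in>UNIV. t $ l) ^ k"
        using p(2)[OF t] B(2) by (simp add: sum_distrib_right mult.assoc)
      moreover have "(\<Prod>l\<in>UNIV. t $ l) ^ k \<noteq> 0" using t by (simp add: torus_T_def)
      ultimately show "(\<Sum>a\<in>B. x a * lmon (e a) t) = \<phi> t $ i $ j"
        by (metis mult_right_cancel)
    qed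
    then show ?thesis using B(1) by blast
  qed
  then obtain S where S: "\<And>i j. finite (S i j)" "\<And>i j. (\<lambda>t. \<phi> t $ i $ j) \<in> span_on torus_T lmon (S i j)" by metis
  define U where "U = (\<Union>i. \<Union>j. S i j)"
  have U: "finite U" using S(1) by (simp add: U_def)
  have "(\<lambda>t. \<phi> t $ i $ j) \<in> span_on torus_T lmon U" for i j
    by (rule span_on_mono[OF S(2) _ U]) (auto simp: U_def)
  then have "\<exists>x. \<forall>t\<in>torus_T. \<phi> t $ i $ j = (\<Sum>w\<in>U. x w * lmon w t)" for i j by (simp add: span_on_def)
  then obtain x where x: "\<And>i j t. t \<in> torus_T \<Longrightarrow> \<phi> t $ i $ j = (\<Sum>w\<in>U. x i j w * lmon w t)" by metis
  have "\<phi> t = lincomb U (\<lambda>w. lmon w t) (\<lambda>w. \<chi> i j. x i j w)" if "t \<in> torus_T" for t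
    using x[OF that] by (simp add: vec_eq_iff lincomb_nth mult.commute)
  then show ?thesis using U by blast
qed

text \<open>Comparing coefficients in \<open>\<phi> (s t) = \<phi> s \<phi> t\<close> shows that the
  coefficient matrices of \<open>\<phi>\<close> are orthogonal idempotents.\<close>

lemma weight_decomposition:
  fixes \<phi> :: "complex^'m \<Rightarrow> complex^'n^'n"
  assumes iso: "alg_torus_iso G \<phi>"
  shows "\<exists>A. finite (weights \<phi>) \<and> (\<forall>t\<in>torus_T. \<phi> t = lincomb (weights \<phi>) (\<lambda>w. lmon w t) A) \<and>
    (\<forall>w\<in>weights \<phi>. A w \<noteq> 0) \<and>
    (\<forall>v\<in>weights \<phi>. \<forall>w\<in>weights \<phi>. A v ** A w = (if v = w then A w else 0)) \<and>
    lincomb (weights \<phi>) (\<lambda>_. 1) A = mat 1"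
proof -
  obtain S A where S: "finite S" and \<phi>: "\<And>t. t \<in> torus_T \<Longrightarrow> \<phi> t = lincomb S (\<lambda>w. lmon w t) A"
    using laurent_entries[OF iso] by blast
  have mult: "\<phi> (tmul s t) = \<phi> s ** \<phi> t" if "s \<in> torus_T" "t \<in> torus_T" for s t
    using iso that unfolding alg_torus_iso_def tmul_def by blast
  have orth: "A v ** A w = (if v = w then A w else 0)" if vw: "v \<in> S" "w \<in> S" for v w
  proof -
    \<comment> \<open>The homomorphism law is read as an identity of Laurent polynomials in
      \<open>s\<close> with \<open>t\<close> fixed; what results for the coefficient at
      \<open>v\<close> is afterwards compared in \<open>t\<close>.\<close>
    have 1: "lincomb S (\<lambda>w. lmon w t) (\<lambda>w. A v ** A w) = (\<chi> i j. lmon v t * A v $ i $ j)" if t: "t \<in> torus_T" for t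
    proof -
      have "lincomb S (\<lambda>v. lmon v s) (\<lambda>v. \<chi> i j. lmon v t * A v $ i $ j) =
          lincomb S (\<lambda>v. lmon v s) (\<lambda>v. A v ** lincomb S (\<lambda>w. lmon w t) A)" if s: "s \<in> torus_T" for s
      proof -
        have "lincomb S (\<lambda>v. lmon v s) (\<lambda>v. \<chi> i j. lmon v t * A v $ i $ j) = \<phi> (tmul s t)"
          by (simp add: \<phi>[OF torus_T_tmul[OF s t]] lincomb_def lmon_tmul mult.assoc)
        also have "\<dots> = lincomb S (\<lambda>v. lmon v s) (\<lambda>v. A v ** lincomb S (\<lambda>w. lmon w t) A)"
          by (simp add: mult[OF s t] \<phi>[OF s] \<phi>[OF t] lincomb_mult_right)
        finally show ?thesis .
      qed
      from lincomb_coeff_eq[OF S this vw(1)] show ?thesis by (simp add: lincomb_mult_left)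
    qed
    have "lincomb S (\<lambda>w. lmon w t) (\<lambda>w. A v ** A w) = lincomb S (\<lambda>w. lmon w t) (\<lambda>w. if w = v then A v else 0)"
      if "t \<in> torus_T" for t
      unfolding 1[OF that] by (rule lincomb_single[symmetric, OF S vw(1)]) simp
    from lincomb_coeff_eq[OF S this vw(2)] show ?thesis by auto
  qed
  \<comment> \<open>An invertible idempotent is the identity.\<close>
  have one: "\<phi> 1 = mat 1"
  proof -
    have "invertible (\<phi> 1)"
      using iso torus_T_one unfolding alg_torus_iso_def bij_betw_def complex_points_def by blast
    moreover have "\<phi> 1 ** \<phi> 1 = \<phi> 1"
      using mult[OF torus_T_one torus_T_one] by (simp add: tmul_def one_vec_def)
    ultimately show ?thesis by (metis matrix_inv_left matrix_mul_assoc matrix_mul_lid)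
  qed
  have \<phi>A: "\<phi> t ** A w = (\<chi> i j. lmon w t * A w $ i $ j)" if "t \<in> torus_T" "w \<in> S" for t w
    unfolding \<phi>[OF that(1)] lincomb_mult_right by (rule lincomb_single[OF S that(2)]) (simp add: orth that(2))
  \<comment> \<open>A nonzero column of \<open>A w\<close> is a weight vector for \<open>w\<close>.
    Conversely, a coordinate of \<open>\<phi> t *v v = lmon w t *s v\<close> is an identity of
    Laurent polynomials, so the monomial of a weight must occur in the expansion.\<close>
  have W: "weights \<phi> = {w \<in> S. A w \<noteq> 0}"
  proof (rule set_eqI, rule iffI)
    fix w assume "w \<in> {w \<in> S. A w \<noteq> 0}"
    then have w: "w \<in> S" "A w \<noteq> 0" by auto
    then obtain i j where ij: "A w $ i $ j \<noteq> 0" by (auto simp: vec_eq_iff)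
    define v where "v = A w *v axis j 1"
    have "v $ i = A w $ i $ j" 
      by (simp add: v_def matrix_vector_mult_def axis_def if_distrib cong: if_cong)
    then have "v \<noteq> 0" using ij by auto
    moreover have "\<phi> t *v v = (\<Prod>i\<in>UNIV. (t $ i) powi (w $ i)) *s v" if "t \<in> torus_T" for t
    proof -
      have "\<phi> t *v v = (\<phi> t ** A w) *v axis j 1" by (simp add: v_def matrix_vector_mul_assoc)
      also have "\<dots> = lmon w t *s v"
        unfolding \<phi>A[OF that w(1)] v_def by (simp add: vec_eq_iff matrix_vector_mult_def sum_distrib_left mult.assoc)
      finally show ?thesis by (simp add: lmon_def)
    qed
    ultimately show "w \<in> weights \<phi>" unfolding weights_def by blast
  next
    fix w assume "w \<in> weights \<phi>"
    then obtain v where v: "v \<noteq> 0" "\<And>t. t \<in> torus_T \<Longrightarrow> \<phi> t *v v = lmon w t *s v"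
      unfolding weights_def lmon_def by blast
    obtain i where i: "v $ i \<noteq> 0" using v(1) by (auto simp: vec_eq_iff)
    \<comment> \<open>The coefficients of the difference of the two sides, on
      \<open>insert w S\<close> because \<open>w\<close> is not yet known to lie in
      \<open>S\<close>.\<close>
    define x where "x u = (if u \<in> S then (A u *v v) $ i else 0) - (if u = w then v $ i else 0)" for u
    have "x w = 0"
    proof (rule lmon_independent[of "insert w S"])
      fix t :: "complex^'m" assume t: "t \<in> torus_T"
      have "(\<Sum>u\<in>insert w S. (if u \<in> S then (A u *v v) $ i else 0) * lmon u t) = (\<Sum>u\<in>S. (A u *v v) $ i * lmon u t)"
        using S by (intro sum.mono_neutral_cong_right) auto
      also have "\<dots> = (\<phi> t *v v) $ i"
        unfolding \<phi>[OF t] by (simp add: matrix_vector_mult_def lincomb_nth sum_distrib_right sum_distrib_left, subst sum.swap) (simp add: mult_ac)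
      also have "\<dots> = lmon w t * v $ i" by (simp add: v(2)[OF t])
      finally have 1: "(\<Sum>u\<in>insert w S. (if u \<in> S then (A u *v v) $ i else 0) * lmon u t) = lmon w t * v $ i" .
      have "(\<Sum>u\<in>insert w S. (if u = w then v $ i else 0) * lmon u t) = (\<Sum>u\<in>insert w S. if u = w then v $ i * lmon w t else 0)"
        by (intro sum.cong) auto
      also have "\<dots> = lmon w t * v $ i" using S by simp
      finally show "(\<Sum>u\<in>insert w S. x u * lmon u t) = 0"
        using 1 by (simp add: x_def left_diff_distrib sum_subtractf del: sum.insert_if)
    qed (use S in auto)
    then have "w \<in> S \<and> (A w *v v) $ i \<noteq> 0" using i by (auto simp: x_def split: if_splits)
    then show "w \<in> {w \<in> S. A w \<noteq> 0}" by auto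
  qed
  have restr: "lincomb S f A = lincomb (weights \<phi>) f A" for f
    unfolding lincomb_def W using S by (intro arg_cong[of _ _ vec_lambda] ext sum.mono_neutral_right) auto
  have "lincomb (weights \<phi>) (\<lambda>_. 1) A = mat 1"
    using \<phi>[OF torus_T_one] by (simp add: one restr)
  moreover have "finite (weights \<phi>)" using S by (simp add: W)
  ultimately show ?thesis using \<phi> orth unfolding restr by (intro exI[of _ A]) (simp add: W)
qed

section \<open>Orthogonality, real structure and symmetry of the weights\<close>

lemma poly_fun_continuous:
  fixes p :: "('i \<Rightarrow> complex) \<Rightarrow> complex"
  assumes "p \<in> poly_fun" "\<And>i. continuous_on S (\<lambda>x. f x i)"
  shows "continuous_on S (\<lambda>x. p (f x))"
  using assms(1) by induction (auto intro!: continuous_intros assms(2))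

lemma lmon_cnj:
  assumes "t \<in> circle_torus"
  shows "cnj (lmon w t) = lmon (- w) t"
proof -
  have "cnj (t $ i) = inverse (t $ i)" for i
  proof -
    have "t $ i * cnj (t $ i) = 1"
      using assms complex_norm_square[of "t $ i"] by (simp add: circle_torus_def)
    then show ?thesis by (metis inverse_unique)
  qed
  then have "cnj (lmon w t) = lmon w (\<chi> i. inverse (t $ i))" by (simp add: lmon_def)
  then show ?thesis by (simp add: lmon_inverse lmon_uminus)
qed

lemma circle_torus_torus_T: "(circle_torus :: (complex^'m) set) \<subseteq> torus_T"
proof
  fix z :: "complex^'m" assume "z \<in> circle_torus"
  then have "cmod (z $ i) = 1" for i by (simp add: circle_torus_def)
  then have "z $ i \<noteq> 0" for i by (metis norm_zero zero_neq_one)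
  then show "z \<in> torus_T" by (simp add: torus_T_def)
qed

lemma poly_fun_complexify:
  fixes p :: "('i \<Rightarrow> real) \<Rightarrow> real"
  assumes "p \<in> poly_fun"
  shows "\<exists>q\<in>poly_fun. \<forall>x. q (\<lambda>i. complex_of_real (x i)) = complex_of_real (p x)"
  using assms
proof induction
  case (const c)
  show ?case by (rule bexI[of _ "\<lambda>_. complex_of_real c"]) (auto intro: poly_fun.intros)
next
  case (var i)
  show ?case by (rule bexI[of _ "\<lambda>x. x i"]) (auto intro: poly_fun.intros)
next
  case (add p q)
  then obtain p' q' where "p' \<in> poly_fun" "\<forall>x. p' (\<lambda>i. complex_of_real (x i)) = complex_of_real (p x)"
    "q' \<in> poly_fun" "\<forall>x. q' (\<lambda>i. complex_of_real (x i)) = complex_of_real (q x)" by blast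
  then show ?case by (intro bexI[of _ "\<lambda>x. p' x + q' x"]) (auto intro: poly_fun.intros)
next
  case (mult p q)
  then obtain p' q' where "p' \<in> poly_fun" "\<forall>x. p' (\<lambda>i. complex_of_real (x i)) = complex_of_real (p x)"
    "q' \<in> poly_fun" "\<forall>x. q' (\<lambda>i. complex_of_real (x i)) = complex_of_real (q x)" by blast
  then show ?case by (intro bexI[of _ "\<lambda>x. p' x * q' x"]) (auto intro: poly_fun.intros)
qed

lemma mcoords_cmat: "mcoords (cmat g) = (\<lambda>i. complex_of_real (mcoords g i))"
  by (auto simp: mcoords_def cmat_nth fun_eq_iff)

locale euclidean_torus =
  fixes Q :: "real^'n^'n" and G :: "(real^'n^'n) set" and \<phi> :: "complex^'m \<Rightarrow> complex^'n^'n"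
  assumes datum: "torus_datum Q G \<phi>"
begin

abbreviation X where "X \<equiv> weights \<phi>"

text \<open>The projections onto the weight spaces. Their values outside \<open>X\<close> are
  arbitrary, so statements about them are confined to \<open>X\<close>.\<close>

definition proj :: "int^'m \<Rightarrow> complex^'n^'n" where
  "proj = (SOME A. finite (weights \<phi>) \<and> (\<forall>t\<in>torus_T. \<phi> t = lincomb (weights \<phi>) (\<lambda>w. lmon w t) A) \<and>
    (\<forall>w\<in>weights \<phi>. A w \<noteq> 0) \<and>
    (\<forall>v\<in>weights \<phi>. \<forall>w\<in>weights \<phi>. A v ** A w = (if v = w then A w else 0)) \<and>
    lincomb (weights \<phi>) (\<lambda>_. 1) A = mat 1)"

lemma iso: "alg_torus_iso G \<phi>"
  using datum by (simp add: torus_datum_def)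

lemma
  shows finite_X: "finite X"
    and \<phi>_eq: "t \<in> torus_T \<Longrightarrow> \<phi> t = lincomb X (\<lambda>w. lmon w t) proj"
    and proj_nonzero: "w \<in> X \<Longrightarrow> proj w \<noteq> 0"
    and proj_mult: "v \<in> X \<Longrightarrow> w \<in> X \<Longrightarrow> proj v ** proj w = (if v = w then proj w else 0)"
    and sum_proj: "lincomb X (\<lambda>_. 1) proj = mat 1"
  using someI_ex[OF weight_decomposition[OF iso], folded proj_def] by auto

lemma \<phi>_mult: "s \<in> torus_T \<Longrightarrow> t \<in> torus_T \<Longrightarrow> \<phi> (tmul s t) = \<phi> s ** \<phi> t"
  using iso unfolding alg_torus_iso_def tmul_def by blast

lemma \<phi>_inj: "inj_on \<phi> torus_T" and \<phi>_image: "\<phi> ` torus_T = complex_points G"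
  using iso by (auto simp: alg_torus_iso_def bij_betw_def)

lemma \<phi>_one: "\<phi> 1 = mat 1"
  using \<phi>_eq[OF torus_T_one] sum_proj by simp

lemma \<phi>_inverse:
  assumes "t \<in> torus_T"
  shows "\<phi> t ** \<phi> (\<chi> i. inverse (t $ i)) = mat 1"
proof -
  have "tmul t (\<chi> i. inverse (t $ i)) = 1"
    using assms by (simp add: tmul_def vec_eq_iff torus_T_def)
  then show ?thesis using \<phi>_mult[OF assms torus_T_inverse[OF assms]] \<phi>_one by simp
qed

lemma Q_sym: "transpose Q = Q"
  and Q_pos: "v \<noteq> 0 \<Longrightarrow> v \<bullet> (Q *v v) > 0"
  and G_inv: "g \<in> G \<Longrightarrow> invertible g \<and> matrix_inv g \<in> G"
  and G_mult: "g \<in> G \<Longrightarrow> h \<in> G \<Longrightarrow> g ** h \<in> G"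
  and G_closed: "zariski_closed_real G"
  and G_orth: "g \<in> G \<Longrightarrow> transpose g ** Q ** g = Q"
  using datum by (auto simp: torus_datum_def)

lemma Q_invertible: "invertible Q"
proof -
  have "v = 0" if "Q *v v = 0" for v using Q_pos[of v] that by force
  then show ?thesis unfolding invertible_left_inverse matrix_left_invertible_ker by blast
qed

lemma cmat_Q_inv: "cmat (matrix_inv Q) ** cmat Q = mat 1" "cmat Q ** cmat (matrix_inv Q) = mat 1"
  using matrix_inv_left[OF Q_invertible] matrix_inv_right[OF Q_invertible]
  by (simp_all flip: cmat_mult add: cmat_mat_one)

lemma Qtransp_nth: "Qtransp Q M $ i $ j =
    (\<Sum>k\<in>UNIV. \<Sum>l\<in>UNIV. of_real (matrix_inv Q $ i $ l) * M $ k $ l * of_real (Q $ k $ j))"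
  by (simp add: Qtransp_def matrix_mult_nth cmat_nth transpose_def sum_distrib_right)

lemma Qtransp_lincomb: "Qtransp Q (lincomb S f A) = lincomb S f (\<lambda>w. Qtransp Q (A w))"
proof -
  have "transpose (lincomb S f A) = lincomb S f (\<lambda>w. transpose (A w))"
    by (simp add: vec_eq_iff lincomb_nth transpose_def)
  then show ?thesis by (simp add: Qtransp_def lincomb_mult_left lincomb_mult_right)
qed

lemma Qtransp_mult: "Qtransp Q (A ** B) = Qtransp Q B ** Qtransp Q A"
proof -
  have "Qtransp Q B ** Qtransp Q A = cmat (matrix_inv Q) ** transpose B ** (cmat Q ** cmat (matrix_inv Q)) ** transpose A ** cmat Q"
    by (simp add: Qtransp_def matrix_mul_assoc)
  then show ?thesis by (simp add: Qtransp_def cmat_Q_inv matrix_transpose_mul matrix_mul_assoc)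
qed

lemma Qtransp_Qtransp: "Qtransp Q (Qtransp Q A) = A"
proof -
  have "transpose (cmat Q) = cmat Q" using Q_sym by (simp flip: cmat_transpose)
  moreover have "transpose (cmat (matrix_inv Q)) = cmat (matrix_inv Q)"
  proof -
    have "transpose (cmat (matrix_inv Q)) ** cmat Q = transpose (cmat Q ** cmat (matrix_inv Q))"
      using \<open>transpose (cmat Q) = cmat Q\<close> by (simp add: matrix_transpose_mul)
    then have "transpose (cmat (matrix_inv Q)) ** cmat Q = mat 1" by (simp add: cmat_Q_inv transpose_mat)
    then have "transpose (cmat (matrix_inv Q)) ** (cmat Q ** cmat (matrix_inv Q)) = cmat (matrix_inv Q)"
      by (simp add: matrix_mul_assoc)
    then show ?thesis by (simp add: cmat_Q_inv)
  qed
  ultimately have "Qtransp Q (Qtransp Q A) = (cmat (matrix_inv Q) ** cmat Q) ** A ** (cmat (matrix_inv Q) ** cmat Q)"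
    by (simp add: Qtransp_def matrix_transpose_mul matrix_mul_assoc)
  then show ?thesis by (simp add: cmat_Q_inv)
qed

lemma Qtransp_diff: "Qtransp Q (A - B) = Qtransp Q A - Qtransp Q B"
  by (simp add: vec_eq_iff Qtransp_nth algebra_simps sum_subtractf)

lemma trace_Qtransp: "trace (Qtransp Q A) = trace A"
proof -
  have "trace (Qtransp Q A) = trace (cmat Q ** (cmat (matrix_inv Q) ** transpose A))"
    unfolding Qtransp_def by (rule trace_mul_sym)
  also have "\<dots> = trace (transpose A)" by (simp add: matrix_mul_assoc cmat_Q_inv)
  finally show ?thesis by (simp add: trace_def transpose_def)
qed

lemma complex_points_vanish:
  assumes "x \<in> complex_points G" "p \<in> poly_fun" "\<And>g. g \<in> G \<Longrightarrow> p (mcoords (cmat g)) = 0"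
  shows "p (mcoords x) = 0"
  using assms by (simp add: complex_points_def)

text \<open>Preservation of \<open>Q\<close> is a system of polynomial equations valid on
  \<open>G\<close>, hence on its complex points.\<close>

lemma complex_points_orth:
  assumes "x \<in> complex_points G"
  shows "Qtransp Q x ** x = mat 1"
proof -
  have "transpose x ** cmat Q ** x = cmat Q"
  proof -
    have "(transpose x ** cmat Q ** x) $ i $ j = cmat Q $ i $ j" for i j
    proof -
      let ?p = "\<lambda>c :: 'n \<times> 'n \<Rightarrow> complex. (\<Sum>k\<in>UNIV. (\<Sum>l\<in>UNIV. c (l, i) * of_real (Q $ l $ k)) * c (k, j)) - of_real (Q $ i $ j)"
      have p: "?p (mcoords y) = (transpose y ** cmat Q ** y) $ i $ j - cmat Q $ i $ j" for y
        by (simp add: mcoords_def matrix_mult_nth transpose_def cmat_nth)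
      have "?p \<in> poly_fun" by (intro poly_fun_diff poly_fun_sum poly_fun.intros)
      moreover have "?p (mcoords (cmat g)) = 0" if "g \<in> G" for g
        unfolding p using arg_cong[OF G_orth[OF that], of cmat]
        by (simp add: cmat_mult cmat_transpose)
      ultimately have "?p (mcoords x) = 0" by (rule complex_points_vanish[OF assms, of ?p])
      then show ?thesis unfolding p by simp
    qed
    then show ?thesis by (simp add: vec_eq_iff)
  qed
  then show ?thesis by (simp add: Qtransp_def cmat_Q_inv flip: matrix_mul_assoc)
qed

lemma Qtransp_\<phi>:
  assumes "t \<in> torus_T"
  shows "Qtransp Q (\<phi> t) = \<phi> (\<chi> i. inverse (t $ i))"
proof -
  have "Qtransp Q (\<phi> t) ** (\<phi> t ** \<phi> (\<chi> i. inverse (t $ i))) = \<phi> (\<chi> i. inverse (t $ i))"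
    using complex_points_orth[of "\<phi> t"] assms by (simp add: matrix_mul_assoc imageI flip: \<phi>_image)
  then show ?thesis using \<phi>_inverse[OF assms] by simp
qed

text \<open>The transpose of \<open>\<phi> t\<close> is \<open>\<phi>\<close> of the inverse of
  \<open>t\<close>. Comparing Laurent coefficients over the union of \<open>X\<close> and its
  negative shows that the transpose of \<open>proj w\<close> is the coefficient at
  \<open>- w\<close>; it is nonzero because transposition is an involution.\<close>

lemma X_symmetric: "w \<in> X \<Longrightarrow> - w \<in> X" and Qtransp_proj: "w \<in> X \<Longrightarrow> Qtransp Q (proj w) = proj (- w)"
proof -
  have main: "- w \<in> X \<and> Qtransp Q (proj w) = proj (- w)" if w: "w \<in> X"
  proof -
    let ?S = "X \<union> uminus ` X"
    define B where "B v = (if v \<in> X then Qtransp Q (proj v) else 0)" for v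
    define C where "C v = (if - v \<in> X then proj (- v) else 0)" for v
    have fin: "finite ?S" using finite_X by simp
    have mem: "v \<in> uminus ` X \<longleftrightarrow> - v \<in> X" for v by (metis image_iff minus_minus)
    have "lincomb ?S (\<lambda>w. lmon w t) B = lincomb ?S (\<lambda>w. lmon w t) C" if t: "t \<in> torus_T" for t
    proof -
      have "lincomb ?S (\<lambda>w. lmon w t) B = lincomb X (\<lambda>w. lmon w t) (\<lambda>w. Qtransp Q (proj w))"
        unfolding lincomb_def using fin
        by (intro arg_cong[of _ _ vec_lambda] ext sum.mono_neutral_cong_right) (auto simp: B_def)
      also have "\<dots> = \<phi> (\<chi> i. inverse (t $ i))"
        using Qtransp_\<phi>[OF t] by (simp add: \<phi>_eq[OF t] Qtransp_lincomb)
      also have "\<dots> = lincomb X (\<lambda>w. lmon (- w) t) proj"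
        by (simp add: \<phi>_eq[OF torus_T_inverse[OF t]] lmon_inverse lmon_uminus)
      also have "\<dots> = lincomb (uminus ` X) (\<lambda>w. lmon w t) (\<lambda>w. proj (- w))"
        by (simp add: lincomb_def sum.reindex)
      also have "\<dots> = lincomb ?S (\<lambda>w. lmon w t) C"
        unfolding lincomb_def using fin
        by (intro arg_cong[of _ _ vec_lambda] ext sum.mono_neutral_cong_left) (auto simp: C_def mem)
      finally show ?thesis .
    qed
    from lincomb_coeff_eq[OF fin this, of w] w
    have eq: "Qtransp Q (proj w) = (if - w \<in> X then proj (- w) else 0)" by (simp add: B_def C_def)
    have "Qtransp Q (proj w) \<noteq> 0"
    proof
      assume "Qtransp Q (proj w) = 0"
      then have "Qtransp Q 0 = proj w" using Qtransp_Qtransp[of "proj w"] by simp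
      moreover have "Qtransp Q 0 = 0" by (simp add: vec_eq_iff Qtransp_nth)
      ultimately show False using proj_nonzero[OF w] by simp
    qed
    then show ?thesis using eq by (auto split: if_splits)
  qed
  show "w \<in> X \<Longrightarrow> - w \<in> X" "w \<in> X \<Longrightarrow> Qtransp Q (proj w) = proj (- w)" using main by auto
qed

text \<open>A real vector \<open>a \<noteq> 0\<close> orthogonal to all weights would make
  \<open>texp a\<close> act trivially, so \<open>texp a = 1\<close> by injectivity of
  \<open>\<phi>\<close>. The exponential of a real number is 1 only at 0, hence
  \<open>a = 0\<close>.\<close>

lemma symmetric_spanning_X: "symmetric_spanning X"
proof -
  have "span (rvec ` X) = UNIV"
  proof (rule ccontr)
    assume "span (rvec ` X) \<noteq> UNIV"
    then obtain a where a: "a \<noteq> 0" "\<And>x. x \<in> span (rvec ` X) \<Longrightarrow> a \<bullet> x = 0"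
      using orthogonal_to_subspace_exists_gen[of "rvec ` X" UNIV] by (auto simp: orthogonal_def psubset_eq)
    let ?t = "texp (\<chi> i. complex_of_real (a $ i))"
    have "lmon w ?t = 1" if "w \<in> X" for w
    proof -
      have "(\<Sum>i\<in>UNIV. real_of_int (w $ i) * a $ i) = 0"
        using a(2)[OF span_base[OF imageI[OF that]]] by (simp add: inner_vec_def rvec_def mult.commute)
      from arg_cong[OF this, of complex_of_real] show ?thesis by (simp add: lmon_texp)
    qed
    then have "lincomb X (\<lambda>w. lmon w ?t) proj = mat 1"
      using sum_proj lincomb_cong[of X "\<lambda>w. lmon w ?t" "\<lambda>_. 1" proj proj] by simp
    then have "\<phi> ?t = \<phi> 1" by (simp add: \<phi>_eq[OF torus_T_texp] \<phi>_one)
    then have "?t = 1" using \<phi>_inj torus_T_texp torus_T_one by (auto dest: inj_onD)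
    then have "exp (complex_of_real (a $ i)) = 1" for i by (simp add: texp_def vec_eq_iff)
    then have "exp (a $ i) = 1" for i by (metis exp_of_real of_real_eq_1_iff)
    then show False using a(1) by (simp add: vec_eq_iff)
  qed
  then show ?thesis using finite_X X_symmetric by (simp add: symmetric_spanning_def)
qed

section \<open>The compact torus inside the complex points\<close>

text \<open>The preimage of \<open>G\<close> in the torus. It turns out to be the unit torus:
  boundedness of \<open>G\<close> puts it inside, and density together with the closedness of
  \<open>G\<close> gives the converse.\<close>

definition real_part :: "(complex^'m) set" where
  "real_part = {t \<in> torus_T. \<exists>g\<in>G. \<phi> t = cmat g}"

lemma cmat_complex_points: "g \<in> G \<Longrightarrow> cmat g \<in> complex_points G"
proof -
  assume g: "g \<in> G"
  have "cmat g ** cmat (matrix_inv g) = mat 1" "cmat (matrix_inv g) ** cmat g = mat 1"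
    using matrix_inv_left[of g] matrix_inv_right[of g] G_inv[OF g] by (simp_all flip: cmat_mult add: cmat_mat_one)
  then have "invertible (cmat g)" by (auto simp: invertible_def)
  then show ?thesis using g by (auto simp: complex_points_def)
qed

lemma exists_real_part:
  assumes "g \<in> G"
  shows "\<exists>t\<in>real_part. \<phi> t = cmat g"
proof -
  obtain t where "t \<in> torus_T" "\<phi> t = cmat g"
    using cmat_complex_points[OF assms] \<phi>_image by (metis imageE)
  then show ?thesis using assms by (auto simp: real_part_def)
qed

lemma real_part_mult: "s \<in> real_part \<Longrightarrow> t \<in> real_part \<Longrightarrow> tmul s t \<in> real_part"
  using G_mult by (auto simp: real_part_def \<phi>_mult torus_T_tmul simp flip: cmat_mult)

lemma real_part_inverse:
  assumes "t \<in> real_part"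
  shows "(\<chi> i. inverse (t $ i)) \<in> real_part"
proof -
  obtain g where g: "t \<in> torus_T" "g \<in> G" "\<phi> t = cmat g" using assms by (auto simp: real_part_def)
  have "cmat (matrix_inv g) ** (\<phi> t ** \<phi> (\<chi> i. inverse (t $ i))) = \<phi> (\<chi> i. inverse (t $ i))"
    using matrix_inv_left[of g] G_inv[OF g(2)] by (simp add: matrix_mul_assoc g(3) flip: cmat_mult) (simp add: cmat_mat_one)
  then have "\<phi> (\<chi> i. inverse (t $ i)) = cmat (matrix_inv g)" by (simp add: \<phi>_inverse[OF g(1)])
  then show ?thesis using g(1) G_inv[OF g(2)] torus_T_inverse by (auto simp: real_part_def)
qed

definition qcoord :: "'m \<Rightarrow> ('n \<times> 'n \<Rightarrow> complex) \<Rightarrow> complex" where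
  "qcoord = (SOME q. \<forall>l. q l \<in> poly_fun \<and> (\<forall>t\<in>torus_T. q l (mcoords (\<phi> t)) = t $ l))"

lemma qcoord: "qcoord l \<in> poly_fun" "t \<in> torus_T \<Longrightarrow> qcoord l (mcoords (\<phi> t)) = t $ l"
proof -
  have "\<exists>q\<in>poly_fun. \<forall>t\<in>torus_T. q (mcoords (\<phi> t)) = t $ l" for l
  proof -
    obtain q where q: "q \<in> poly_fun" "\<And>x. x \<in> complex_points G \<Longrightarrow> inv_into torus_T \<phi> x $ l = q (mcoords x)"
      using iso unfolding alg_torus_iso_def by blast
    have "q (mcoords (\<phi> t)) = t $ l" if "t \<in> torus_T" for t
      using q(2)[of "\<phi> t"] \<phi>_image \<phi>_inj that by (metis imageI inv_into_f_f)
    then show ?thesis using q(1) by blast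
  qed
  then have "\<exists>q. \<forall>l. q l \<in> poly_fun \<and> (\<forall>t\<in>torus_T. q l (mcoords (\<phi> t)) = t $ l)" by metis
  from someI_ex[OF this, folded qcoord_def]
  show "qcoord l \<in> poly_fun" "t \<in> torus_T \<Longrightarrow> qcoord l (mcoords (\<phi> t)) = t $ l" by auto
qed

text \<open>Zariski density of \<open>G\<close> in its complex points, carried to the torus:
  substituting \<open>qcoord\<close> for the coordinates turns the Laurent polynomial, with
  denominators cleared, into a polynomial in matrix entries.\<close>

lemma real_part_dense:
  assumes "finite S" "\<And>t. t \<in> real_part \<Longrightarrow> (\<Sum>w\<in>S. x w * lmon w t) = 0" "w \<in> S"
  shows "x w = 0"
proof (rule lmon_independent[OF assms(1) _ assms(3)])
  fix t :: "complex^'m" assume t: "t \<in> torus_T"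
  obtain k e where e: "\<And>v t. v \<in> S \<Longrightarrow> t \<in> torus_T \<Longrightarrow> lmon k t * lmon v t = (\<Prod>i\<in>UNIV. (t $ i) ^ e v i)"
    using lmon_clear_denominators[OF assms(1)] by blast
  let ?P = "\<lambda>c. \<Sum>w\<in>S. x w * (\<Prod>i\<in>UNIV. qcoord i c ^ e w i)"
  have P: "?P (mcoords (\<phi> s)) = lmon k s * (\<Sum>w\<in>S. x w * lmon w s)" if "s \<in> torus_T" for s
    using that by (simp add: qcoord sum_distrib_left mult.left_commute e)
  have "?P \<in> poly_fun" by (intro poly_fun_sum poly_fun_prod poly_fun_power poly_fun.intros qcoord)
  moreover have "?P (mcoords (cmat g)) = 0" if g: "g \<in> G" for g
  proof -
    obtain s where "s \<in> real_part" "\<phi> s = cmat g" using exists_real_part[OF g] by blast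
    then show ?thesis using P[of s] assms(2)[of s] by (simp add: real_part_def)
  qed
  moreover have "\<phi> t \<in> complex_points G" using t \<phi>_image by blast
  ultimately have "?P (mcoords (\<phi> t)) = 0" using complex_points_vanish[of "\<phi> t" ?P] by simp
  then show "(\<Sum>w\<in>S. x w * lmon w t) = 0" using P[OF t] lmon_nonzero[OF t, of k] by simp
qed

lemma compact_G: "compact G"
proof -
  obtain \<psi> where \<psi>: "continuous_on circle_torus \<psi>" "bij_betw \<psi> (circle_torus :: (complex^'m) set) G"
    using datum unfolding torus_datum_def by blast
  have "bounded (circle_torus :: (complex^'m) set)"
  proof (rule boundedI)
    fix z :: "complex^'m" assume "z \<in> circle_torus"
    then show "norm z \<le> real CARD('m)"
      using L2_set_le_sum[of UNIV "\<lambda>i. cmod (z $ i)"] by (simp add: norm_vec_def circle_torus_def)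
  qed
  moreover have "closed (circle_torus :: (complex^'m) set)"
    unfolding circle_torus_def by (intro closed_Collect_all closed_Collect_eq continuous_intros)
  ultimately have "compact (circle_torus :: (complex^'m) set)" by (simp add: compact_eq_bounded_closed)
  then have "compact (\<psi> ` circle_torus)" using \<psi>(1) by (intro compact_continuous_image)
  then show ?thesis using \<psi>(2) by (simp add: bij_betw_def)
qed

lemma real_part_bounded: "\<exists>M. \<forall>t\<in>real_part. cmod (t $ l) \<le> M"
proof -
  have "continuous_on G (\<lambda>g. qcoord l (mcoords (cmat g)))"
    by (rule poly_fun_continuous[OF qcoord(1), where f = "\<lambda>g. mcoords (cmat g)"])
      (auto simp: mcoords_def cmat_nth case_prod_unfold intro!: continuous_intros)
  then have "compact ((\<lambda>g. qcoord l (mcoords (cmat g))) ` G)" using compact_G by (rule compact_continuous_image)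
  then obtain M where M: "\<And>g. g \<in> G \<Longrightarrow> cmod (qcoord l (mcoords (cmat g))) \<le> M"
    by (metis (no_types, lifting) bounded_iff compact_imp_bounded imageI)
  have "cmod (t $ l) \<le> M" if t: "t \<in> real_part" for t
  proof -
    obtain g where "g \<in> G" "\<phi> t = cmat g" "t \<in> torus_T" using t by (auto simp: real_part_def)
    then show ?thesis using M[of g] qcoord(2)[of t l] by simp
  qed
  then show ?thesis by blast
qed

text \<open>All powers of \<open>t\<close> lie in the bounded group \<open>real_part\<close>, so no
  coordinate has modulus above 1; the same holds for the inverse of \<open>t\<close>.\<close>

lemma real_part_circle:
  assumes "t \<in> real_part"
  shows "cmod (t $ l) = 1"
proof -
  obtain M where M: "\<And>t. t \<in> real_part \<Longrightarrow> cmod (t $ l) \<le> M" using real_part_bounded by blast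
  have le: "cmod (t $ l) \<le> 1" if t: "t \<in> real_part" for t
  proof (rule ccontr)
    assume "\<not> ?thesis"
    then obtain n where n: "M < cmod (t $ l) ^ n" using real_arch_pow[of "cmod (t $ l)" M] by auto
    have "(\<chi> i. (t $ i) ^ Suc k) \<in> real_part" for k
    proof (induction k)
      case (Suc k)
      from real_part_mult[OF t Suc] show ?case by (simp add: tmul_def)
    qed (use t in simp)
    from M[OF this[of n]] have "cmod (t $ l) ^ Suc n \<le> M" by (simp add: norm_mult norm_power)
    moreover have "cmod (t $ l) ^ n \<le> cmod (t $ l) ^ Suc n"
      using \<open>\<not> _\<close> by (intro power_increasing) auto
    ultimately show False using n by linarith
  qed
  have "t $ l \<noteq> 0" using assms by (simp add: real_part_def torus_T_def)
  moreover have "inverse (cmod (t $ l)) \<le> 1" using le[OF real_part_inverse[OF assms]] by (simp add: norm_inverse)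
  ultimately show ?thesis using le[OF assms] by (simp add: field_simps)
qed

text \<open>For \<open>t\<close> in the real part \<open>\<phi> t\<close> is real and conjugation
  replaces \<open>lmon w t\<close> by \<open>lmon (- w) t\<close>. Density allows the coefficients
  to be compared.\<close>

lemma cnj_proj:
  assumes "w \<in> X"
  shows "cnj (proj w $ i $ j) = proj (- w) $ i $ j"
proof -
  have "proj v $ i $ j - cnj (proj (- v) $ i $ j) = 0" if "v \<in> X" for v
  proof (rule real_part_dense[OF finite_X _ that])
    fix t assume t: "t \<in> real_part"
    then obtain g where g: "\<phi> t = cmat g" "t \<in> torus_T" by (auto simp: real_part_def)
    have circ: "t \<in> circle_torus" using real_part_circle[OF t] by (simp add: circle_torus_def)
    have "cnj (\<phi> t $ i $ j) = \<phi> t $ i $ j" by (simp add: g(1) cmat_nth)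
    then have "(\<Sum>w\<in>X. lmon (- w) t * cnj (proj w $ i $ j)) = (\<Sum>w\<in>X. lmon w t * proj w $ i $ j)"
      by (simp add: \<phi>_eq[OF g(2)] lincomb_nth lmon_cnj[OF circ])
    moreover have "(\<Sum>w\<in>X. lmon (- w) t * cnj (proj w $ i $ j)) = (\<Sum>w\<in>X. lmon w t * cnj (proj (- w) $ i $ j))"
      by (rule sum.reindex_bij_witness[of _ uminus uminus]) (auto intro: X_symmetric)
    ultimately show "(\<Sum>w\<in>X. (proj w $ i $ j - cnj (proj (- w) $ i $ j)) * lmon w t) = 0"
      by (simp add: algebra_simps sum_subtractf)
  qed
  from this[OF X_symmetric[OF assms]] show ?thesis by simp
qed

lemma circle_torus_real:
  assumes "t \<in> circle_torus"
  shows "\<exists>g\<in>G. \<phi> t = cmat g"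
proof -
  have t: "t \<in> torus_T" using assms circle_torus_torus_T by blast
  have "cnj (\<phi> t $ i $ j) = \<phi> t $ i $ j" for i j
  proof -
    have "cnj (\<phi> t $ i $ j) = (\<Sum>w\<in>X. lmon (- w) t * proj (- w) $ i $ j)"
      by (simp add: \<phi>_eq[OF t] lincomb_nth lmon_cnj[OF assms] cnj_proj)
    also have "\<dots> = (\<Sum>w\<in>X. lmon w t * proj w $ i $ j)"
      by (rule sum.reindex_bij_witness[of _ uminus uminus]) (auto intro: X_symmetric)
    finally show ?thesis by (simp add: \<phi>_eq[OF t] lincomb_nth)
  qed
  then have "complex_of_real (Re (\<phi> t $ i $ j)) = \<phi> t $ i $ j" for i j
    by (metis Reals_cnj_iff of_real_Re)
  then have g: "cmat (\<chi> i j. Re (\<phi> t $ i $ j)) = \<phi> t" by (simp add: vec_eq_iff cmat_nth)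
  \<comment> \<open>A real equation of \<open>G\<close>, read over the complex numbers, holds at
    \<open>\<phi> t\<close>; since \<open>\<phi> t\<close> is real, it holds for the real matrix,
    and \<open>G\<close> is Zariski closed.\<close>
  have "(\<chi> i j. Re (\<phi> t $ i $ j)) \<in> G"
  proof (rule G_closed[unfolded zariski_closed_real_def, THEN spec, THEN mp], intro ballI impI)
    fix p :: "('n \<times> 'n \<Rightarrow> real) \<Rightarrow> real"
    assume p: "p \<in> poly_fun" "\<forall>g\<in>G. p (mcoords g) = 0"
    obtain q where q: "q \<in> poly_fun" "\<And>x. q (\<lambda>i. complex_of_real (x i)) = complex_of_real (p x)"
      using poly_fun_complexify[OF p(1)] by blast
    have "q (mcoords (cmat g)) = 0" if "g \<in> G" for g using p(2) q(2) that by (simp add: mcoords_cmat)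
    moreover have "\<phi> t \<in> complex_points G" using t \<phi>_image by blast
    ultimately have "q (mcoords (cmat (\<chi> i j. Re (\<phi> t $ i $ j)))) = 0"
      using complex_points_vanish[of "\<phi> t" q] q(1) unfolding g by simp
    then show "p (mcoords (\<chi> i j. Re (\<phi> t $ i $ j))) = 0" using q(2) by (simp add: mcoords_cmat)
  qed
  then show ?thesis using g by metis
qed

end

section \<open>The ED equations as critical point equations\<close>

text \<open>Used to lift a differentiable curve in \<open>G\<close> to the torus, whose coordinates
  are polynomials in the matrix entries.\<close>

lemma poly_fun_vector_differentiable:
  fixes p :: "('i \<Rightarrow> complex) \<Rightarrow> complex"
  assumes "p \<in> poly_fun" "\<And>i. \<exists>d. ((\<lambda>\<tau>. f \<tau> i) has_vector_derivative d) (at (x :: real))"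
  shows "\<exists>d. ((\<lambda>\<tau>. p (f \<tau>)) has_vector_derivative d) (at x)"
  using assms(1)
proof induction
  case (const c)
  show ?case by (rule exI, rule has_vector_derivative_const)
next
  case (var i)
  show ?case by (rule assms(2))
next
  case (add p q)
  then show ?case by (elim exE) (rule exI, rule has_vector_derivative_add)
next
  case (mult p q)
  then show ?case by (elim exE) (rule exI, rule has_vector_derivative_mult)
qed

lemma has_vector_derivative_prod_at_one:
  fixes f :: "'i \<Rightarrow> real \<Rightarrow> complex"
  assumes "finite S" "\<And>i. i \<in> S \<Longrightarrow> (f i has_vector_derivative d i) (at x)" "\<And>i. i \<in> S \<Longrightarrow> f i x = 1"
  shows "((\<lambda>\<tau>. \<Prod>i\<in>S. f i \<tau>) has_vector_derivative (\<Sum>i\<in>S. d i)) (at x)"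
  using assms
proof (induction S rule: finite_induct)
  case (insert i S)
  have "((\<lambda>\<tau>. f i \<tau> * (\<Prod>i\<in>S. f i \<tau>)) has_vector_derivative
      f i x * (\<Sum>i\<in>S. d i) + d i * (\<Prod>i\<in>S. f i x)) (at x)"
    by (rule has_vector_derivative_mult) (use insert in auto)
  moreover have "(\<Prod>i\<in>S. f i x) = 1" using insert.prems by simp
  ultimately show ?case using insert by (simp add: add.commute)
qed (simp add: has_vector_derivative_const)

lemma lmon_vector_derivative_at_one:
  fixes t :: "real \<Rightarrow> complex^'m"
  assumes "\<And>i. ((\<lambda>\<tau>. t \<tau> $ i) has_vector_derivative \<xi> $ i) (at x)" "t x = 1"
  shows "((\<lambda>\<tau>. lmon w (t \<tau>)) has_vector_derivative wlin w \<xi>) (at x)"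
  unfolding lmon_def wlin_def
proof (rule has_vector_derivative_prod_at_one)
  fix i
  have "((\<lambda>z. z powi (w $ i)) has_field_derivative of_int (w $ i)) (at (t x $ i))"
    by (auto intro!: derivative_eq_intros simp: assms(2))
  from field_vector_diff_chain_at[OF assms(1) this]
  show "((\<lambda>\<tau>. (t \<tau> $ i) powi (w $ i)) has_vector_derivative of_int (w $ i) * \<xi> $ i) (at x)"
    by (simp add: o_def mult.commute)
qed (auto simp: assms(2))

text \<open>Bridges the two kinds of polynomials: the generic condition of
  \<open>has_ED_degree\<close> is a real polynomial in the entries of \<open>u\<close>, while the
  coefficients of the Laurent polynomial are complex.\<close>

definition cpoly :: "(('i \<Rightarrow> real) \<Rightarrow> complex) set" where
  "cpoly = {f. (\<lambda>x. Re (f x)) \<in> poly_fun \<and> (\<lambda>x. Im (f x)) \<in> poly_fun}"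

lemma cpoly_const: "(\<lambda>_. c) \<in> cpoly"
  and cpoly_var: "(\<lambda>x. complex_of_real (x i)) \<in> cpoly"
  and cpoly_add: "f \<in> cpoly \<Longrightarrow> g \<in> cpoly \<Longrightarrow> (\<lambda>x. f x + g x) \<in> cpoly"
  and cpoly_mult: "f \<in> cpoly \<Longrightarrow> g \<in> cpoly \<Longrightarrow> (\<lambda>x. f x * g x) \<in> cpoly"
  unfolding cpoly_def by (auto intro!: poly_fun.intros poly_fun_diff)

lemma cpoly_sum: "(\<And>i. i \<in> I \<Longrightarrow> f i \<in> cpoly) \<Longrightarrow> (\<lambda>x. \<Sum>i\<in>I. f i x) \<in> cpoly"
  by (induction I rule: infinite_finite_induct) (auto intro: cpoly_const cpoly_add)

lemma cpoly_compose:
  assumes "p \<in> poly_fun" "\<And>w. (\<lambda>x. f x w) \<in> cpoly"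
  shows "(\<lambda>x. p (f x)) \<in> cpoly"
  using assms(1) by induction (auto intro: cpoly_const cpoly_add cpoly_mult assms(2))

context euclidean_torus
begin

text \<open>For real \<open>\<xi>\<close> the one-parameter group
  \<open>\<tau> \<mapsto> exp (\<i> \<tau> \<xi>)\<close> of the unit torus is mapped by
  \<open>\<phi>\<close> into \<open>G\<close>. Its velocity \<open>R \<xi>\<close> is the
  combination of the \<open>proj w\<close> with coefficients
  \<open>\<i> (w \<bullet> \<xi>)\<close>, and complex combinations of such velocities give every
  \<open>\<zeta>\<close>.\<close>

lemma lie_alg_C_contains: "lincomb X (\<lambda>w. wlin w \<zeta>) proj \<in> lie_alg_C G"
proof -
  define R where "R \<xi> = (\<Sum>w\<in>X. - ((rvec w \<bullet> \<xi>) *\<^sub>R (\<chi> i j. Im (proj w $ i $ j))))" for \<xi> :: "real^'m"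
  have R_lie: "R \<xi> \<in> lie_alg G" for \<xi>
  proof -
    define t where "t \<tau> = texp (\<chi> i. \<i> * complex_of_real (\<tau> * \<xi> $ i))" for \<tau> :: real
    have t: "t \<tau> \<in> circle_torus" for \<tau>
      by (simp add: t_def texp_def circle_torus_def)
    have lm: "lmon w (t \<tau>) = cis (\<tau> * (rvec w \<bullet> \<xi>))" for w \<tau>
    proof -
      have "(\<Sum>i\<in>UNIV. of_int (w $ i) * (\<i> * complex_of_real (\<tau> * \<xi> $ i))) = \<i> * complex_of_real (\<tau> * (rvec w \<bullet> \<xi>))"
        by (simp add: inner_vec_def rvec_def sum_distrib_left mult_ac)
      then show ?thesis by (simp add: t_def lmon_texp cis_conv_exp)
    qed
    define \<gamma> where "\<gamma> \<tau> = (\<Sum>w\<in>X. cos (\<tau> * (rvec w \<bullet> \<xi>)) *\<^sub>R (\<chi> i j. Re (proj w $ i $ j)) - sin (\<tau> * (rvec w \<bullet> \<xi>)) *\<^sub>R (\<chi> i j. Im (proj w $ i $ j)))" for \<tau>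
    have Re_\<phi>: "\<gamma> \<tau> $ i $ j = Re (\<phi> (t \<tau>) $ i $ j)" for \<tau> i j
      using subsetD[OF circle_torus_torus_T t[of \<tau>]]
      by (simp add: \<gamma>_def \<phi>_eq lincomb_nth lm sum_component)
    have "\<gamma> \<tau> \<in> G" for \<tau>
    proof -
      obtain g where g: "g \<in> G" "\<phi> (t \<tau>) = cmat g" using circle_torus_real[OF t[of \<tau>]] by blast
      then have "\<gamma> \<tau> = g" by (simp add: vec_eq_iff Re_\<phi> cmat_nth)
      then show ?thesis using g by simp
    qed
    moreover have "\<gamma> 0 = mat 1"
    proof -
      have "t 0 = 1" by (simp add: t_def texp_def vec_eq_iff)
      then have "\<gamma> 0 $ i $ j = mat 1 $ i $ j" for i j unfolding Re_\<phi> by (simp add: \<phi>_one mat_def)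
      then show ?thesis by (simp add: vec_eq_iff)
    qed
    moreover have "(\<gamma> has_vector_derivative R \<xi>) (at 0)"
      unfolding \<gamma>_def R_def
      by (auto intro!: derivative_eq_intros)
    ultimately show ?thesis unfolding lie_alg_def by blast
  qed
  have R_eq: "complex_of_real (R \<xi> $ i $ j) = (\<Sum>w\<in>X. \<i> * complex_of_real (rvec w \<bullet> \<xi>) * proj w $ i $ j)" for \<xi> i j
  proof -
    let ?S = "\<Sum>w\<in>X. \<i> * complex_of_real (rvec w \<bullet> \<xi>) * proj w $ i $ j"
    have "cnj ?S = (\<Sum>w\<in>X. \<i> * complex_of_real (rvec (- w) \<bullet> \<xi>) * proj (- w) $ i $ j)"
      by (simp add: cnj_proj rvec_uminus)
    also have "\<dots> = ?S"
      by (rule sum.reindex_bij_witness[of _ uminus uminus]) (auto intro: X_symmetric)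
    finally have "?S \<in> \<real>" by (simp only: Reals_cnj_iff)
    then have "complex_of_real (Re ?S) = ?S" by (rule of_real_Re)
    moreover have "Re ?S = R \<xi> $ i $ j" by (simp add: R_def sum_component)
    ultimately show ?thesis by (simp only:)
  qed
  \<comment> \<open>Chosen so that \<open>\<zeta> = \<i> a - b\<close>; the velocities already carry
    a factor \<open>\<i>\<close>.\<close>
  define a b where "a = (\<chi> i. Im (\<zeta> $ i))" and "b = (\<chi> i. - Re (\<zeta> $ i))"
  have "lincomb X (\<lambda>w. wlin w \<zeta>) proj = (\<chi> i j. complex_of_real (R a $ i $ j) + \<i> * complex_of_real (R b $ i $ j))"
  proof -
    have wl: "wlin w \<zeta> = \<i> * complex_of_real (rvec w \<bullet> a) - complex_of_real (rvec w \<bullet> b)" for w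
      by (simp add: wlin_def a_def b_def rvec_def inner_vec_def complex_eq_iff sum_negf)
    show ?thesis
      unfolding R_eq wl by (simp add: vec_eq_iff lincomb_nth sum_distrib_left algebra_simps flip: sum.distrib)
  qed
  then show ?thesis using R_lie unfolding lie_alg_C_def by blast
qed

text \<open>The curve is pulled back to the torus, where it is differentiable at 0 through the
  polynomial inverse \<open>qcoord\<close>; the Laurent expansion of \<open>\<phi>\<close> is then
  differentiated at 1.\<close>

lemma lie_alg_in_span:
  assumes "B \<in> lie_alg G"
  shows "\<exists>\<xi>. cmat B = lincomb X (\<lambda>w. wlin w \<xi>) proj"
proof -
  obtain \<gamma> where \<gamma>: "\<gamma> 0 = mat 1" "\<And>\<tau>. \<gamma> \<tau> \<in> G" "(\<gamma> has_vector_derivative B) (at 0)"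
    using assms unfolding lie_alg_def by blast
  have entry: "((\<lambda>\<tau>. cmat (\<gamma> \<tau>) $ i $ j) has_vector_derivative cmat B $ i $ j) (at 0)" for i j
  proof -
    have "bounded_linear (\<lambda>M :: real^'n^'n. complex_of_real (M $ i $ j))"
      by (intro bounded_linear_compose[OF bounded_linear_of_real]
          bounded_linear_compose[OF bounded_linear_vec_nth] bounded_linear_vec_nth)
    from bounded_linear.has_vector_derivative[OF this \<gamma>(3)] show ?thesis by (simp add: cmat_nth)
  qed
  have "\<exists>t. t \<in> torus_T \<and> \<phi> t = cmat (\<gamma> \<tau>)" for \<tau>
    using exists_real_part[OF \<gamma>(2)[of \<tau>]] by (auto simp: real_part_def)
  then obtain t where t: "\<And>\<tau>. t \<tau> \<in> torus_T" "\<And>\<tau>. \<phi> (t \<tau>) = cmat (\<gamma> \<tau>)" by metis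
  have "\<phi> (t 0) = \<phi> 1" by (simp add: t(2) \<gamma>(1) \<phi>_one cmat_mat_one)
  then have t0: "t 0 = 1" using \<phi>_inj t(1) torus_T_one by (auto dest: inj_onD)
  have "\<exists>d. ((\<lambda>\<tau>. t \<tau> $ l) has_vector_derivative d) (at 0)" for l
  proof -
    have "\<exists>d. ((\<lambda>\<tau>. mcoords (cmat (\<gamma> \<tau>)) ij) has_vector_derivative d) (at 0)" for ij
      using entry by (cases ij) (auto simp: mcoords_def)
    from poly_fun_vector_differentiable[where f = "\<lambda>\<tau>. mcoords (cmat (\<gamma> \<tau>))", OF qcoord(1)[of l] this]
    show ?thesis using qcoord(2)[OF t(1), of l] by (simp add: t(2))
  qed
  then obtain d where "\<And>l. ((\<lambda>\<tau>. t \<tau> $ l) has_vector_derivative d l) (at 0)" by metis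
  then have \<xi>: "((\<lambda>\<tau>. t \<tau> $ l) has_vector_derivative (\<chi> l. d l) $ l) (at 0)" for l by simp
  have "cmat B $ i $ j = lincomb X (\<lambda>w. wlin w (\<chi> l. d l)) proj $ i $ j" for i j
  proof (rule vector_derivative_unique_at[OF entry])
    have "((\<lambda>\<tau>. \<Sum>w\<in>X. lmon w (t \<tau>) * proj w $ i $ j) has_vector_derivative
        (\<Sum>w\<in>X. wlin w (\<chi> l. d l) * proj w $ i $ j)) (at 0)"
      by (intro has_vector_derivative_sum has_vector_derivative_mult_left lmon_vector_derivative_at_one \<xi> t0)
    then show "((\<lambda>\<tau>. cmat (\<gamma> \<tau>) $ i $ j) has_vector_derivative
        lincomb X (\<lambda>w. wlin w (\<chi> l. d l)) proj $ i $ j) (at 0)"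
      by (simp add: \<phi>_eq[OF t(1)] lincomb_nth flip: t(2))
  qed
  then show ?thesis by (auto simp: vec_eq_iff)
qed

lemma lie_alg_C_eq: "lie_alg_C G = range (\<lambda>\<zeta>. lincomb X (\<lambda>w. wlin w \<zeta>) proj)"
proof
  show "range (\<lambda>\<zeta>. lincomb X (\<lambda>w. wlin w \<zeta>) proj) \<subseteq> lie_alg_C G" using lie_alg_C_contains by blast
  show "lie_alg_C G \<subseteq> range (\<lambda>\<zeta>. lincomb X (\<lambda>w. wlin w \<zeta>) proj)"
  proof
    fix M assume "M \<in> lie_alg_C G"
    then obtain A B where AB: "A \<in> lie_alg G" "B \<in> lie_alg G"
      and M: "M = (\<chi> i j. complex_of_real (A $ i $ j) + \<i> * complex_of_real (B $ i $ j))"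
      unfolding lie_alg_C_def by blast
    obtain \<xi> \<eta> where "cmat A = lincomb X (\<lambda>w. wlin w \<xi>) proj" "cmat B = lincomb X (\<lambda>w. wlin w \<eta>) proj"
      using AB lie_alg_in_span by meson
    then have *: "complex_of_real (A $ i $ j) = (\<Sum>w\<in>X. wlin w \<xi> * proj w $ i $ j)"
      "complex_of_real (B $ i $ j) = (\<Sum>w\<in>X. wlin w \<eta> * proj w $ i $ j)" for i j
      by (simp_all flip: cmat_nth lincomb_nth)
    have "wlin w (\<xi> + \<i> *s \<eta>) = wlin w \<xi> + \<i> * wlin w \<eta>" for w
      by (simp add: wlin_def algebra_simps sum.distrib sum_distrib_left)
    then have "M = lincomb X (\<lambda>w. wlin w (\<xi> + \<i> *s \<eta>)) proj"
      unfolding M * by (simp add: vec_eq_iff lincomb_nth algebra_simps sum.distrib sum_distrib_left)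
    then show "M \<in> range (\<lambda>\<zeta>. lincomb X (\<lambda>w. wlin w \<zeta>) proj)" by blast
  qed
qed

definition lcoeff :: "complex^'n^'n \<Rightarrow> int^'m \<Rightarrow> complex" where
  "lcoeff M w = trace (Qtransp Q M ** proj w)"

text \<open>The terms of \<open>w\<close> and \<open>- w\<close> cancel. This eliminates the part of
  the ED equations that does not involve \<open>u\<close>.\<close>

lemma trace_lie_alg_zero: "(\<Sum>w\<in>X. wlin w \<zeta> * trace (proj w)) = 0"
proof -
  have "wlin (- w) \<zeta> = - wlin w \<zeta>" for w by (simp add: wlin_def sum_negf)
  moreover have "trace (proj (- w)) = trace (proj w)" if "w \<in> X" for w
    using Qtransp_proj[OF that] trace_Qtransp by metis
  moreover have "(\<Sum>w\<in>X. wlin w \<zeta> * trace (proj w)) = (\<Sum>w\<in>X. wlin (- w) \<zeta> * trace (proj (- w)))"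
    by (rule sum.reindex_bij_witness[of _ uminus uminus]) (auto intro: X_symmetric)
  ultimately have "(\<Sum>w\<in>X. wlin w \<zeta> * trace (proj w)) = - (\<Sum>w\<in>X. wlin w \<zeta> * trace (proj w))"
    by (simp add: sum_negf)
  then show ?thesis by simp
qed

text \<open>With \<open>x = \<phi> t\<close> and \<open>A\<close> in the Lie algebra the pairing is
  \<open>tr (M\<^sup>t x A) - tr (x\<^sup>t x A)\<close>. The second trace is
  \<open>tr A = 0\<close>, and orthogonality of the projections gives \<open>x A\<close> the
  coefficients \<open>lmon w t * wlin w \<zeta>\<close>.\<close>

lemma ed_pairing:
  assumes "t \<in> torus_T"
  shows "Qpair Q (Qtransp Q (\<phi> t) ** (M - \<phi> t)) (lincomb X (\<lambda>w. wlin w \<zeta>) proj) =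
    (\<Sum>i\<in>UNIV. \<zeta> $ i * crit_eq X (lcoeff M) i t)"
proof -
  let ?x = "\<phi> t" and ?A = "lincomb X (\<lambda>w. wlin w \<zeta>) proj"
  have xx: "Qtransp Q ?x ** ?x = mat 1" using complex_points_orth \<phi>_image assms by blast
  have xA: "?x ** ?A = lincomb X (\<lambda>w. lmon w t * wlin w \<zeta>) proj"
  proof -
    have "proj v ** ?A = (\<chi> i j. wlin v \<zeta> * proj v $ i $ j)" if "v \<in> X" for v
      unfolding lincomb_mult_left
      by (rule lincomb_single[OF finite_X that]) (simp add: proj_mult that)
    then show ?thesis
      unfolding \<phi>_eq[OF assms] lincomb_mult_right
      by (simp add: vec_eq_iff lincomb_nth mult.assoc)
  qed
  have "Qpair Q (Qtransp Q ?x ** (M - ?x)) ?A = trace (Qtransp Q (M - ?x) ** (?x ** ?A))"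
    by (simp add: Qpair_def Qtransp_mult Qtransp_Qtransp matrix_mul_assoc)
  also have "Qtransp Q (M - ?x) ** (?x ** ?A) = Qtransp Q M ** (?x ** ?A) - ?A"
    using xx by (simp add: Qtransp_diff matrix_mult_diff_left matrix_mul_assoc)
  also have "trace \<dots> = trace (Qtransp Q M ** (?x ** ?A)) - trace ?A" by (rule trace_sub)
  also have "trace ?A = 0" by (simp add: trace_lincomb trace_lie_alg_zero)
  also have "trace (Qtransp Q M ** (?x ** ?A)) = (\<Sum>w\<in>X. lmon w t * wlin w \<zeta> * lcoeff M w)"
    unfolding xA by (simp add: lincomb_mult_left trace_lincomb lcoeff_def)
  also have "\<dots> = (\<Sum>w\<in>X. \<Sum>i\<in>UNIV. \<zeta> $ i * (lcoeff M w * of_int (w $ i) * lmon w t))"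
    by (simp add: wlin_def sum_distrib_left sum_distrib_right mult_ac)
  also have "\<dots> = (\<Sum>i\<in>UNIV. \<zeta> $ i * crit_eq X (lcoeff M) i t)"
    by (subst sum.swap) (simp add: crit_eq_def sum_distrib_left)
  finally show ?thesis by simp
qed

lemma ed_sols_eq: "ed_sols Q G u = \<phi> ` crit_points X (lcoeff (cmat u))"
proof -
  have "(\<forall>A\<in>lie_alg_C G. Qpair Q (Qtransp Q (\<phi> t) ** (cmat u - \<phi> t)) A = 0) \<longleftrightarrow>
      (\<forall>i. crit_eq X (lcoeff (cmat u)) i t = 0)" if t: "t \<in> torus_T" for t
  proof
    assume *: "\<forall>A\<in>lie_alg_C G. Qpair Q (Qtransp Q (\<phi> t) ** (cmat u - \<phi> t)) A = 0"
    show "\<forall>i. crit_eq X (lcoeff (cmat u)) i t = 0"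
    proof
      fix i
      have "0 = (\<Sum>l\<in>UNIV. axis i 1 $ l * crit_eq X (lcoeff (cmat u)) l t)"
        using * ed_pairing[OF t, of "cmat u" "axis i 1"] unfolding lie_alg_C_eq by simp
      also have "\<dots> = (\<Sum>l\<in>UNIV. if l = i then crit_eq X (lcoeff (cmat u)) l t else 0)"
        by (intro sum.cong) (auto simp: axis_def)
      finally show "crit_eq X (lcoeff (cmat u)) i t = 0" by simp
    qed
  qed (auto simp: lie_alg_C_eq ed_pairing[OF t])
  then show ?thesis unfolding ed_sols_def crit_points_def \<phi>_image[symmetric] by blast
qed

lemma lcoeff_linear: "lcoeff (\<chi> i j. A $ i $ j + s * B $ i $ j) w = lcoeff A w + s * lcoeff B w"
  by (simp add: lcoeff_def trace_def matrix_mult_nth Qtransp_nth algebra_simps sum.distrib sum_distrib_left)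

text \<open>It suffices to find matrices dual to the projections under the trace. A multiple
  \<open>E\<close> of a matrix unit picks a nonzero entry of \<open>proj w\<close>, and
  \<open>proj w ** E\<close> also annihilates the other projections by cyclicity of the
  trace.\<close>

lemma lcoeff_surj:
  shows "\<exists>M. \<forall>w\<in>X. lcoeff M w = c w"
proof -
  have "\<exists>N. (\<forall>v\<in>X. trace (N ** proj v) = (if v = w then 1 else 0))" if w: "w \<in> X" for w
  proof -
    obtain i j where ij: "proj w $ i $ j \<noteq> 0" using proj_nonzero[OF w] by (auto simp: vec_eq_iff)
    define E :: "complex^'n^'n" where "E = (\<chi> k l. if k = j then if l = i then 1 / proj w $ i $ j else 0 else 0)"
    have "trace (E ** proj w) = 1"
    proof -
      have "(\<Sum>l\<in>UNIV. E $ k $ l * proj w $ l $ k) = (if k = j then 1 else 0)" for k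
      proof -
        have "(\<Sum>l\<in>UNIV. E $ k $ l * proj w $ l $ k) = (\<Sum>l\<in>UNIV. if l = i then (if k = j then 1 else 0) else 0)"
          using ij by (intro sum.cong) (auto simp: E_def)
        then show ?thesis by simp
      qed
      then show ?thesis by (simp add: trace_def matrix_mult_nth)
    qed
    moreover have "trace ((proj w ** E) ** proj v) = trace (E ** (proj v ** proj w))" for v
    proof -
      have "trace ((proj w ** E) ** proj v) = trace (proj w ** (E ** proj v))" by (simp add: matrix_mul_assoc)
      also have "\<dots> = trace ((E ** proj v) ** proj w)" by (rule trace_mul_sym)
      finally show ?thesis by (simp add: matrix_mul_assoc)
    qed
    ultimately have "trace ((proj w ** E) ** proj v) = (if v = w then 1 else 0)" if "v \<in> X" for v
      using that w by (simp add: proj_mult trace_def)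
    then show ?thesis by blast
  qed
  then obtain N where N: "\<And>w v. w \<in> X \<Longrightarrow> v \<in> X \<Longrightarrow> trace (N w ** proj v) = (if v = w then 1 else 0)" by metis
  have "lcoeff (Qtransp Q (lincomb X c N)) v = c v" if "v \<in> X" for v
  proof -
    have "lcoeff (Qtransp Q (lincomb X c N)) v = (\<Sum>w\<in>X. c w * (if v = w then 1 else 0))"
      using that by (simp add: lcoeff_def Qtransp_Qtransp lincomb_mult_right trace_lincomb N)
    also have "\<dots> = c v" using that finite_X by (simp add: if_distrib cong: if_cong)
    finally show ?thesis .
  qed
  then show ?thesis by blast
qed

text \<open>Surjectivity yields a complex matrix \<open>a + \<i> b\<close> where \<open>p\<close>
  does not vanish. On the complex line \<open>a + s b\<close> there are finitely many zeros, so some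
  real \<open>s\<close> gives a real matrix with nonzero value. The squared modulus turns the
  complex condition into a real polynomial.\<close>

lemma generic_pullback:
  assumes p: "p \<in> poly_fun" "depends_on X p" "p \<noteq> (\<lambda>_. 0)"
  shows "\<exists>P\<in>poly_fun. P \<noteq> (\<lambda>_. 0) \<and> (\<forall>u. P (mcoords u) \<noteq> 0 \<longrightarrow> p (lcoeff (cmat u)) \<noteq> 0)"
proof -
  define m where "m x = (\<chi> i j. complex_of_real (x (i, j)))" for x :: "'n \<times> 'n \<Rightarrow> real"
  have m: "m (mcoords u) = cmat u" for u by (simp add: m_def vec_eq_iff cmat_nth mcoords_def)
  define f where "f x = p (lcoeff (m x))" for x
  have "(\<lambda>x. lcoeff (m x) w) \<in> cpoly" for w
    unfolding lcoeff_def trace_def matrix_mult_nth Qtransp_nth m_def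
    by (auto intro!: cpoly_sum cpoly_mult cpoly_const cpoly_var)
  then have f: "f \<in> cpoly" unfolding f_def by (rule cpoly_compose[OF p(1)])
  define P where "P x = Re (f x) * Re (f x) + Im (f x) * Im (f x)" for x
  have "P \<in> poly_fun" using f unfolding P_def cpoly_def by (auto intro!: poly_fun.intros)
  moreover have P0: "P x \<noteq> 0 \<longleftrightarrow> f x \<noteq> 0" for x
    unfolding P_def complex_eq_iff by (simp add: sum_squares_eq_zero_iff)
  moreover have "P \<noteq> (\<lambda>_. 0)"
  proof -
    obtain c where c: "p c \<noteq> 0" using p(3) by (auto simp: fun_eq_iff)
    obtain M where M: "\<forall>w\<in>X. lcoeff M w = c w" using lcoeff_surj by blast
    then have "p (lcoeff M) = p c" using p(2) by (simp add: depends_on_def)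
    define a b where "a = (\<chi> i j. Re (M $ i $ j))" and "b = (\<chi> i j. Im (M $ i $ j))"
    have line: "lcoeff (\<chi> i j. cmat a $ i $ j + s * cmat b $ i $ j) = (\<lambda>w. lcoeff (cmat a) w + s * lcoeff (cmat b) w)" for s
      by (rule ext) (rule lcoeff_linear)
    have "(\<chi> i j. cmat a $ i $ j + \<i> * cmat b $ i $ j) = M"
      by (simp add: vec_eq_iff cmat_nth a_def b_def complex_eq_iff)
    then have "p (\<lambda>w. lcoeff (cmat a) w + \<i> * lcoeff (cmat b) w) \<noteq> 0"
      using line[of \<i>] c \<open>p (lcoeff M) = p c\<close> by simp
    from poly_fun_line_zeros_finite[OF p(1) this]
    have "finite (complex_of_real -` {s. p (\<lambda>w. lcoeff (cmat a) w + s * lcoeff (cmat b) w) = 0})"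
      by (rule finite_vimageI) (simp add: inj_on_def)
    then obtain s where "s \<notin> complex_of_real -` {s. p (\<lambda>w. lcoeff (cmat a) w + s * lcoeff (cmat b) w) = 0}"
      using ex_new_if_finite[OF infinite_UNIV_char_0] by blast
    then have "p (lcoeff (\<chi> i j. cmat a $ i $ j + complex_of_real s * cmat b $ i $ j)) \<noteq> 0" by (simp add: line)
    moreover have "(\<chi> i j. cmat a $ i $ j + complex_of_real s * cmat b $ i $ j) = m (\<lambda>(i, j). a $ i $ j + s * b $ i $ j)"
      by (simp add: m_def vec_eq_iff cmat_nth)
    ultimately have "f (\<lambda>(i, j). a $ i $ j + s * b $ i $ j) \<noteq> 0" by (simp add: f_def)
    then show ?thesis using P0 by (auto simp: fun_eq_iff)
  qed
  ultimately show ?thesis using m by (metis f_def)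
qed

lemma has_ED_degree:
  assumes "p \<in> poly_fun" "depends_on X p" "p \<noteq> (\<lambda>_. 0)"
    and card: "\<And>c. p c \<noteq> 0 \<Longrightarrow> finite (crit_points X c) \<and> card (crit_points X c) = d"
  shows "has_ED_degree Q G d"
proof -
  obtain P where P: "P \<in> poly_fun" "P \<noteq> (\<lambda>_. 0)" "\<And>u. P (mcoords u) \<noteq> 0 \<Longrightarrow> p (lcoeff (cmat u)) \<noteq> 0"
    using generic_pullback[OF assms(1-3)] by blast
  have "finite (ed_sols Q G u) \<and> card (ed_sols Q G u) = d" if "P (mcoords u) \<noteq> 0" for u
  proof -
    have "inj_on \<phi> (crit_points X (lcoeff (cmat u)))"
      using \<phi>_inj by (rule inj_on_subset) (auto simp: crit_points_def)
    then show ?thesis using card[OF P(3)[OF that]] by (simp add: ed_sols_eq card_image)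
  qed
  then show ?thesis unfolding has_ED_degree_def using P(1,2) by blast
qed

end

text \<open>Two nonzero polynomials are simultaneously nonzero somewhere. This makes the definite
  description in \<open>ED_degree\<close> well defined.\<close>

lemma has_ED_degree_unique:
  assumes "has_ED_degree Q G d" "has_ED_degree Q G e"
  shows "d = e"
proof -
  obtain p where p: "p \<in> poly_fun" "p \<noteq> (\<lambda>_. 0)" "\<And>u. p (mcoords u) \<noteq> 0 \<Longrightarrow> card (ed_sols Q G u) = d"
    using assms(1) unfolding has_ED_degree_def by blast
  obtain q where q: "q \<in> poly_fun" "q \<noteq> (\<lambda>_. 0)" "\<And>u. q (mcoords u) \<noteq> 0 \<Longrightarrow> card (ed_sols Q G u) = e"
    using assms(2) unfolding has_ED_degree_def by blast
  from poly_fun_mult_nonzero[OF p(1) q(1) p(2) q(2)]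
  obtain x where x: "p x * q x \<noteq> 0" by (auto simp only: fun_eq_iff)
  have "mcoords (\<chi> i j. x (i, j)) = x" by (simp add: mcoords_def fun_eq_iff)
  then show ?thesis using p(3)[of "\<chi> i j. x (i, j)"] q(3)[of "\<chi> i j. x (i, j)"] x by simp
qed

lemma ED_degree_eqI: "has_ED_degree Q G d \<Longrightarrow> ED_degree Q G = d"
  unfolding ED_degree_def by (rule the_equality) (auto intro: has_ED_degree_unique)

theorem theorem3p5:
  fixes Q :: "real^'n^'n" and G :: "(real^'n^'n) set" and \<phi> :: "complex^'m \<Rightarrow> complex^'n^'n"
    and Q' :: "real^'k^'k" and G' :: "(real^'k^'k) set" and \<phi>' :: "complex^'m \<Rightarrow> complex^'k^'k"
  assumes "torus_datum Q G \<phi>" and "torus_datum Q' G' \<phi>'"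
  shows "(weights \<phi>' = weights \<phi> \<longrightarrow> ED_degree Q' G' = ED_degree Q G)
         \<and> real (ED_degree Q G) \<le> norm_vol (weights \<phi>)"
proof -
  interpret T: euclidean_torus Q G \<phi> by standard (rule assms(1))
  interpret T': euclidean_torus Q' G' \<phi>' by standard (rule assms(2))
  \<comment> \<open>\<open>p\<close> and \<open>d\<close> are obtained from the set of weights
    alone, so they serve both data when these sets agree.\<close>
  obtain p d where p: "p \<in> poly_fun" "depends_on (weights \<phi>) p" "p \<noteq> (\<lambda>_. 0)"
    and card: "\<And>c. p c \<noteq> 0 \<Longrightarrow> finite (crit_points (weights \<phi>) c) \<and> card (crit_points (weights \<phi>) c) = d"
    and d: "real d \<le> norm_vol (weights \<phi>)"
    using generic_card_crit_points[OF T.symmetric_spanning_X] by blast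
  have "ED_degree Q G = d" by (rule ED_degree_eqI, rule T.has_ED_degree[OF p card])
  moreover have "ED_degree Q' G' = d" if "weights \<phi>' = weights \<phi>"
    by (rule ED_degree_eqI, rule T'.has_ED_degree[of p, unfolded that, OF p card])
  ultimately show ?thesis using d by simp
qed

end
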